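(* There exist Anosov structures on $\mathbb{R}^2$ with arbitrarily high finite degree of inaccessibility; that is, for every positive integer $N$ there is an Anosov structure on $\mathbb{R}^2$ whose degree of inaccessibility is finite and at least $N$. Moreover, these can be chosen so that the underlying diffeomorphism is fixed-point free, and they can also be chosen so that the underlying diffeomorphism has a fixed point.
   Context: An Anosov structure on $\mathbb{R}^2$ for a diffeomorphism $f:\mathbb{R}^2\to\mathbb{R}^2$ (the underlying diffeomorphism) consists of a complete Riemannian metric $\mu$ on $\mathbb{R}^2$ together with two continuous one-dimensional foliations $\mathcal{F}^s$ (stable) and $\mathcal{F}^u$ (unstable) of $\mathbb{R}^2$ with $C^1$ leaves, each respected by $f$ (the image under $f$ of a leaf of $\mathcal{F}^s$, resp. $\mathcal{F}^u$, is a leaf of $\mathcal{F}^s$, resp. $\mathcal{F}^u$), such that there exist constants $C>0$ and $\lambda>1$ for which, for every positive integer $n$, $\|Df^n(v)\|_\mu\ge C\lambda^n\|v\|_\mu$ for every vector $v$ tangent to a leaf of $\mathcal{F}^u$, and $\|Df^n(v)\|_\mu\le C\lambda^{-n}\|v\|_\mu$ for every vector $v$ tangent to a leaf of $\mathcal{F}^s$. Here $\|v\|_\mu$ is the length of $v$ in the metric $\mu$. Given an Anosov structure and points $p,q\in\mathbb{R}^2$, $q$ is $n$-accessible from $p$ if there is a path from $p$ to $q$ consisting of arcs of leaves of $\mathcal{F}^s$ and $\mathcal{F}^u$ as follows: there is a finite sequence of points $p=p_0,p_1,\dots,p_n=q$ such that for each $i=0,\dots,n-1$ the points $p_i$ and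 $p_{i+1}$ lie in the same stable leaf or in the same unstable leaf. Put $\mathcal{N}(p,q)=\min\{n : q\text{ is }n\text{-accessible from }p\}$ (which is finite for every pair $p,q$). The degree of inaccessibility of the Anosov structure is $\sup_{p,q\in\mathbb{R}^2}\mathcal{N}(p,q)$. *)

theory Defs
  imports "HOL-Analysis.Analysis"
begin

type_synonym plane = "real \<times> real"

subsection \<open>Diffeomorphisms and Riemannian metrics\<close>

fun Ck :: "nat \<Rightarrow> ('a::real_normed_vector \<Rightarrow> 'b::real_normed_vector) \<Rightarrow> bool" where
  "Ck 0 f \<longleftrightarrow> continuous_on UNIV f"
| "Ck (Suc k) f \<longleftrightarrow>
     (\<forall>x. f differentiable (at x)) \<and> (\<forall>v. Ck k (\<lambda>x. frechet_derivative f (at x) v))"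

definition smooth :: "('a::real_normed_vector \<Rightarrow> 'b::real_normed_vector) \<Rightarrow> bool" where
  "smooth f \<longleftrightarrow> (\<forall>k. Ck k f)"

definition diffeomorphism :: "(plane \<Rightarrow> plane) \<Rightarrow> bool" where
  "diffeomorphism f \<longleftrightarrow> bij f \<and> smooth f \<and> smooth (inv f)"

definition riemannian_metric :: "(plane \<Rightarrow> plane \<Rightarrow> plane \<Rightarrow> real) \<Rightarrow> bool" where
  "riemannian_metric \<mu> \<longleftrightarrow>
     (\<forall>p. bilinear (\<mu> p)) \<and>
     (\<forall>p v w. \<mu> p v w = \<mu> p w v) \<and>
     (\<forall>p v. v \<noteq> 0 \<longrightarrow> \<mu> p v v > 0) \<and>
     (\<forall>v w. smooth (\<lambda>p. \<mu> p v w))"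

definition riemannian_norm :: "(plane \<Rightarrow> plane \<Rightarrow> plane \<Rightarrow> real) \<Rightarrow> plane \<Rightarrow> plane \<Rightarrow> real" where
  "riemannian_norm \<mu> p v = sqrt (\<mu> p v v)"

text \<open>A \<^const>\<open>valid_path\<close> may have unbounded speed near its finitely many break points, hence
  infinite length. Using \<^const>\<open>has_integral\<close> rather than \<^const>\<open>integral\<close> keeps such paths out of
  the infimum, instead of giving them length 0.\<close>

definition riemannian_dist :: "(plane \<Rightarrow> plane \<Rightarrow> plane \<Rightarrow> real) \<Rightarrow> plane \<Rightarrow> plane \<Rightarrow> real" where
  "riemannian_dist \<mu> p q =
     Inf {l. \<exists>\<gamma>. valid_path \<gamma> \<and> pathstart \<gamma> = p \<and> pathfinish \<gamma> = q \<and>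
       ((\<lambda>t. riemannian_norm \<mu> (\<gamma> t) (vector_derivative \<gamma> (at t))) has_integral l) {0..1}}"

definition complete_riemannian_metric :: "(plane \<Rightarrow> plane \<Rightarrow> plane \<Rightarrow> real) \<Rightarrow> bool" where
  "complete_riemannian_metric \<mu> \<longleftrightarrow>
     riemannian_metric \<mu> \<and> Metric_space.mcomplete UNIV (riemannian_dist \<mu>)"

subsection \<open>Foliations\<close>

definition C1_arc :: "plane set \<Rightarrow> bool" where
  "C1_arc A \<longleftrightarrow> (\<exists>I \<gamma> \<gamma>'. open I \<and> connected I \<and> I \<noteq> {} \<and>
     (\<forall>t\<in>I. (\<gamma> has_vector_derivative \<gamma>' t) (at t) \<and> \<gamma>' t \<noteq> 0) \<and>
     continuous_on I \<gamma>' \<and> inj_on \<gamma> I \<and> A = \<gamma> ` (I :: real set))"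

text \<open>A foliated chart on \<open>U\<close> has values in a product of two open intervals. Each component of the
  trace on \<open>U\<close> of a leaf is a full horizontal slice (a plaque). That the leaves are \<open>C\<^sup>1\<close> is
  expressed by the plaques being regular \<open>C\<^sup>1\<close> arcs; no regularity across the leaves is asked for.\<close>

definition foliated_chart ::
    "plane set set \<Rightarrow> plane set \<Rightarrow> (plane \<Rightarrow> real \<times> real) \<Rightarrow> bool" where
  "foliated_chart F U \<phi> \<longleftrightarrow> open U \<and>
     (\<exists>I J \<psi>. open I \<and> connected I \<and> open J \<and> connected J \<and> homeomorphism U (I \<times> J) \<phi> \<psi>) \<and>
     (\<forall>L\<in>F. \<forall>P\<in>components (L \<inter> U). C1_arc P \<and> (\<exists>c. P = {q\<in>U. snd (\<phi> q) = c}))"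

text \<open>Path-connectedness of the leaves, as opposed to mere connectedness in the topology of the
  plane, rules out that a union of several leaves accumulating on each other counts as one leaf.\<close>

definition foliation :: "plane set set \<Rightarrow> bool" where
  "foliation F \<longleftrightarrow> partition_on UNIV F \<and> (\<forall>L\<in>F. path_connected L) \<and>
     (\<forall>p. \<exists>U \<phi>. p \<in> U \<and> foliated_chart F U \<phi>)"

definition tangent_to :: "plane set set \<Rightarrow> plane \<Rightarrow> plane \<Rightarrow> bool" where
  "tangent_to F p v \<longleftrightarrow> (\<exists>L\<in>F. \<exists>\<gamma>. \<gamma> C1_differentiable_on {-1<..<1} \<and> \<gamma> ` {-1<..<1} \<subseteq> L \<and>
     \<gamma> 0 = p \<and> (\<gamma> has_vector_derivative v) (at 0))"

definition respects_foliation :: "(plane \<Rightarrow> plane) \<Rightarrow> plane set set \<Rightarrow> bool" where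
  "respects_foliation f F \<longleftrightarrow> (\<forall>L\<in>F. f ` L \<in> F)"

subsection \<open>Anosov structures\<close>

definition anosov_structure ::
    "(plane \<Rightarrow> plane) \<Rightarrow> (plane \<Rightarrow> plane \<Rightarrow> plane \<Rightarrow> real) \<Rightarrow> plane set set \<Rightarrow> plane set set \<Rightarrow> bool" where
  "anosov_structure f \<mu> Fs Fu \<longleftrightarrow>
     diffeomorphism f \<and> complete_riemannian_metric \<mu> \<and>
     foliation Fs \<and> foliation Fu \<and> respects_foliation f Fs \<and> respects_foliation f Fu \<and>
     (\<exists>C lam. C > 0 \<and> lam > 1 \<and> (\<forall>n\<ge>1. \<forall>p v.
        (tangent_to Fu p v \<longrightarrow>
           riemannian_norm \<mu> ((f ^^ n) p) (frechet_derivative (f ^^ n) (at p) v)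
             \<ge> C * lam ^ n * riemannian_norm \<mu> p v) \<and>
        (tangent_to Fs p v \<longrightarrow>
           riemannian_norm \<mu> ((f ^^ n) p) (frechet_derivative (f ^^ n) (at p) v)
             \<le> C * inverse (lam ^ n) * riemannian_norm \<mu> p v)))"

definition accessible ::
    "plane set set \<Rightarrow> plane set set \<Rightarrow> nat \<Rightarrow> plane \<Rightarrow> plane \<Rightarrow> bool" where
  "accessible Fs Fu n p q \<longleftrightarrow> (\<exists>x :: nat \<Rightarrow> plane. x 0 = p \<and> x n = q \<and>
     (\<forall>i<n. (\<exists>L\<in>Fs. x i \<in> L \<and> x (Suc i) \<in> L) \<or> (\<exists>L\<in>Fu. x i \<in> L \<and> x (Suc i) \<in> L)))"

text \<open>The value is \<open>\<infinity>\<close> if \<open>q\<close> is not accessible from \<open>p\<close>; otherwise the infimum is a minimum.\<close>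

definition access_number ::
    "plane set set \<Rightarrow> plane set set \<Rightarrow> plane \<Rightarrow> plane \<Rightarrow> enat" where
  "access_number Fs Fu p q = (INF n\<in>{n. accessible Fs Fu n p q}. enat n)"

definition degree_of_inaccessibility :: "plane set set \<Rightarrow> plane set set \<Rightarrow> enat" where
  "degree_of_inaccessibility Fs Fu = (SUP (p, q)\<in>UNIV. access_number Fs Fu p q)"

end

(* A hyperbolic linear map A = diag(1/e, e) of the plane preserves the foliations by vertical and
horizontal lines. Pull both back along an embedding Phi of the plane onto an A-invariant open region:
the leaves become the components of the intersections of the region with axis-parallel lines, so
accessibility counts the turns of rectilinear paths inside the region.

The region consists of the points that satisfy a b osc(ln(b/a)/2) < 1 if they lie in the open first
quadrant, where osc has period 1, so that A permutes the wandering tentacles around ln(b/a)/2 = n.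
With s = ln(ab)/2 and t = ln(b/a)/2 the leaves have slope -1 or 1 in the (s, t)-plane. In a
tentacle t is confined to an interval of length < 1/2 while s gets as large as
ln(1/delta)/2, hence a path out of the tentacle needs many turns if delta is small. A zigzag around
the centre line shows that boundedly many turns suffice.

Phi(x, y) = T(x, y) (x, y) is radial; it is smooth because the deviation of T from 1 is flat
along the coordinate axes. This gives the example with a fixed point, and restricting it to
the open first quadrant gives one without. A metric kappa (dg^2 + dh^2) with Phi = (g, h) and
kappa invariant expands and contracts as required; letting kappa grow towards the
boundary of the region makes it complete. *)

theory Submission
  imports Defs
begin

subsection \<open>Smooth functions\<close>

text \<open>The radial factor solves one scalar equation. With u = 1/(xy), the image (a, b) of (x,
  y) keeps the ratio b/a = y/x and satisfies 1/(ab) = u + osc e^(-u). As u tends to 0 the right-hand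
  side decreases to osc, so in the quadrant the image fills exactly ab osc < 1; its derivative 1 -
  osc e^(-u) is positive because osc < 1; and e^(-u) is flat near the axes, where u is large.
  Completeness has to be reconciled with invariance: kappa may use only invariant quantities, here a
  function V that dominates (xy)^2. Expressed by dg and dh, however, the differential of xy carries
  the weights |h| and |g|, which are unbounded along orbits. The test functions are therefore g, h
  and V/(1 + g^2 + h^2): the denominator absorbs the weights, and bounds on all three still bound V.
  For the lower bound, one leaf can lower ab by at most a factor e while ab is at least 4e: a larger
  drop would shift t by 1/2 between two points with osc < 1/4. A starting point with ab = 4 e^N then
  needs at least N leaves to get out, which dictates \<delta> of order e^(-N).\<close>

lemma Ck_Suc_imp_Ck: "Ck (Suc k) f \<Longrightarrow> Ck k f"
proof (induction k arbitrary: f)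
  case 0
  then show ?case
    by (auto intro!: continuous_at_imp_continuous_on differentiable_imp_continuous_within)
next
  case (Suc k)
  then show ?case
    by (metis Ck.simps(2))
qed

lemma Ck_const: "Ck k (\<lambda>x. c)"
  by (induction k arbitrary: c) auto

lemma Ck_bounded_linear: "bounded_linear f \<Longrightarrow> Ck k f"
proof (induction k)
  case 0
  then show ?case by (simp add: linear_continuous_on)
next
  case (Suc k)
  have "frechet_derivative f (at x) = f" for x
    using Suc.prems by (metis bounded_linear_imp_has_derivative frechet_derivative_at)
  then show ?case
    using Suc.prems by (simp add: Ck_const bounded_linear_imp_differentiable)
qed

lemma Ck_add: "Ck k f \<Longrightarrow> Ck k g \<Longrightarrow> Ck k (\<lambda>x. f x + g x)"
proof (induction k arbitrary: f g)
  case 0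
  then show ?case by (simp add: continuous_on_add)
next
  case (Suc k)
  have "((\<lambda>x. f x + g x) has_derivative
          (\<lambda>v. frechet_derivative f (at x) v + frechet_derivative g (at x) v)) (at x)" for x
    using Suc.prems by (auto intro!: has_derivative_add simp: frechet_derivative_works)
  then have "frechet_derivative (\<lambda>x. f x + g x) (at x)
      = (\<lambda>v. frechet_derivative f (at x) v + frechet_derivative g (at x) v)" for x
    by (metis frechet_derivative_at)
  then show ?case
    using Suc by (simp add: differentiable_add)
qed

lemma Ck_mult:
  fixes f g :: "'a::real_normed_vector \<Rightarrow> real"
  shows "Ck k f \<Longrightarrow> Ck k g \<Longrightarrow> Ck k (\<lambda>x. f x * g x)"
proof (induction k arbitrary: f g)
  case 0
  then show ?case by (simp add: continuous_on_mult)
next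
  case (Suc k)
  have "((\<lambda>x. f x * g x) has_derivative
          (\<lambda>v. f x * frechet_derivative g (at x) v + frechet_derivative f (at x) v * g x)) (at x)" for x
    using Suc.prems by (auto intro!: has_derivative_mult simp: frechet_derivative_works)
  then have "frechet_derivative (\<lambda>x. f x * g x) (at x)
      = (\<lambda>v. f x * frechet_derivative g (at x) v + frechet_derivative f (at x) v * g x)" for x
    by (metis frechet_derivative_at)
  moreover have "Ck k f" "Ck k g"
    using Suc.prems by (auto intro: Ck_Suc_imp_Ck)
  ultimately show ?case
    using Suc by (simp add: differentiable_mult Ck_add)
qed

lemma Ck_Pair:
  "Ck k f \<Longrightarrow> Ck k g \<Longrightarrow> Ck k (\<lambda>x. (f x, g x))"
proof (induction k arbitrary: f g)
  case 0
  then show ?case by (simp add: continuous_on_Pair)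
next
  case (Suc k)
  have d: "((\<lambda>x. (f x, g x)) has_derivative
          (\<lambda>v. (frechet_derivative f (at x) v, frechet_derivative g (at x) v))) (at x)" for x
    using Suc.prems by (auto intro!: has_derivative_Pair simp: frechet_derivative_works)
  then have "frechet_derivative (\<lambda>x. (f x, g x)) (at x)
      = (\<lambda>v. (frechet_derivative f (at x) v, frechet_derivative g (at x) v))" for x
    by (metis frechet_derivative_at)
  then show ?case
    using Suc differentiableI[OF d] by simp
qed

lemma smoothD: "smooth f \<Longrightarrow> Ck k f"
  by (simp add: smooth_def)

lemma smooth_const: "smooth (\<lambda>x. c)"
  by (simp add: smooth_def Ck_const)

lemma smooth_bounded_linear: "bounded_linear f \<Longrightarrow> smooth f"
  by (simp add: smooth_def Ck_bounded_linear)

lemma smooth_add: "smooth f \<Longrightarrow> smooth g \<Longrightarrow> smooth (\<lambda>x. f x + g x)"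
  by (simp add: smooth_def Ck_add)

lemma smooth_mult:
  fixes f g :: "'a::real_normed_vector \<Rightarrow> real"
  shows "smooth f \<Longrightarrow> smooth g \<Longrightarrow> smooth (\<lambda>x. f x * g x)"
  by (simp add: smooth_def Ck_mult)

lemma smooth_power:
  fixes f :: "'a::real_normed_vector \<Rightarrow> real"
  shows "smooth f \<Longrightarrow> smooth (\<lambda>x. f x ^ n)"
  by (induction n) (simp_all add: smooth_const smooth_mult)

lemma smooth_Pair: "smooth f \<Longrightarrow> smooth g \<Longrightarrow> smooth (\<lambda>x. (f x, g x))"
  by (simp add: smooth_def Ck_Pair)

lemma smooth_frechet_derivative:
  "smooth f \<Longrightarrow> smooth (\<lambda>x. frechet_derivative f (at x) v)"
  by (metis Ck.simps(2) smooth_def)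

lemma smooth_imp_has_derivative:
  "smooth f \<Longrightarrow> (f has_derivative frechet_derivative f (at x)) (at x)"
  by (metis Ck.simps(2) smooth_def frechet_derivative_works)

lemma smooth_imp_continuous_on: "smooth f \<Longrightarrow> continuous_on S f"
  by (metis Ck.simps(1) smooth_def continuous_on_subset subset_UNIV)

text \<open>The chain rule turns a derivative of the composite into products of partial derivatives
  of \<open>F\<close>, again composed with \<open>(u, v)\<close>, and derivatives of
  \<open>u\<close> and \<open>v\<close>. The partials of a smooth \<open>F\<close> are smooth scalar
  functions, so the induction on \<open>k\<close> runs over all \<open>F\<close> at once.\<close>

lemma smooth_compose_plane:
  fixes F :: "plane \<Rightarrow> real" and u v :: "'a::real_normed_vector \<Rightarrow> real"
  assumes "smooth F" "smooth u" "smooth v"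
  shows "smooth (\<lambda>x. F (u x, v x))"
proof -
  have "Ck k (\<lambda>x. F (u x, v x))" for k
    using assms(1)
  proof (induction k arbitrary: F)
    case 0
    have "continuous_on UNIV (F \<circ> (\<lambda>x. (u x, v x)))"
      using 0 assms by (intro continuous_on_compose continuous_on_Pair smooth_imp_continuous_on) auto
    then show ?case by (simp add: o_def)
  next
    case (Suc k)
    let ?F = "\<lambda>e x. frechet_derivative F (at (u x, v x)) e"
    let ?u = "\<lambda>x. frechet_derivative u (at x)" and ?v = "\<lambda>x. frechet_derivative v (at x)"
    have d: "((\<lambda>x. F (u x, v x)) has_derivative
        (\<lambda>w. ?F (1,0) x * ?u x w + ?F (0,1) x * ?v x w)) (at x)" for x
    proof -
      have lin: "bounded_linear (frechet_derivative F (at (u x, v x)))"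
        using smooth_imp_has_derivative[OF Suc.prems] by (rule has_derivative_bounded_linear)
      have *: "?F (a, b) x = ?F (1,0) x * a + ?F (0,1) x * b" for a b
      proof -
        have "(a, b) = a *\<^sub>R (1::real,0::real) + b *\<^sub>R (0,1)" by simp
        then show ?thesis
          using lin by (simp only: linear_add linear_scale bounded_linear.linear) simp
      qed
      have "((F \<circ> (\<lambda>x. (u x, v x))) has_derivative
          (frechet_derivative F (at (u x, v x)) \<circ> (\<lambda>w. (?u x w, ?v x w)))) (at x)"
        by (intro diff_chain_at has_derivative_Pair smooth_imp_has_derivative Suc.prems assms)
      moreover have "frechet_derivative F (at (u x, v x)) \<circ> (\<lambda>w. (?u x w, ?v x w))
          = (\<lambda>w. ?F (1,0) x * ?u x w + ?F (0,1) x * ?v x w)"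
        unfolding o_def by (rule ext) (rule *)
      ultimately show ?thesis by (simp only: o_def)
    qed
    have fd: "frechet_derivative (\<lambda>x. F (u x, v x)) (at x)
        = (\<lambda>w. ?F (1,0) x * ?u x w + ?F (0,1) x * ?v x w)" for x
      by (rule frechet_derivative_at[OF d, symmetric])
    have "Ck k (\<lambda>x. ?F (1,0) x * ?u x w + ?F (0,1) x * ?v x w)" for w
      by (rule Ck_add; rule Ck_mult; (rule Suc.IH[OF smooth_frechet_derivative[OF Suc.prems]]
            | rule smoothD[OF smooth_frechet_derivative]), (rule assms)?)
    then show ?case
      by (simp add: fd differentiableI[OF d])
  qed
  then show ?thesis by (simp add: smooth_def)
qed

lemma smooth_exp:
  fixes u :: "'a::real_normed_vector \<Rightarrow> real"
  assumes "smooth u"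
  shows "smooth (\<lambda>x. exp (u x))"
proof -
  have "Ck k (\<lambda>x. exp (u x))" for k
  proof (induction k)
    case 0
    then show ?case using assms by (simp add: continuous_on_exp smooth_imp_continuous_on)
  next
    case (Suc k)
    have d: "((\<lambda>x. exp (u x)) has_derivative (\<lambda>w. exp (u x) * frechet_derivative u (at x) w)) (at x)" for x
      using has_derivative_exp[OF smooth_imp_has_derivative[OF assms]] by (simp add: mult.commute)
    have fd: "frechet_derivative (\<lambda>x. exp (u x)) (at x) = (\<lambda>w. exp (u x) * frechet_derivative u (at x) w)" for x
      by (rule frechet_derivative_at[OF d, symmetric])
    show ?case
      by (simp add: fd differentiableI[OF d] Ck_mult Suc smooth_frechet_derivative smoothD assms)
  qed
  then show ?thesis by (simp add: smooth_def)
qed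

lemma smooth_powr:
  fixes u :: "'a::real_normed_vector \<Rightarrow> real"
  assumes "smooth u" and pos: "\<And>x. u x > 0"
  shows "smooth (\<lambda>x. u x powr a)"
proof -
  have "Ck k (\<lambda>x. u x powr a)" for k a
  proof (induction k arbitrary: a)
    case 0
    then show ?case
      using assms by (simp add: continuous_on_powr continuous_on_const smooth_imp_continuous_on order_less_imp_not_eq2)
  next
    case (Suc k)
    have d: "((\<lambda>x. u x powr a) has_derivative
        (\<lambda>w. a * u x powr (a - 1) * frechet_derivative u (at x) w)) (at x)" for x
    proof -
      have "((\<lambda>y. y powr a) has_real_derivative a * u x powr (a - 1)) (at (u x))"
        using pos by (rule has_real_derivative_powr)
      then have "((\<lambda>y. y powr a) \<circ> u has_derivative
          (*) (a * u x powr (a - 1)) \<circ> frechet_derivative u (at x)) (at x)"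
        by (intro diff_chain_at smooth_imp_has_derivative assms) (simp add: has_field_derivative_def)
      then show ?thesis by (simp add: o_def)
    qed
    have fd: "frechet_derivative (\<lambda>x. u x powr a) (at x)
        = (\<lambda>w. a * u x powr (a - 1) * frechet_derivative u (at x) w)" for x
      by (rule frechet_derivative_at[OF d, symmetric])
    show ?case
      by (simp add: fd differentiableI[OF d] Ck_mult Ck_const Suc smooth_frechet_derivative smoothD assms)
  qed
  then show ?thesis by (simp add: smooth_def)
qed

subsection \<open>Flat oscillating functions\<close>

text \<open>A squeeze: the difference quotient of \<open>f\<close> at \<open>x\<close> is at most
  that of \<open>S\<close>. It handles the points where a definition by cases switches to 0.\<close>

lemma has_derivative_zero_if_dominated:
  fixes f S :: "'a::real_normed_vector \<Rightarrow> real"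
  assumes le: "\<And>y. \<bar>f y\<bar> \<le> S y" and "S x = 0" and S: "(S has_derivative (\<lambda>_. 0)) (at x)"
  shows "(f has_derivative (\<lambda>_. 0)) (at x)"
proof -
  have "f x = 0" using le[of x] assms(2) by simp
  have "((\<lambda>y. norm (S y) / norm (y - x)) \<longlongrightarrow> 0) (at x)"
    using S \<open>S x = 0\<close> by (simp add: has_derivative_iff_norm)
  then have "((\<lambda>y. norm (f y) / norm (y - x)) \<longlongrightarrow> 0) (at x)"
  proof (rule Lim_null_comparison[rotated])
    show "\<forall>\<^sub>F y in at x. norm (norm (f y) / norm (y - x)) \<le> norm (S y) / norm (y - x)"
      using le by (auto intro!: always_eventually divide_right_mono order_trans[OF le])
  qed
  then show ?thesis
    using \<open>f x = 0\<close> by (simp add: has_derivative_iff_norm)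
qed

lemma power_mult_exp_minus_le:
  fixes u :: real
  assumes "u \<ge> 0"
  shows "u ^ n * exp (- u) \<le> fact n"
proof -
  have "(\<lambda>k. u ^ k /\<^sub>R fact k) sums exp u" by (rule exp_converges)
  then have "sum (\<lambda>k. u ^ k /\<^sub>R fact k) {n} \<le> exp u"
    using assms sum_le_suminf[of "\<lambda>k. u ^ k /\<^sub>R fact k" "{n}"] by (simp add: sums_iff)
  then show ?thesis by (simp add: exp_minus field_simps)
qed

text \<open>With u = 1/(xy) this is u^m e^(-u) cos(\<omega> ln(y/x) + c), extended by 0. The power
  and the phase are parameters because differentiation raises m by 1 or 2 and shifts the phase by
  pi/2: up to polynomial coefficients the family is closed under differentiation.\<close>

definition flat_osc :: "nat \<Rightarrow> real \<Rightarrow> real \<Rightarrow> plane \<Rightarrow> real" where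
  "flat_osc m \<omega> c z = (if fst z > 0 \<and> snd z > 0
     then inverse (fst z * snd z) ^ m * exp (- inverse (fst z * snd z)) * cos (\<omega> * ln (snd z / fst z) + c)
     else 0)"

text \<open>In the quadrant this is the chain rule for u = 1/(xy) and L = ln(y/x), where du = -u^2
  (x dy + y dx) and dL = u (x dy - y dx). Elsewhere the derivative is 0, because e^(-u) beats every
  power of u.\<close>

lemma flat_osc_has_derivative:
  "(flat_osc m \<omega> c has_derivative (\<lambda>w.
      (flat_osc (m + 2) \<omega> c z - real m * flat_osc (m + 1) \<omega> c z) * (fst z * snd w + snd z * fst w)
      + \<omega> * flat_osc (m + 1) \<omega> (c + pi / 2) z * (fst z * snd w - snd z * fst w))) (at z)"
  (is "(_ has_derivative ?D) _")
proof (cases "fst z > 0 \<and> snd z > 0")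
  case True
  then have pos: "fst z > 0" "snd z > 0" by auto
  let ?f = "\<lambda>z. inverse (fst z * snd z) ^ m * exp (- inverse (fst z * snd z))
    * cos (\<omega> * ln (snd z / fst z) + c)"
  define U where "U z = inverse (fst z * snd z)" for z :: plane
  define L where "L z = ln (snd z / fst z)" for z :: plane
  define u where "u = U z"
  let ?p = "\<lambda>w. fst z * snd w + snd z * fst w" and ?q = "\<lambda>w. fst z * snd w - snd z * fst w"
  have dU: "(U has_derivative (\<lambda>w. - (u\<^sup>2 * ?p w))) (at z)"
    unfolding U_def[abs_def] u_def using pos
    by (auto intro!: derivative_eq_intros simp: field_simps power2_eq_square)
  have dL: "(L has_derivative (\<lambda>w. u * ?q w)) (at z)"
    unfolding L_def[abs_def] u_def U_def using pos
    by (auto intro!: derivative_eq_intros simp: field_simps power2_eq_square)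
  \<comment> \<open>For m = 0 the exponent \<open>m - 1\<close> truncates, but the factor
    \<open>real m\<close> vanishes.\<close>
  have m: "real m * u ^ (m - 1) * u\<^sup>2 = real m * u ^ (m + 1)"
    by (cases m) (auto simp: power2_eq_square)
  have "((\<lambda>z. U z ^ m * exp (- U z) * cos (\<omega> * L z + c)) has_derivative
      (\<lambda>w. (u ^ (m + 2) * ?p w - (real m * u ^ (m - 1) * u\<^sup>2) * ?p w) * exp (- u) * cos (\<omega> * L z + c)
        + \<omega> * (u ^ (m + 1) * exp (- u) * (- sin (\<omega> * L z + c))) * ?q w)) (at z)"
    by (rule derivative_eq_intros dU dL refl)+
      (simp add: u_def algebra_simps power2_eq_square flip: u_def)
  also have "(\<lambda>w. (u ^ (m + 2) * ?p w - (real m * u ^ (m - 1) * u\<^sup>2) * ?p w) * exp (- u) * cos (\<omega> * L z + c)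
        + \<omega> * (u ^ (m + 1) * exp (- u) * (- sin (\<omega> * L z + c))) * ?q w) = ?D"
    unfolding m using pos
    by (simp add: flat_osc_def u_def U_def L_def cos_add sin_add algebra_simps fun_eq_iff)
  finally have "(?f has_derivative ?D) (at z)"
    by (simp add: U_def L_def)
  moreover have "open {z::plane. fst z > 0 \<and> snd z > 0}"
    by (intro open_Collect_conj open_Collect_less continuous_intros)
  ultimately show ?thesis
    by (rule has_derivative_transform_within_open[where s = "{z. fst z > 0 \<and> snd z > 0}"])
      (use pos in \<open>auto simp: flat_osc_def\<close>)
next
  case False
  have D0: "?D = (\<lambda>_. 0)"
    using False by (auto simp: flat_osc_def)
  \<comment> \<open>A multiple of (xy)^2 with a nonpositive coordinate of \<open>z\<close>
    subtracted from one factor: on the quadrant this can only enlarge the factor, and it makes the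
    square vanish to second order at \<open>z\<close>.\<close>
  define S where "S y = (if fst z > 0 then fact (m + 2) * (fst y * (snd y - snd z))\<^sup>2
                         else fact (m + 2) * ((fst y - fst z) * snd y)\<^sup>2)" for y :: plane
  have "\<bar>flat_osc m \<omega> c y\<bar> \<le> S y" for y
  proof (cases "fst y > 0 \<and> snd y > 0")
    case True
    define p where "p = fst y * snd y"
    have p: "p > 0" using True by (simp add: p_def)
    \<comment> \<open>Two extra powers of 1/p are spent to gain the factor p^2.\<close>
    have "inverse p ^ (m + 2) * exp (- inverse p) \<le> fact (m + 2)"
      using p by (intro power_mult_exp_minus_le) simp
    then have "inverse p ^ (m + 2) * exp (- inverse p) * p\<^sup>2 \<le> fact (m + 2) * p\<^sup>2"
      by (rule mult_right_mono) simp
    moreover have "inverse p ^ (m + 2) * exp (- inverse p) * p\<^sup>2 = inverse p ^ m * exp (- inverse p)"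
      using p by (simp add: power_add power2_eq_square field_simps)
    ultimately have le: "inverse p ^ m * exp (- inverse p) \<le> fact (m + 2) * p\<^sup>2" by metis
    have "\<bar>flat_osc m \<omega> c y\<bar> = inverse p ^ m * exp (- inverse p) * \<bar>cos (\<omega> * ln (snd y / fst y) + c)\<bar>"
      using True p by (simp add: flat_osc_def p_def abs_mult)
    also have "\<dots> \<le> inverse p ^ m * exp (- inverse p) * 1"
      using p by (intro mult_left_mono) auto
    also have "\<dots> \<le> fact (m + 2) * p\<^sup>2" using le by (simp only: mult_1_right)
    also have "\<dots> \<le> S y"
    proof (cases "fst z > 0")
      case t: True
      then have "snd z \<le> 0" using False by auto
      then have "p \<le> fst y * (snd y - snd z)"
        using True by (simp add: p_def algebra_simps mult_nonneg_nonpos)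
      then show ?thesis using t p by (simp add: S_def power_mono)
    next
      case f: False
      then have "p \<le> (fst y - fst z) * snd y"
        using True by (simp add: p_def algebra_simps mult_nonpos_nonneg)
      then show ?thesis using f p by (simp add: S_def power_mono)
    qed
    finally show ?thesis .
  next
    case f: False
    then show ?thesis by (auto simp: flat_osc_def S_def)
  qed
  moreover have "S z = 0" by (simp add: S_def)
  moreover have "(S has_derivative (\<lambda>_. 0)) (at z)"
    unfolding S_def
    by (cases "fst z > 0") (auto intro!: derivative_eq_intros)
  ultimately show ?thesis
    unfolding D0 by (rule has_derivative_zero_if_dominated)
qed

lemma smooth_flat_osc: "smooth (flat_osc m \<omega> c)"
proof -
  have "Ck k (flat_osc m \<omega> c)" for k
  proof (induction k arbitrary: m c)
    case 0
    show ?case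
      using flat_osc_has_derivative[of m \<omega> c]
      by (auto intro!: continuous_at_imp_continuous_on has_derivative_continuous)
  next
    case (Suc k)
    note d = flat_osc_has_derivative[of m \<omega> c]
    have fd: "frechet_derivative (flat_osc m \<omega> c) (at z) = (\<lambda>w.
      (flat_osc (m + 2) \<omega> c z + (- real m) * flat_osc (m + 1) \<omega> c z) * (fst z * snd w + snd z * fst w)
      + \<omega> * flat_osc (m + 1) \<omega> (c + pi / 2) z * (fst z * snd w + snd z * (- fst w)))" for z
      using frechet_derivative_at[OF d[of z]] by simp
    have "Ck k (\<lambda>z. (flat_osc (m + 2) \<omega> c z + (- real m) * flat_osc (m + 1) \<omega> c z) * (fst z * snd w + snd z * fst w)
      + \<omega> * flat_osc (m + 1) \<omega> (c + pi / 2) z * (fst z * snd w + snd z * (- fst w)))" for w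
      by (rule Ck_add; rule Ck_mult; (rule Ck_add)?; (rule Ck_mult)?;
          intro Ck_const Suc Ck_bounded_linear bounded_linear_fst bounded_linear_snd)
    then show ?case
      by (simp only: Ck.simps fd) (simp add: differentiableI[OF d])
  qed
  then show ?thesis by (simp add: smooth_def)
qed

subsection \<open>Foliations by level sets\<close>

definition leaves :: "(plane \<Rightarrow> real) \<Rightarrow> plane set set" where
  "leaves g = range (\<lambda>p. path_component_set {q. g q = g p} p)"

lemma same_leafI:
  assumes "path_connected S" "p \<in> S" "q \<in> S" "S \<subseteq> {x. g x = g p}"
  shows "\<exists>L\<in>leaves g. p \<in> L \<and> q \<in> L"
proof
  show "path_component_set {x. g x = g p} p \<in> leaves g" by (simp add: leaves_def)
  show "p \<in> path_component_set {x. g x = g p} p \<and> q \<in> path_component_set {x. g x = g p} p"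
    using path_component_maximal[OF assms(2,1,4)] assms(2,3) by blast
qed

lemma same_leafE:
  assumes "L \<in> leaves g" "p \<in> L" "q \<in> L"
  obtains \<gamma> where "path \<gamma>" "\<And>t. t \<in> {0..1} \<Longrightarrow> g (\<gamma> t) = g p" "\<gamma> 0 = p" "\<gamma> 1 = q"
proof -
  obtain r where L: "L = path_component_set {x. g x = g r} r"
    using assms(1) by (auto simp: leaves_def)
  have "g p = g r" using assms(2) path_component_mem unfolding L by fastforce
  have "path_component {x. g x = g r} p q"
    using assms(2,3) unfolding L by (metis mem_Collect_eq path_component_sym path_component_trans)
  then obtain \<gamma> where "path \<gamma>" "path_image \<gamma> \<subseteq> {x. g x = g r}" "pathstart \<gamma> = p" "pathfinish \<gamma> = q"
    unfolding path_component_def by blast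
  moreover from this have "g (\<gamma> t) = g p" if "t \<in> {0..1}" for t
  proof -
    have "\<gamma> t \<in> path_image \<gamma>" using that by (simp add: path_image_def)
    then show ?thesis using \<open>path_image \<gamma> \<subseteq> _\<close> \<open>g p = g r\<close> by auto
  qed
  ultimately show thesis
    using that[of \<gamma>] by (simp add: pathstart_def pathfinish_def)
qed

lemma partition_on_leaves: "partition_on UNIV (leaves g)"
proof (rule partition_onI)
  show "\<Union> (leaves g) = UNIV"
    unfolding leaves_def by (auto intro!: exI path_component_refl)
next
  fix L K assume "L \<in> leaves g" "K \<in> leaves g" "L \<noteq> K"
  then obtain p q where pq: "L = path_component_set {x. g x = g p} p" "K = path_component_set {x. g x = g q} q"
    by (auto simp: leaves_def)
  show "disjnt L K"
  proof (rule ccontr)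
    assume "\<not> disjnt L K"
    then obtain x where x: "path_component {x. g x = g p} p x" "path_component {x. g x = g q} q x"
      by (auto simp: pq disjnt_def)
    then have eq: "g x = g p" "g x = g q"
      by (auto dest!: path_component_mem(2))
    have "path_component_set {y. g y = g p} x = L" "path_component_set {y. g y = g q} x = K"
      using x unfolding pq by (simp_all add: path_component_eq)
    moreover have "g p = g q" using eq by simp
    ultimately show False
      using \<open>L \<noteq> K\<close> by simp
  qed
next
  show "{} \<notin> leaves g"
  proof
    assume "{} \<in> leaves g"
    then obtain p where "path_component_set {x. g x = g p} p = {}"
      by (auto simp: leaves_def)
    then show False unfolding path_component_eq_empty by simp
  qed
qed

text \<open>\<open>g\<close> is constant along a curve inside a leaf, so its derivative kills the
  velocity.\<close>

lemma tangent_to_leaves: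
  assumes "tangent_to (leaves g) p v" and "(g has_derivative g') (at p)"
  shows "g' v = 0"
proof -
  obtain L \<gamma> where L: "L \<in> leaves g" "\<gamma> ` {-1<..<1} \<subseteq> L" "\<gamma> 0 = p"
    and v: "(\<gamma> has_vector_derivative v) (at 0)"
    using assms(1) unfolding tangent_to_def by blast
  have const: "g (\<gamma> t) = g p" if "t \<in> {-1<..<1}" for t
  proof -
    have "\<gamma> t \<in> L" "p \<in> L" using L that by auto
    then show ?thesis using L(1) by (metis same_leafE atLeastAtMost_iff zero_le_one order_refl)
  qed
  have "(g \<circ> \<gamma> has_derivative g' \<circ> (\<lambda>t. t *\<^sub>R v)) (at 0)"
    using v assms(2) L(3) by (intro diff_chain_at) (auto simp: has_vector_derivative_def)
  then have "((\<lambda>t. g p) has_derivative g' \<circ> (\<lambda>t. t *\<^sub>R v)) (at 0)"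
    by (rule has_derivative_transform_within_open[where s = "{-1<..<1}"]) (auto simp: const)
  then have "g' \<circ> (\<lambda>t. t *\<^sub>R v) = (\<lambda>_. 0)"
    by (rule has_derivative_unique) (rule has_derivative_const)
  then show ?thesis by (metis comp_apply scaleR_one)
qed

text \<open>\<open>f\<close> is a homeomorphism that multiplies \<open>g\<close> by a nonzero
  constant, so it permutes the level sets of \<open>g\<close> and carries path components to path
  components.\<close>

lemma respects_foliation_leaves:
  assumes f: "continuous_on UNIV f" and f': "continuous_on UNIV f'"
    and inv: "\<And>x. f' (f x) = x" "\<And>x. f (f' x) = x"
    and g: "\<And>x. g (f x) = c * g x" and "c \<noteq> 0"
  shows "respects_foliation f (leaves g)"
  unfolding respects_foliation_def
proof
  fix L assume "L \<in> leaves g"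
  then obtain p where L: "L = path_component_set {x. g x = g p} p"
    by (auto simp: leaves_def)
  have g': "g (f' x) = g x / c" for x
    using g[of "f' x"] \<open>c \<noteq> 0\<close> by (simp add: inv)
  have im: "path_component T (u x) (u y)"
    if pc: "path_component S x y" and u: "continuous_on UNIV u" and uST: "u ` S \<subseteq> T" for S T :: "plane set" and u x y
  proof -
    obtain \<gamma> where "path \<gamma>" "path_image \<gamma> \<subseteq> S" "pathstart \<gamma> = x" "pathfinish \<gamma> = y"
      using pc unfolding path_component_def by blast
    then have "path (u \<circ> \<gamma>)"
      using u by (intro path_continuous_image) (auto intro: continuous_on_subset)
    moreover have "path_image (u \<circ> \<gamma>) \<subseteq> T"
      unfolding path_image_compose using \<open>path_image \<gamma> \<subseteq> S\<close> uST by blast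
    ultimately show ?thesis
      using \<open>pathstart \<gamma> = x\<close> \<open>pathfinish \<gamma> = y\<close> unfolding path_component_def
      by (intro exI[of _ "u \<circ> \<gamma>"]) (simp add: pathstart_compose pathfinish_compose)
  qed
  have "f ` L = path_component_set {x. g x = g (f p)} (f p)"
  proof (intro equalityI subsetI)
    fix y assume "y \<in> f ` L"
    then obtain x where "path_component {x. g x = g p} p x" "y = f x" by (auto simp: L)
    then show "y \<in> path_component_set {x. g x = g (f p)} (f p)"
      using im[OF _ f, of "{x. g x = g p}" p x "{x. g x = g (f p)}"] by (simp add: image_subset_iff g)
  next
    fix y assume "y \<in> path_component_set {x. g x = g (f p)} (f p)"
    then have "path_component {x. g x = g (f p)} (f p) y" by simp
    then have "path_component {x. g x = g p} (f' (f p)) (f' y)"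
      by (rule im[OF _ f']) (auto simp: g' g \<open>c \<noteq> 0\<close>)
    then have "f' y \<in> L" by (simp add: L inv)
    then show "y \<in> f ` L" by (metis inv(2) image_eqI)
  qed
  then show "f ` L \<in> leaves g" by (auto simp: leaves_def)
qed

lemma frechet_derivative_pair:
  fixes u :: "plane \<Rightarrow> real"
  assumes "smooth u"
  shows "frechet_derivative u (at p) (a, b)
    = a * frechet_derivative u (at p) (1, 0) + b * frechet_derivative u (at p) (0, 1 :: real)"
proof -
  have lin: "linear (frechet_derivative u (at p))"
    using smooth_imp_has_derivative[OF assms] by (rule has_derivative_linear)
  have "(a, b) = a *\<^sub>R (1::real,0::real) + b *\<^sub>R (0,1)" by simp
  then show ?thesis
    by (simp only: linear_add[OF lin] linear_scale[OF lin]) simp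
qed

section \<open>Foliations defined by an injective immersion of the plane\<close>

locale plane_embedding =
  fixes g h :: "plane \<Rightarrow> real"
  assumes smooth_g: "smooth g" and smooth_h: "smooth h"
    and inj: "\<And>p q. g p = g q \<Longrightarrow> h p = h q \<Longrightarrow> p = q"
    and immersion: "\<And>p v. frechet_derivative g (at p) v = 0 \<Longrightarrow> frechet_derivative h (at p) v = 0 \<Longrightarrow> v = 0"
begin

definition \<Phi> :: "plane \<Rightarrow> plane" where "\<Phi> p = (g p, h p)"

definition \<Psi> :: "plane \<Rightarrow> plane" where "\<Psi> = inv \<Phi>"

lemma inj_\<Phi>: "inj \<Phi>"
  by (rule injI, rule inj) (simp_all add: \<Phi>_def)

lemma continuous_\<Phi>: "continuous_on S \<Phi>"
  unfolding \<Phi>_def[abs_def] by (intro continuous_on_Pair smooth_imp_continuous_on smooth_g smooth_h)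

lemma open_range: "open (range \<Phi>)"
  by (rule invariance_of_domain[OF continuous_\<Phi> open_UNIV inj_\<Phi>])

lemma \<Psi>_\<Phi> [simp]: "\<Psi> (\<Phi> p) = p"
  by (simp add: \<Psi>_def inj_\<Phi>)

lemma \<Phi>_\<Psi>: "z \<in> range \<Phi> \<Longrightarrow> \<Phi> (\<Psi> z) = z"
  by (simp add: \<Psi>_def f_inv_into_f)

lemma g_\<Psi>: "z \<in> range \<Phi> \<Longrightarrow> g (\<Psi> z) = fst z"
  using \<Phi>_\<Psi>[of z] by (metis \<Phi>_def fst_conv)

lemma h_\<Psi>: "z \<in> range \<Phi> \<Longrightarrow> h (\<Psi> z) = snd z"
  using \<Phi>_\<Psi>[of z] by (metis \<Phi>_def snd_conv)

lemma continuous_\<Psi>: "continuous_on (range \<Phi>) \<Psi>"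
  by (rule continuous_on_inverse_open[OF open_UNIV continuous_\<Phi>]) simp_all

definition jac :: "plane \<Rightarrow> real" where
  "jac p = frechet_derivative g (at p) (1, 0) * frechet_derivative h (at p) (0, 1)
         - frechet_derivative g (at p) (0, 1) * frechet_derivative h (at p) (1, 0)"

text \<open>If the gradients were dependent, the gradient of \<open>g\<close> turned by a right
  angle would be annihilated by both derivatives, and likewise that of \<open>h\<close>. So both
  gradients vanish, and then even \<open>(1, 0)\<close> is annihilated.\<close>

lemma jac_nonzero: "jac p \<noteq> 0"
proof
  assume j: "jac p = 0"
  note eqs = frechet_derivative_pair[OF smooth_g] frechet_derivative_pair[OF smooth_h]
  let ?a = "frechet_derivative g (at p)" and ?b = "frechet_derivative h (at p)"
  have 1: "(- ?a (0,1), ?a (1,0)) = 0"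
  proof (rule immersion)
    show "?a (- ?a (0,1), ?a (1,0)) = 0" by (subst eqs) simp
    show "?b (- ?a (0,1), ?a (1,0)) = 0" using j by (subst eqs) (simp add: jac_def algebra_simps)
  qed
  have 2: "(- ?b (0,1), ?b (1,0)) = 0"
  proof (rule immersion)
    show "?a (- ?b (0,1), ?b (1,0)) = 0" using j by (subst eqs) (simp add: jac_def algebra_simps)
    show "?b (- ?b (0,1), ?b (1,0)) = 0" by (subst eqs) simp
  qed
  have "(1::real, 0::real) = 0"
    by (rule immersion[of p]) (use 1 2 in \<open>simp_all add: zero_prod_def\<close>)
  then show False by (simp add: zero_prod_def)
qed

text \<open>Cramer's rule: the matrix is the inverse of the Jacobian of \<open>\<Phi>\<close> at the
  preimage. Continuity of \<open>\<Psi>\<close> on the open range makes this algebraic inverse the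
  derivative.\<close>

lemma \<Psi>_has_derivative:
  assumes z: "z \<in> range \<Phi>"
  shows "(\<Psi> has_derivative (\<lambda>w.
      ((frechet_derivative h (at (\<Psi> z)) (0,1) * fst w - frechet_derivative g (at (\<Psi> z)) (0,1) * snd w) / jac (\<Psi> z),
       (frechet_derivative g (at (\<Psi> z)) (1,0) * snd w - frechet_derivative h (at (\<Psi> z)) (1,0) * fst w) / jac (\<Psi> z))))
    (at z)"
    (is "(_ has_derivative ?D) _")
proof (rule has_derivative_inverse_basic[where T = "range \<Phi>"])
  let ?p = "\<Psi> z"
  show "(\<Phi> has_derivative (\<lambda>v. (frechet_derivative g (at ?p) v, frechet_derivative h (at ?p) v))) (at ?p)"
    unfolding \<Phi>_def[abs_def]
    by (intro has_derivative_Pair smooth_imp_has_derivative smooth_g smooth_h)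
  show "bounded_linear ?D"
    by (intro bounded_linear_Pair bounded_linear_divide bounded_linear_compose[OF bounded_linear_divide]
        bounded_linear_sub bounded_linear_const_mult bounded_linear_fst bounded_linear_snd)
  have "?D (frechet_derivative g (at ?p) (a, b), frechet_derivative h (at ?p) (a, b)) = (a, b)" for a b
    unfolding frechet_derivative_pair[OF smooth_g, of _ a b] frechet_derivative_pair[OF smooth_h, of _ a b]
    using jac_nonzero[of ?p] by (auto simp: divide_simps jac_def) (simp_all add: algebra_simps)
  then show "?D \<circ> (\<lambda>v. (frechet_derivative g (at ?p) v, frechet_derivative h (at ?p) v)) = id"
    by (auto simp: fun_eq_iff)
  show "continuous (at z) \<Psi>"
    using continuous_on_eq_continuous_at[OF open_range] continuous_\<Psi> z by blast
qed (use z open_range \<Phi>_\<Psi> in auto)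

text \<open>Over a small rectangle inside the range of \<open>\<Phi>\<close>, \<open>(h, g)\<close>
  is itself a chart. As \<open>g\<close> is its second coordinate, a level set of \<open>g\<close>
  meets the chart domain in a single slice, which is path-connected and hence lies in one leaf. So
  every leaf has at most one plaque there.\<close>

lemma foliation_leaves: "foliation (leaves g)"
  unfolding foliation_def
proof (intro conjI allI ballI)
  show "partition_on UNIV (leaves g)" by (rule partition_on_leaves)
  show "path_connected L" if "L \<in> leaves g" for L
    using that by (auto simp: leaves_def path_connected_path_component)
next
  fix p
  have "\<Phi> p \<in> range \<Phi>" by simp
  then obtain A B where "open A" "open B" "\<Phi> p \<in> A \<times> B" and AB: "A \<times> B \<subseteq> range \<Phi>"
    using open_range by (metis open_prod_elim)
  then have "g p \<in> A" "h p \<in> B" by (auto simp: \<Phi>_def)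
  then obtain d e where "d > 0" "e > 0" "ball (g p) d \<subseteq> A" "ball (h p) e \<subseteq> B"
    using \<open>open A\<close> \<open>open B\<close> by (meson open_contains_ball)
  define J where "J = ball (g p) d"
  define I where "I = ball (h p) e"
  have IJ: "J \<times> I \<subseteq> range \<Phi>"
    using AB \<open>ball (g p) d \<subseteq> A\<close> \<open>ball (h p) e \<subseteq> B\<close> by (auto simp: I_def J_def)
  define U where "U = {q. h q \<in> I \<and> g q \<in> J}"
  \<comment> \<open>The coordinates are swapped because plaques are the slices on which the second
    coordinate of a chart is constant.\<close>
  define \<phi> where "\<phi> q = (h q, g q)" for q
  define \<psi> where "\<psi> z = \<Psi> (snd z, fst z)" for z
  have [simp]: "open I" "open J" "connected I" "connected J" "convex I"
    by (auto simp: I_def J_def)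
  have U: "open U"
    unfolding U_def
    by (intro open_Collect_conj open_vimage[of I h, unfolded vimage_def] open_vimage[of J g, unfolded vimage_def]
        smooth_imp_continuous_on smooth_g smooth_h) auto
  have cont\<psi>: "continuous_on (I \<times> J) \<psi>"
    unfolding \<psi>_def using IJ
    by (intro continuous_on_compose2[OF continuous_\<Psi>] continuous_intros) auto
  have \<psi>: "h (\<psi> z) = fst z" "g (\<psi> z) = snd z" if "z \<in> I \<times> J" for z
  proof -
    have "(snd z, fst z) \<in> range \<Phi>" using that IJ by (auto simp: mem_Times_iff)
    then show "h (\<psi> z) = fst z" "g (\<psi> z) = snd z" by (simp_all add: \<psi>_def g_\<Psi> h_\<Psi>)
  qed
  have \<psi>_eq: "\<psi> (h q, g q) = q" for q
    by (simp add: \<psi>_def flip: \<Phi>_def)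
  have hom: "homeomorphism U (I \<times> J) \<phi> \<psi>"
  proof (rule homeomorphismI)
    show "continuous_on U \<phi>"
      unfolding \<phi>_def by (intro continuous_on_Pair smooth_imp_continuous_on smooth_g smooth_h)
    show "\<phi> ` U \<subseteq> I \<times> J" by (auto simp: \<phi>_def U_def)
    show "\<psi> ` (I \<times> J) \<subseteq> U"
      using \<psi> by (fastforce simp: U_def)
    show "\<psi> (\<phi> q) = q" if "q \<in> U" for q
      by (simp add: \<phi>_def \<psi>_eq)
    show "\<phi> (\<psi> z) = z" if "z \<in> I \<times> J" for z
      using \<psi>[OF that] by (simp add: \<phi>_def)
  qed (rule cont\<psi>)
  have "C1_arc P \<and> (\<exists>c. P = {q\<in>U. snd (\<phi> q) = c})" if L: "L \<in> leaves g" and P: "P \<in> components (L \<inter> U)" for L P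
  proof -
    obtain r where r: "L = path_component_set {x. g x = g r} r"
      using L by (auto simp: leaves_def)
    define c where "c = g r"
    obtain q where "q \<in> P" using in_components_nonempty[OF P] by blast
    then have q: "q \<in> L" "q \<in> U" using in_components_subset[OF P] by auto
    have Lc: "g x = c" if "x \<in> L" for x
      using that path_component_mem unfolding r c_def by fastforce
    have "c \<in> J" using q Lc by (auto simp: U_def)
    define S where "S = (\<lambda>t. \<psi> (t, c)) ` I"
    have S_eq: "S = {x\<in>U. g x = c}"
    proof (intro equalityI subsetI)
      fix x assume "x \<in> {x\<in>U. g x = c}"
      then show "x \<in> S"
        unfolding S_def using \<psi>_eq[of x] by (intro image_eqI[of _ _ "h x"]) (auto simp: U_def)
    qed (auto simp: S_def U_def \<psi> \<open>c \<in> J\<close>)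
    have pcS: "path_connected S"
      unfolding S_def using \<open>c \<in> J\<close>
      by (intro path_connected_continuous_image continuous_on_compose2[OF cont\<psi>] continuous_intros
          convex_imp_path_connected) auto
    have "path_component_set {x. g x = g r} q = L"
      using q unfolding r by (simp add: path_component_eq)
    moreover have "S \<subseteq> path_component_set {x. g x = g r} q"
      using pcS q Lc by (intro path_component_maximal) (auto simp: S_eq c_def)
    ultimately have "L \<inter> U = S"
      using Lc by (auto simp: S_eq)
    then have "P = S"
      using P pcS by (metis path_connected_imp_connected connected_component_eq_self componentsE
          connected_component_eq_self)
    have "C1_arc S"
      unfolding C1_arc_def
    proof (intro exI conjI ballI)
      let ?\<gamma> = "\<lambda>t. \<psi> (t, c)"
      \<comment> \<open>The second column of the inverse Jacobian: the direction in which
        \<open>h\<close> grows at unit rate while \<open>g\<close> stays constant.\<close>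
      let ?\<gamma>' = "\<lambda>t. (- frechet_derivative g (at (?\<gamma> t)) (0,1) / jac (?\<gamma> t),
        frechet_derivative g (at (?\<gamma> t)) (1,0) / jac (?\<gamma> t))"
      show "open I" "connected I" by simp_all
      show "I \<noteq> {}" using q by (auto simp: U_def)
      show "inj_on ?\<gamma> I"
        using \<psi>(1) \<open>c \<in> J\<close> by (intro inj_onI) (metis SigmaI fst_conv)
      show "S = ?\<gamma> ` I" by (simp add: S_def)
      have cont\<gamma>: "continuous_on I ?\<gamma>"
        using \<open>c \<in> J\<close> by (intro continuous_on_compose2[OF cont\<psi>] continuous_intros) auto
      have comp: "continuous_on I (\<lambda>t. frechet_derivative u (at (?\<gamma> t)) v)" if "smooth u" for u :: "plane \<Rightarrow> real" and v
        by (rule continuous_on_compose2[OF smooth_imp_continuous_on[OF smooth_frechet_derivative[OF that], of UNIV] cont\<gamma>]) simp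
      show "continuous_on I ?\<gamma>'"
        using jac_nonzero unfolding jac_def
        by (intro continuous_intros comp smooth_g smooth_h) auto
      fix t assume "t \<in> I"
      then have "(c, t) \<in> range \<Phi>" using IJ \<open>c \<in> J\<close> by auto
      from \<Psi>_has_derivative[OF this]
      have "(\<Psi> \<circ> (\<lambda>t. (c, t)) has_derivative (\<lambda>w.
         ((frechet_derivative h (at (\<Psi> (c,t))) (0,1) * fst w - frechet_derivative g (at (\<Psi> (c,t))) (0,1) * snd w) / jac (\<Psi> (c,t)),
          (frechet_derivative g (at (\<Psi> (c,t))) (1,0) * snd w - frechet_derivative h (at (\<Psi> (c,t))) (1,0) * fst w) / jac (\<Psi> (c,t))))
         \<circ> (\<lambda>s. (0, s))) (at t)"
        by (intro diff_chain_at has_derivative_Pair has_derivative_const has_derivative_ident) 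
      then show "(?\<gamma> has_vector_derivative ?\<gamma>' t) (at t)"
        by (simp add: has_vector_derivative_def o_def \<psi>_def mult.commute)
      show "?\<gamma>' t \<noteq> 0"
        using jac_nonzero[of "?\<gamma> t"] unfolding zero_prod_def by (auto simp: jac_def)
    qed
    then show ?thesis
      using \<open>P = S\<close> by (auto simp: S_eq \<phi>_def)
  qed
  then have "foliated_chart (leaves g) U \<phi>"
    unfolding foliated_chart_def using U hom by (intro conjI exI[of _ I] exI[of _ J] exI[of _ \<psi>]) auto
  moreover have "p \<in> U"
    using \<open>d > 0\<close> \<open>e > 0\<close> by (simp add: U_def I_def J_def)
  ultimately show "\<exists>U \<phi>. p \<in> U \<and> foliated_chart (leaves g) U \<phi>" by blast
qed

lemma same_leaf_if_segment:
  assumes seg: "closed_segment (\<Phi> p) (\<Phi> q) \<subseteq> range \<Phi>"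
    and u: "\<And>z. z \<in> closed_segment (\<Phi> p) (\<Phi> q) \<Longrightarrow> u (\<Psi> z) = u p"
  shows "\<exists>L\<in>leaves u. p \<in> L \<and> q \<in> L"
proof (rule same_leafI)
  show "path_connected (\<Psi> ` closed_segment (\<Phi> p) (\<Phi> q))"
    by (intro path_connected_continuous_image continuous_on_subset[OF continuous_\<Psi> seg])
       (simp add: convex_imp_path_connected)
  show "p \<in> \<Psi> ` closed_segment (\<Phi> p) (\<Phi> q)" "q \<in> \<Psi> ` closed_segment (\<Phi> p) (\<Phi> q)"
    by (metis \<Psi>_\<Phi> ends_in_segment(1) imageI, metis \<Psi>_\<Phi> ends_in_segment(2) imageI)
  show "\<Psi> ` closed_segment (\<Phi> p) (\<Phi> q) \<subseteq> {x. u x = u p}"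
    using u by (intro image_subsetI CollectI)
qed

end

lemma plane_embedding_commute: "plane_embedding g h \<Longrightarrow> plane_embedding h g"
  unfolding plane_embedding_def by blast

subsection \<open>Completeness of Riemannian metrics\<close>

definition speed :: "(plane \<Rightarrow> plane \<Rightarrow> plane \<Rightarrow> real) \<Rightarrow> (real \<Rightarrow> plane) \<Rightarrow> real \<Rightarrow> real" where
  "speed \<mu> \<gamma> t = riemannian_norm \<mu> (\<gamma> t) (vector_derivative \<gamma> (at t))"

definition lengths :: "(plane \<Rightarrow> plane \<Rightarrow> plane \<Rightarrow> real) \<Rightarrow> plane \<Rightarrow> plane \<Rightarrow> real set" where
  "lengths \<mu> p q = {l. \<exists>\<gamma>. valid_path \<gamma> \<and> pathstart \<gamma> = p \<and> pathfinish \<gamma> = q \<and>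
     (speed \<mu> \<gamma> has_integral l) {0..1}}"

lemma riemannian_dist_eq: "riemannian_dist \<mu> p q = Inf (lengths \<mu> p q)"
  by (simp add: riemannian_dist_def lengths_def speed_def[abs_def])

lemma riemannian_metricD:
  assumes "riemannian_metric \<mu>"
  shows "bilinear (\<mu> p)" "v \<noteq> 0 \<Longrightarrow> \<mu> p v v > 0" "smooth (\<lambda>p. \<mu> p v w)"
  using assms unfolding riemannian_metric_def by blast+

lemma riemannian_norm_scaleR:
  assumes "riemannian_metric \<mu>"
  shows "riemannian_norm \<mu> p (c *\<^sub>R v) = \<bar>c\<bar> * riemannian_norm \<mu> p v"
proof -
  have b: "bilinear (\<mu> p)" using assms by (rule riemannian_metricD)
  show ?thesis
    by (simp add: riemannian_norm_def bilinear_lmul[OF b] bilinear_rmul[OF b] real_sqrt_mult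
        flip: mult.assoc power2_eq_square)
qed

lemma riemannian_norm_nonneg:
  assumes "riemannian_metric \<mu>"
  shows "riemannian_norm \<mu> p v \<ge> 0"
proof -
  have "\<mu> p v v \<ge> 0"
    using riemannian_metricD[OF assms] by (cases "v = 0") (simp_all add: bilinear_lzero less_imp_le)
  then show ?thesis by (simp add: riemannian_norm_def)
qed

text \<open>Substitution divides the integral by |m| and the speed gains the factor |m|. This serves
  both halves of a concatenation (m = 2) and reversal (m = -1); break points and endpoints form a
  finite set, which the integral ignores.\<close>

lemma has_integral_speed_affine:
  assumes \<mu>: "riemannian_metric \<mu>" and \<gamma>: "valid_path \<gamma>" and l: "(speed \<mu> \<gamma> has_integral l) {0..1}"
    and "m \<noteq> 0" and ab: "(\<lambda>x. 1 / m * x + - (c / m)) ` {0..1} = {a..b}"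
    and \<eta>: "\<And>x. x \<in> {a<..<b} \<Longrightarrow> \<eta> x = \<gamma> (m * x + c)"
  shows "(speed \<mu> \<eta> has_integral l) {a..b}"
proof -
  obtain S where S: "finite S" "\<forall>x\<in>{0..1} - S. \<gamma> differentiable at x"
    using \<gamma> by (auto simp: valid_path_def piecewise_C1_differentiable_on_def C1_differentiable_on_eq)
  have "((\<lambda>x. speed \<mu> \<gamma> (m * x + c)) has_integral (1 / \<bar>m\<bar>) *\<^sub>R l) {a..b}"
    using has_integral_affinity01[OF l \<open>m \<noteq> 0\<close>, of c] ab by simp
  from has_integral_mult_right[OF this, of "\<bar>m\<bar>"]
  have i: "((\<lambda>x. \<bar>m\<bar> * speed \<mu> \<gamma> (m * x + c)) has_integral l) {a..b}"
    using \<open>m \<noteq> 0\<close> by simp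
  show ?thesis
  proof (rule has_integral_spike_finite[OF _ _ i])
    have "inj (\<lambda>x. m * x + c)" using \<open>m \<noteq> 0\<close> by (auto simp: inj_def)
    then show "finite ({a, b} \<union> (\<lambda>x. m * x + c) -` S)"
      using S(1) by (simp add: finite_vimageI)
    fix x assume x: "x \<in> {a..b} - ({a, b} \<union> (\<lambda>x. m * x + c) -` S)"
    then have x': "x \<in> {a<..<b}" by auto
    have "x \<in> (\<lambda>x. 1 / m * x + - (c / m)) ` {0..1}" using x ab by auto
    then have "m * x + c \<in> {0..1}" using \<open>m \<noteq> 0\<close> by (auto simp: field_simps)
    then have "\<gamma> differentiable at (m * x + c)" using S(2) x by auto
    then have d: "(\<gamma> has_vector_derivative vector_derivative \<gamma> (at (m * x + c))) (at (m * x + c))"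
      by (simp add: vector_derivative_works)
    have "((\<lambda>x. m * x + c) has_vector_derivative m) (at x)"
      by (auto intro!: derivative_eq_intros)
    from vector_diff_chain_at[OF this d]
    have "((\<lambda>x. \<gamma> (m * x + c)) has_vector_derivative m *\<^sub>R vector_derivative \<gamma> (at (m * x + c))) (at x)"
      by (simp add: o_def)
    then have "(\<eta> has_vector_derivative m *\<^sub>R vector_derivative \<gamma> (at (m * x + c))) (at x)"
      by (rule has_vector_derivative_transform_within_open[where S = "{a<..<b}"]) (use \<eta> x' in auto)
    then show "speed \<mu> \<eta> x = \<bar>m\<bar> * speed \<mu> \<gamma> (m * x + c)"
      using \<eta>[OF x'] by (simp add: speed_def vector_derivative_at riemannian_norm_scaleR[OF \<mu>])
  qed
qed

lemma lengths_join:
  assumes "riemannian_metric \<mu>" "l \<in> lengths \<mu> p q" "k \<in> lengths \<mu> q r"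
  shows "l + k \<in> lengths \<mu> p r"
proof -
  obtain \<gamma> \<eta> where \<gamma>: "valid_path \<gamma>" "pathstart \<gamma> = p" "pathfinish \<gamma> = q" "(speed \<mu> \<gamma> has_integral l) {0..1}"
    and \<eta>: "valid_path \<eta>" "pathstart \<eta> = q" "pathfinish \<eta> = r" "(speed \<mu> \<eta> has_integral k) {0..1}"
    using assms by (auto simp: lengths_def)
  have "(speed \<mu> (\<gamma> +++ \<eta>) has_integral l) {0..1/2}"
    by (rule has_integral_speed_affine[OF assms(1) \<gamma>(1,4), of 2 0])
      (simp_all add: image_affinity_atLeastAtMost_div joinpaths_def)
  moreover have "(speed \<mu> (\<gamma> +++ \<eta>) has_integral k) {1/2..1}"
    by (rule has_integral_speed_affine[OF assms(1) \<eta>(1,4), of 2 "- 1"])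
      (simp_all add: image_affinity_atLeastAtMost_div joinpaths_def)
  ultimately have "(speed \<mu> (\<gamma> +++ \<eta>) has_integral (l + k)) {0..1}"
    by (intro has_integral_combine[where c = "1/2"]) auto
  then show ?thesis
    using \<gamma> \<eta> by (auto simp: lengths_def intro!: exI[of _ "\<gamma> +++ \<eta>"] valid_path_join)
qed

lemma lengths_reverse:
  assumes "riemannian_metric \<mu>" "l \<in> lengths \<mu> p q"
  shows "l \<in> lengths \<mu> q p"
proof -
  obtain \<gamma> where \<gamma>: "valid_path \<gamma>" "pathstart \<gamma> = p" "pathfinish \<gamma> = q" "(speed \<mu> \<gamma> has_integral l) {0..1}"
    using assms by (auto simp: lengths_def)
  have "(speed \<mu> (reversepath \<gamma>) has_integral l) {0..1}"
    by (rule has_integral_speed_affine[OF assms(1) \<gamma>(1,4), of "- 1" 1])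
      (simp_all add: image_affinity_atLeastAtMost reversepath_def)
  then show ?thesis
    using \<gamma> by (auto simp: lengths_def intro!: exI[of _ "reversepath \<gamma>"])
qed

lemma lengths_nonneg:
  assumes "riemannian_metric \<mu>" "l \<in> lengths \<mu> p q"
  shows "l \<ge> 0"
proof -
  obtain \<gamma> where "(speed \<mu> \<gamma> has_integral l) {0..1}"
    using assms by (auto simp: lengths_def)
  then show ?thesis
    by (rule has_integral_nonneg) (simp add: speed_def riemannian_norm_nonneg[OF assms(1)])
qed

lemma lengths_segment:
  assumes \<mu>: "riemannian_metric \<mu>"
    and B: "\<And>z. z \<in> closed_segment p q \<Longrightarrow> riemannian_norm \<mu> z (q - p) \<le> B"
  shows "\<exists>l\<in>lengths \<mu> p q. l \<le> B"
proof -
  have sp: "speed \<mu> (linepath p q) = (\<lambda>t. riemannian_norm \<mu> (linepath p q t) (q - p))"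
    by (simp add: speed_def fun_eq_iff)
  have "continuous_on {0..1} (\<lambda>t. \<mu> (linepath p q t) (q - p) (q - p))"
    by (rule continuous_on_compose2[OF smooth_imp_continuous_on[of "\<lambda>z. \<mu> z (q - p) (q - p)" UNIV]])
      (simp_all add: riemannian_metricD(3)[OF \<mu>] continuous_on_linepath)
  then have "continuous_on {0..1} (speed \<mu> (linepath p q))"
    unfolding sp riemannian_norm_def by (rule continuous_on_real_sqrt)
  then obtain l where l: "(speed \<mu> (linepath p q) has_integral l) {0..1}"
    using integrable_continuous_real integrable_on_def by blast
  have "l \<le> B"
  proof (rule has_integral_le[OF l])
    show "((\<lambda>t. B) has_integral B) {0..1::real}"
      using has_integral_const_real[of B 0 1] by simp
    show "speed \<mu> (linepath p q) t \<le> B" if "t \<in> {0..1}" for t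
      unfolding sp using that by (intro B) (auto simp: linepath_in_path)
  qed
  then show ?thesis
    using l by (auto simp: lengths_def intro!: bexI[of _ l] exI[of _ "linepath p q"])
qed

text \<open>The fundamental theorem of calculus, in the form that tolerates finitely many
  exceptional points, writes the change of \<phi> as the integral of a function dominated by the
  speed.\<close>

lemma lipschitz_le_length:
  fixes \<phi> :: "plane \<Rightarrow> real"
  assumes l: "l \<in> lengths \<mu> p q"
    and \<phi>: "\<And>z. (\<phi> has_derivative \<phi>' z) (at z)" "\<And>z v. \<bar>\<phi>' z v\<bar> \<le> riemannian_norm \<mu> z v"
  shows "\<bar>\<phi> q - \<phi> p\<bar> \<le> l"
proof -
  obtain \<gamma> where \<gamma>: "valid_path \<gamma>" "pathstart \<gamma> = p" "pathfinish \<gamma> = q" "(speed \<mu> \<gamma> has_integral l) {0..1}"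
    using l by (auto simp: lengths_def)
  obtain S where S: "finite S" "\<forall>x\<in>{0..1} - S. \<gamma> differentiable at x" and c: "continuous_on {0..1} \<gamma>"
    using \<gamma>(1) by (auto simp: valid_path_def piecewise_C1_differentiable_on_def C1_differentiable_on_eq)
  let ?D = "\<lambda>t. \<phi>' (\<gamma> t) (vector_derivative \<gamma> (at t))"
  have "(?D has_integral ((\<phi> \<circ> \<gamma>) 1 - (\<phi> \<circ> \<gamma>) 0)) {0..1}"
  proof (rule fundamental_theorem_of_calculus_strong[OF S(1)])
    have "continuous_on UNIV \<phi>"
      using \<phi>(1) by (auto intro!: continuous_at_imp_continuous_on has_derivative_continuous)
    then show "continuous_on {0..1} (\<phi> \<circ> \<gamma>)"
      by (rule continuous_on_compose[OF c continuous_on_subset]) simp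
    fix t :: real assume "t \<in> {0..1} - S"
    then have "(\<gamma> has_vector_derivative vector_derivative \<gamma> (at t)) (at t)"
      using S(2) by (simp add: vector_derivative_works)
    then have d: "(\<phi> \<circ> \<gamma> has_derivative \<phi>' (\<gamma> t) \<circ> (\<lambda>s. s *\<^sub>R vector_derivative \<gamma> (at t))) (at t)"
      by (intro diff_chain_at \<phi>) (simp add: has_vector_derivative_def)
    have "\<phi>' (\<gamma> t) (s *\<^sub>R v) = s * \<phi>' (\<gamma> t) v" for s v
      using has_derivative_linear[OF \<phi>(1)] by (simp add: linear_scale)
    then show "(\<phi> \<circ> \<gamma> has_vector_derivative ?D t) (at t)"
      using d by (simp add: has_vector_derivative_def o_def)
  qed simp
  then have i: "(?D has_integral (\<phi> q - \<phi> p)) {0..1}"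
    using \<gamma>(2,3) by (simp add: pathstart_def pathfinish_def)
  have "\<phi> q - \<phi> p \<le> l"
    by (rule has_integral_le[OF i \<gamma>(4)]) (use \<phi>(2) in \<open>auto simp: speed_def abs_le_iff\<close>)
  moreover have "- (\<phi> q - \<phi> p) \<le> l"
    by (rule has_integral_le[OF has_integral_neg[OF i] \<gamma>(4)]) (use \<phi>(2) in \<open>auto simp: speed_def abs_le_iff\<close>)
  ultimately show ?thesis by simp
qed

text \<open>A metric is smooth in the base point for fixed vectors only, so the uniform bound is
  assembled from its four coefficients in the standard basis.\<close>

lemma riemannian_norm_locally_bounded:
  assumes \<mu>: "riemannian_metric \<mu>" and K: "compact K"
  obtains B where "B > 0" "\<And>z v. z \<in> K \<Longrightarrow> riemannian_norm \<mu> z v \<le> B * norm v"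
proof -
  let ?m = "\<lambda>i j z. \<bar>\<mu> z i j\<bar>" and ?e1 = "(1::real, 0::real)" and ?e2 = "(0::real, 1::real)"
  let ?s = "\<lambda>z. ?m ?e1 ?e1 z + ?m ?e1 ?e2 z + ?m ?e2 ?e1 z + ?m ?e2 ?e2 z"
  have "continuous_on K ?s"
    by (intro continuous_intros smooth_imp_continuous_on riemannian_metricD[OF \<mu>])
  then have "bounded (?s ` K)" using K by (intro compact_imp_bounded compact_continuous_image)
  then obtain C where "C > 0" and C: "\<And>z. z \<in> K \<Longrightarrow> \<bar>?s z\<bar> \<le> C"
    by (auto simp: bounded_pos)
  have "riemannian_norm \<mu> z v \<le> sqrt C * norm v" if "z \<in> K" for z v
  proof -
    obtain a b where v: "v = (a, b)" by fastforce
    have bl: "bilinear (\<mu> z)" using \<mu> by (rule riemannian_metricD)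
    have "v = a *\<^sub>R ?e1 + b *\<^sub>R ?e2" by (simp add: v)
    then have "\<mu> z v v = \<mu> z (a *\<^sub>R ?e1 + b *\<^sub>R ?e2) (a *\<^sub>R ?e1 + b *\<^sub>R ?e2)" by metis
    also have "\<dots> = a * a * \<mu> z ?e1 ?e1 + a * b * \<mu> z ?e1 ?e2 + a * b * \<mu> z ?e2 ?e1 + b * b * \<mu> z ?e2 ?e2"
      unfolding bilinear_ladd[OF bl] bilinear_radd[OF bl] bilinear_lmul[OF bl] bilinear_rmul[OF bl]
      by (simp add: algebra_simps)
    also have "\<dots> \<le> (norm v)\<^sup>2 * ?m ?e1 ?e1 z + (norm v)\<^sup>2 * ?m ?e1 ?e2 z + (norm v)\<^sup>2 * ?m ?e2 ?e1 z
        + (norm v)\<^sup>2 * ?m ?e2 ?e2 z"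
    proof -
      have n: "\<bar>a\<bar> \<le> norm v" "\<bar>b\<bar> \<le> norm v"
        using norm_fst_le[of a b] norm_snd_le[of b a] by (auto simp: v)
      have "x * y * m \<le> (norm v)\<^sup>2 * \<bar>m\<bar>" if "\<bar>x\<bar> \<le> norm v" "\<bar>y\<bar> \<le> norm v" for x y m
      proof -
        have "x * y * m \<le> \<bar>x\<bar> * \<bar>y\<bar> * \<bar>m\<bar>" by (metis abs_ge_self abs_mult)
        also have "\<dots> \<le> norm v * norm v * \<bar>m\<bar>"
          using that by (intro mult_right_mono mult_mono) auto
        finally show ?thesis by (simp add: power2_eq_square)
      qed
      then show ?thesis using n by (intro add_mono) auto
    qed
    also have "\<dots> = (norm v)\<^sup>2 * ?s z" by (simp add: algebra_simps)
    also have "\<dots> \<le> (norm v)\<^sup>2 * C"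
      using C[OF that] by (intro mult_left_mono) auto
    finally show ?thesis
      unfolding riemannian_norm_def by (metis mult.commute norm_ge_zero real_sqrt_le_mono real_sqrt_mult real_sqrt_unique)
  qed
  then show thesis using that[of "sqrt C"] \<open>C > 0\<close> by simp
qed

text \<open>Along a path, a function whose gradient has norm at most 1 changes by at most the length of the
  path. Hence separation of points makes the Riemannian distance positive, and boundedness of the joint
  sublevel sets gives Cauchy sequences convergent subsequences.\<close>

lemma complete_riemannian_metricI:
  fixes F :: "(plane \<Rightarrow> real) set"
  assumes \<mu>: "riemannian_metric \<mu>"
    and deriv: "\<And>\<phi> z. \<phi> \<in> F \<Longrightarrow> (\<phi> has_derivative \<phi>' \<phi> z) (at z)"
    and le: "\<And>\<phi> z v. \<phi> \<in> F \<Longrightarrow> \<bar>\<phi>' \<phi> z v\<bar> \<le> riemannian_norm \<mu> z v"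
    and separating: "\<And>p q. (\<And>\<phi>. \<phi> \<in> F \<Longrightarrow> \<phi> p = \<phi> q) \<Longrightarrow> p = q"
    and proper: "\<And>R p. bounded {q. \<forall>\<phi>\<in>F. \<bar>\<phi> q - \<phi> p\<bar> \<le> R}"
  shows "complete_riemannian_metric \<mu>"
proof -
  let ?d = "riemannian_dist \<mu>"
  have bdd: "bdd_below (lengths \<mu> p q)" for p q
    by (rule bdd_belowI) (rule lengths_nonneg[OF \<mu>])
  \<comment> \<open>Near \<open>p\<close> the Riemannian distance is at most a multiple of the
    Euclidean one, since segments from \<open>p\<close> stay in the unit ball. This later turns
    Euclidean convergence of a subsequence into convergence in the metric.\<close>
  have local: "\<exists>B>0. \<forall>q. dist q p \<le> 1 \<longrightarrow> (\<exists>l\<in>lengths \<mu> p q. l \<le> B * dist q p)" for p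
  proof -
    obtain B where "B > 0" and B: "\<And>z v. z \<in> cball p 1 \<Longrightarrow> riemannian_norm \<mu> z v \<le> B * norm v"
      using riemannian_norm_locally_bounded[OF \<mu> compact_cball] by blast
    have "\<exists>l\<in>lengths \<mu> p q. l \<le> B * dist q p" if "dist q p \<le> 1" for q
    proof (rule lengths_segment[OF \<mu>])
      fix z assume "z \<in> closed_segment p q"
      then have "z \<in> cball p 1"
        using that closed_segment_subset[of p "cball p 1" q] by (auto simp: dist_commute)
      then show "riemannian_norm \<mu> z (q - p) \<le> B * dist q p" using B by (simp add: dist_norm)
    qed
    then show ?thesis using \<open>B > 0\<close> by blast
  qed
  have nonempty: "lengths \<mu> p q \<noteq> {}" for p q
  proof -
    obtain B where "B > 0" and B: "\<And>z v. z \<in> closed_segment p q \<Longrightarrow> riemannian_norm \<mu> z v \<le> B * norm v"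
      using riemannian_norm_locally_bounded[OF \<mu> compact_segment] by blast
    then show ?thesis using lengths_segment[OF \<mu>, of p q "B * norm (q - p)"] by blast
  qed
  have d_le: "?d p q \<le> l" if "l \<in> lengths \<mu> p q" for p q l
    unfolding riemannian_dist_eq using that bdd by (rule cInf_lower)
  have lip: "\<bar>\<phi> p - \<phi> q\<bar> \<le> ?d q p" if "\<phi> \<in> F" for \<phi> p q
    unfolding riemannian_dist_eq
    by (rule cInf_greatest[OF nonempty]) (rule lipschitz_le_length[OF _ deriv[OF that] le[OF that]])
  interpret M: Metric_space UNIV ?d
  proof
    fix p q r
    show nonneg: "0 \<le> ?d p q" for p q
      unfolding riemannian_dist_eq by (rule cInf_greatest[OF nonempty lengths_nonneg[OF \<mu>]])
    have "lengths \<mu> p q = lengths \<mu> q p" using lengths_reverse[OF \<mu>] by blast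
    then show "?d p q = ?d q p" by (simp add: riemannian_dist_eq)
    show "?d p q = 0 \<longleftrightarrow> p = q"
    proof
      assume "?d p q = 0"
      then show "p = q" using lip[of _ q p] by (intro separating) fastforce
    next
      assume "p = q"
      obtain l where "l \<in> lengths \<mu> p p" "l \<le> 0"
        using local[of p] by (metis dist_self mult_zero_right zero_le_one)
      then show "?d p q = 0" using nonneg[of p p] d_le[of l p p] \<open>p = q\<close> by simp
    qed
    show "?d p r \<le> ?d p q + ?d q r"
    proof -
      have "?d p r - l \<le> ?d q r" if "l \<in> lengths \<mu> p q" for l
        unfolding riemannian_dist_eq[of \<mu> q r]
      proof (rule cInf_greatest[OF nonempty])
        fix k assume "k \<in> lengths \<mu> q r"
        then show "?d p r - l \<le> k"
          using d_le[OF lengths_join[OF \<mu> that]] by (simp add: algebra_simps)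
      qed
      then have "?d p r - ?d q r \<le> ?d p q"
        unfolding riemannian_dist_eq[of \<mu> p q]
        by (intro cInf_greatest[OF nonempty]) (simp add: algebra_simps)
      then show ?thesis by (simp only: diff_le_eq)
    qed
  qed
  have "M.mcomplete"
    unfolding M.mcomplete_def
  proof (intro allI impI)
    fix \<sigma> assume \<sigma>: "M.MCauchy \<sigma>"
    obtain n0 where n0: "\<And>n n'. n0 \<le> n \<Longrightarrow> n0 \<le> n' \<Longrightarrow> ?d (\<sigma> n) (\<sigma> n') < 1"
      using \<sigma> unfolding M.MCauchy_def by (metis zero_less_one)
    \<comment> \<open>The tail lies within distance 1 of its first point, hence in one joint
      sublevel set of \<open>F\<close>.\<close>
    define \<tau> where "\<tau> n = \<sigma> (n0 + n)" for n
    have "bounded (range \<tau>)"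
    proof (rule bounded_subset[OF proper[of "\<sigma> n0" 1]])
      show "range \<tau> \<subseteq> {q. \<forall>\<phi>\<in>F. \<bar>\<phi> q - \<phi> (\<sigma> n0)\<bar> \<le> 1}"
      proof (intro image_subsetI CollectI ballI)
        fix n \<phi> assume "\<phi> \<in> F"
        then show "\<bar>\<phi> (\<tau> n) - \<phi> (\<sigma> n0)\<bar> \<le> 1"
          using lip[of \<phi> "\<tau> n" "\<sigma> n0"] n0[of n0 "n0 + n"] by (simp add: \<tau>_def)
      qed
    qed
    then obtain x r where r: "strict_mono r" and x: "(\<tau> \<circ> r) \<longlonglongrightarrow> x"
      using bounded_imp_convergent_subsequence by blast
    obtain B where "B > 0" and B: "\<And>q. dist q x \<le> 1 \<Longrightarrow> \<exists>l\<in>lengths \<mu> x q. l \<le> B * dist q x"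
      using local[of x] by blast
    have "limitin M.mtopology (\<tau> \<circ> r) x sequentially"
      unfolding M.limitin_metric_dist_null
    proof (intro conjI)
      have dx: "(\<lambda>n. dist ((\<tau> \<circ> r) n) x) \<longlonglongrightarrow> 0" by (rule tendsto_dist_iff[THEN iffD1, OF x])
      then have "\<forall>\<^sub>F n in sequentially. dist ((\<tau> \<circ> r) n) x < 1"
        by (rule order_tendstoD(2)) (rule zero_less_one)
      then have "\<forall>\<^sub>F n in sequentially. norm (?d ((\<tau> \<circ> r) n) x) \<le> B * dist ((\<tau> \<circ> r) n) x"
      proof (rule eventually_mono)
        fix n assume "dist ((\<tau> \<circ> r) n) x < 1"
        then obtain l where "l \<in> lengths \<mu> x ((\<tau> \<circ> r) n)" "l \<le> B * dist ((\<tau> \<circ> r) n) x"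
          using B[OF less_imp_le] by blast
        then have "?d ((\<tau> \<circ> r) n) x \<le> B * dist ((\<tau> \<circ> r) n) x"
          using d_le[of l x "(\<tau> \<circ> r) n"] M.commute[of x "(\<tau> \<circ> r) n"] by linarith
        then show "norm (?d ((\<tau> \<circ> r) n) x) \<le> B * dist ((\<tau> \<circ> r) n) x"
          by (simp only: real_norm_def M.abs_mdist)
      qed
      then show "(\<lambda>n. ?d ((\<tau> \<circ> r) n) x) \<longlonglongrightarrow> 0"
        by (rule Lim_null_comparison) (use tendsto_mult_right_zero[OF dx] in simp)
    qed auto
    moreover have "\<tau> \<circ> r = \<sigma> \<circ> (\<lambda>n. n0 + r n)" by (simp add: \<tau>_def fun_eq_iff)
    moreover have "strict_mono (\<lambda>n. n0 + r n)" using r by (simp add: strict_mono_def)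
    ultimately have "limitin M.mtopology \<sigma> x sequentially"
      using M.MCauchy_convergent_subsequence[OF \<sigma>] by metis
    then show "\<exists>x. limitin M.mtopology \<sigma> x sequentially" by blast
  qed
  then show ?thesis using \<mu> by (simp add: complete_riemannian_metric_def)
qed

subsection \<open>A star-shaped region with tentacles\<close>

locale tentacles =
  fixes \<delta> :: real
  assumes \<delta>: "0 < \<delta>" "\<delta> \<le> 1 / 8"
begin

text \<open>The minima, of value \<delta> at the integers, are the axes of the tentacles. As
  \<delta> is at most 1/8, the maximum \<delta> + 1/2 is below 3/4, which keeps 1 - osc e^(-u) above
  1/4.\<close>

definition osc :: "real \<Rightarrow> real" where
  "osc t = \<delta> + (1 - cos (2 * pi * t)) / 4"

text \<open>In the quadrant this is osc(t) e^(-1/(xy)): the term cos(2 pi t) with t = ln(y/x)/2 has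
  frequency pi in the variable ln(y/x).\<close>

definition Q :: "plane \<Rightarrow> real" where
  "Q z = (\<delta> + 1 / 4) * flat_osc 0 0 0 z + (- 1 / 4) * flat_osc 0 pi 0 z"

text \<open>With T = A^(-1/2) the image product is ab = xy T^2 = xy/A, so that 1/(ab) = A/(xy) =
  1/(xy) + Q as required.\<close>

definition A :: "plane \<Rightarrow> real" where
  "A z = 1 + fst z * snd z * Q z"

definition T :: "plane \<Rightarrow> real" where
  "T z = A z powr (- 1 / 2)"

definition G :: "plane \<Rightarrow> real" where "G z = fst z * T z"

definition H :: "plane \<Rightarrow> real" where "H z = snd z * T z"

lemma osc_bounds: "\<delta> \<le> osc t" "0 < osc t" "osc t < 1"
proof -
  show "\<delta> \<le> osc t" "0 < osc t" "osc t < 1"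
    unfolding osc_def using \<delta> cos_le_one[of "2 * pi * t"] cos_ge_minus_one[of "2 * pi * t"]
    by argo+
qed

lemma osc_periodic: "osc (t + 1) = osc t"
  by (simp add: osc_def distrib_left)

lemma Q_eq:
  "Q z = (if fst z > 0 \<and> snd z > 0
     then osc (ln (snd z / fst z) / 2) * exp (- inverse (fst z * snd z)) else 0)"
proof -
  have "(\<delta> + 1 / 4) * e + (- 1 / 4) * (e * c) = (\<delta> + (1 - c) / 4) * e" for c e :: real
    by (simp add: field_simps)
  then show ?thesis
    by (simp add: Q_def flat_osc_def osc_def)
qed

lemma Q_bounds: "0 \<le> Q z" "Q z \<le> 3 / 4"
proof -
  have "osc t * exp (- u) \<le> 3 / 4 * 1" if "u > 0" for t u
  proof (rule mult_mono)
    show "osc t \<le> 3 / 4"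
      unfolding osc_def using \<delta> cos_ge_minus_one[of "2 * pi * t"] by argo
  qed (use that in auto)
  then show "0 \<le> Q z" "Q z \<le> 3 / 4"
    using osc_bounds(2) by (auto simp: Q_eq less_imp_le)
qed

lemma PQ_nonneg: "0 \<le> fst z * snd z * Q z"
  using Q_bounds(1)[of z] by (cases "fst z > 0 \<and> snd z > 0") (auto simp: Q_eq)

lemma A_ge_1: "1 \<le> A z"
  using PQ_nonneg[of z] by (simp add: A_def)

lemma A_le: "A z \<le> 1 + \<bar>fst z * snd z\<bar>"
proof -
  have "fst z * snd z * Q z \<le> \<bar>fst z * snd z\<bar> * Q z"
    using Q_bounds by (intro mult_right_mono) auto
  also have "\<dots> \<le> \<bar>fst z * snd z\<bar> * 1"
    using Q_bounds[of z] by (intro mult_left_mono) auto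
  finally show ?thesis by (simp add: A_def)
qed

lemma T_pos: "0 < T z"
  using A_ge_1[of z] by (simp add: T_def)

lemma T_sq: "(T z)\<^sup>2 * A z = 1"
proof -
  have "(T z)\<^sup>2 = A z powr (- 1)"
    unfolding T_def power2_eq_square powr_add[symmetric] by simp
  then show ?thesis using A_ge_1[of z] by (simp add: powr_minus)
qed

lemma T_le_1: "T z \<le> 1"
proof -
  have "(T z)\<^sup>2 * 1 \<le> (T z)\<^sup>2 * A z" using A_ge_1[of z] by (intro mult_left_mono) auto
  then show ?thesis using T_sq[of z] T_pos[of z] by (simp add: power2_le_iff_abs_le abs_square_le_1)
qed

lemma inverse_T_le: "inverse (T z) \<le> A z"
proof -
  have "1 = T z * (T z * A z)" using T_sq[of z] by (simp add: power2_eq_square mult.assoc)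
  also have "\<dots> \<le> 1 * (T z * A z)" using T_le_1[of z] T_pos[of z] A_ge_1[of z] by (intro mult_right_mono) auto
  finally show ?thesis using T_pos[of z] by (simp add: field_simps)
qed

lemma smooth_T: "smooth T"
proof -
  have "smooth A"
    unfolding A_def[abs_def] Q_def
    by (intro smooth_add smooth_mult smooth_const smooth_flat_osc smooth_bounded_linear
        bounded_linear_fst bounded_linear_snd)
  then show ?thesis
    unfolding T_def[abs_def] using A_ge_1 by (intro smooth_powr) (auto intro: less_le_trans[of 0 1])
qed

lemma smooth_G: "smooth G"
  unfolding G_def[abs_def] by (intro smooth_mult smooth_T smooth_bounded_linear bounded_linear_fst)

lemma smooth_H: "smooth H"
  unfolding H_def[abs_def] by (intro smooth_mult smooth_T smooth_bounded_linear bounded_linear_snd)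

section \<open>Derivative of the radial map\<close>

definition Z :: "plane \<Rightarrow> real" where
  "Z z = (\<delta> + 1 / 4) * flat_osc 2 0 0 z + (- 1 / 4) * flat_osc 2 pi 0 z"

definition U :: "plane \<Rightarrow> real" where
  "U z = (- pi / 4) * flat_osc 1 pi (pi / 2) z"

lemma P2_Z: "(fst z * snd z)\<^sup>2 * Z z = Q z"
  by (simp add: Z_def Q_def flat_osc_def field_simps power2_eq_square)

text \<open>The single factor 1/(xy) in \<open>U\<close> cancels; the exponential and the cosine are
  at most 1, which leaves pi/4.\<close>

lemma P_U: "\<bar>fst z * snd z * U z\<bar> \<le> 1"
proof (cases "fst z > 0 \<and> snd z > 0")
  case True
  then have "\<bar>fst z * snd z * U z\<bar>
      = (pi / 4) * (exp (- inverse (fst z * snd z)) * \<bar>cos (pi * ln (snd z / fst z) + pi / 2)\<bar>)"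
    by (simp add: U_def flat_osc_def abs_mult field_simps)
  also have "\<dots> \<le> 1 * (1 * 1)"
    using True pi_less_4 by (intro mult_mono) auto
  finally show ?thesis by simp
qed (auto simp: U_def flat_osc_def)

text \<open>x dy + y dx is the differential of xy, and x dy - y dx is xy times that of ln(y/x).
  \<open>Z\<close> and \<open>U\<close> are the coefficients of dQ in this frame.\<close>

lemma Q_has_derivative:
  "(Q has_derivative (\<lambda>w. Z z * (fst z * snd w + snd z * fst w) + U z * (fst z * snd w - snd z * fst w))) (at z)"
proof -
  have "(flat_osc 0 \<omega> 0 has_derivative (\<lambda>w. flat_osc 2 \<omega> 0 z * (fst z * snd w + snd z * fst w)
      + \<omega> * flat_osc 1 \<omega> (pi / 2) z * (fst z * snd w - snd z * fst w))) (at z)" for \<omega>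
    using flat_osc_has_derivative[of 0 \<omega> 0 z] by (simp add: numeral_2_eq_2)
  from has_derivative_add[OF has_derivative_mult_right[OF this, of "\<delta> + 1 / 4"]
      has_derivative_mult_right[OF this, of "- 1 / 4"], of 0 pi]
  show ?thesis
    unfolding Q_def[abs_def]
    by (rule has_derivative_eq_rhs) (simp add: Z_def U_def fun_eq_iff field_simps)
qed

definition dT :: "plane \<Rightarrow> plane \<Rightarrow> real" where
  "dT z w = - 1 / 2 * T z ^ 3 *
     ((Q z + fst z * snd z * Z z) * (fst z * snd w + snd z * fst w)
      + fst z * snd z * U z * (fst z * snd w - snd z * fst w))"

lemma T_has_derivative: "(T has_derivative dT z) (at z)"
proof -
  have "A z > 0" using A_ge_1[of z] by simp
  have T3: "A z powr (- 1 / 2 - 1) = T z ^ 3"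
  proof -
    have "T z ^ 3 = A z powr (- 1 / 2 + - 1 / 2 + - 1 / 2)"
      unfolding T_def powr_add by (simp add: power3_eq_cube)
    then show ?thesis by simp
  qed
  have dA: "(A has_derivative (\<lambda>w. fst z * snd z *
       (Z z * (fst z * snd w + snd z * fst w) + U z * (fst z * snd w - snd z * fst w))
       + (fst z * snd w + fst w * snd z) * Q z)) (at z)"
    unfolding A_def[abs_def]
    by (rule derivative_eq_intros Q_has_derivative refl | simp)+
  have "((\<lambda>y. y powr (- 1 / 2)) has_real_derivative - 1 / 2 * A z powr (- 1 / 2 - 1)) (at (A z))"
    using \<open>A z > 0\<close> by (rule has_real_derivative_powr)
  then have d: "((\<lambda>y. y powr (- 1 / 2)) has_derivative (\<lambda>x. - 1 / 2 * T z ^ 3 * x)) (at (A z))"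
    unfolding T3 has_field_derivative_def .
  have T_eq: "T = (\<lambda>y. y powr (- 1 / 2)) \<circ> A" by (simp add: T_def fun_eq_iff)
  have "(T has_derivative (\<lambda>x. - 1 / 2 * T z ^ 3 * x) \<circ> (\<lambda>w. fst z * snd z *
       (Z z * (fst z * snd w + snd z * fst w) + U z * (fst z * snd w - snd z * fst w))
       + (fst z * snd w + fst w * snd z) * Q z)) (at z)"
    using diff_chain_at[OF dA d] unfolding T_eq[symmetric] .
  then show ?thesis
    by (rule has_derivative_eq_rhs) (simp add: dT_def fun_eq_iff field_simps)
qed

lemma G_has_derivative: "(G has_derivative (\<lambda>w. fst w * T z + fst z * dT z w)) (at z)"
  unfolding G_def[abs_def]
  by (rule derivative_eq_intros T_has_derivative refl | simp add: add.commute)+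

lemma H_has_derivative: "(H has_derivative (\<lambda>w. snd w * T z + snd z * dT z w)) (at z)"
  unfolding H_def[abs_def]
  by (rule derivative_eq_intros T_has_derivative refl | simp add: add.commute)+

context
  fixes z w :: plane and p \<omega> dG dH
  defines "p \<equiv> fst z * snd w + snd z * fst w"
    and "\<omega> \<equiv> fst z * snd w - snd z * fst w"
    and "dG \<equiv> fst w * T z + fst z * dT z w"
    and "dH \<equiv> snd w * T z + snd z * dT z w"
begin

text \<open>The terms with dT cancel in G dH - H dG, because a radial change does not turn the
  point. What remains is T^2 (x dy - y dx), and T^2 A = 1.\<close>

lemma polar_identity_angle: "\<omega> = A z * (G z * dH - H z * dG)"
proof -
  have "G z * dH - H z * dG = (T z)\<^sup>2 * \<omega>"
    by (simp add: G_def H_def dG_def dH_def \<omega>_def power2_eq_square algebra_simps)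
  then show ?thesis using T_sq[of z] by (metis mult.assoc mult.commute mult_1)
qed

text \<open>In the quadrant this is the differential of 1/(GH) = u + osc e^(-u), multiplied by
  -(xy)^2. The coefficient 1 - Q is the derivative of the right-hand side in u. The computation from
  \<open>dT\<close> covers all points uniformly.\<close>

lemma polar_identity_radius:
  "(1 - Q z) * p = (A z)\<^sup>2 * (H z * dG + G z * dH) + (fst z * snd z)\<^sup>2 * U z * \<omega>"
proof -
  let ?P = "fst z * snd z"
  have "H z * dG + G z * dH = (T z)\<^sup>2 * p + 2 * ?P * T z * dT z w"
    by (simp add: G_def H_def dG_def dH_def p_def power2_eq_square algebra_simps)
  also have "2 * ?P * T z * dT z w = - ((T z)\<^sup>2)\<^sup>2 * ((?P * Q z + ?P\<^sup>2 * Z z) * p + ?P\<^sup>2 * U z * \<omega>)"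
    unfolding dT_def p_def[symmetric] \<omega>_def[symmetric]
    by (simp add: power2_eq_square power3_eq_cube algebra_simps)
  also have "?P * Q z + ?P\<^sup>2 * Z z = A z - 1 + Q z"
    unfolding P2_Z by (simp add: A_def)
  finally have "(A z)\<^sup>2 * (H z * dG + G z * dH) = (A z)\<^sup>2 *
      ((T z)\<^sup>2 * p + - ((T z)\<^sup>2)\<^sup>2 * ((A z - 1 + Q z) * p + ?P\<^sup>2 * U z * \<omega>))"
    by (rule arg_cong)
  also have "\<dots> = A z * ((T z)\<^sup>2 * A z) * p - ((T z)\<^sup>2 * A z)\<^sup>2 * ((A z - 1 + Q z) * p + ?P\<^sup>2 * U z * \<omega>)"
    by (simp add: power2_eq_square algebra_simps)
  finally show ?thesis unfolding T_sq by (simp add: algebra_simps)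
qed

text \<open>Vanishing dG and dH force \<omega> = 0, then p = 0 since 1 - Q is at least 1/4, hence dT
  = 0, and positivity of \<open>T\<close> gives w = 0. The detour through dT matters at the origin,
  where p and \<omega> vanish for every w.\<close>

lemma immersion_GH:
  assumes "dG = 0" "dH = 0"
  shows "w = 0"
proof -
  have "\<omega> = 0" using polar_identity_angle assms by simp
  then have "(1 - Q z) * p = 0" using polar_identity_radius assms by simp
  then have "p = 0" using Q_bounds[of z] by simp
  then have "dT z w = 0"
    using \<open>\<omega> = 0\<close> unfolding dT_def p_def[symmetric] \<omega>_def[symmetric] by simp
  then show "w = 0"
    using assms T_pos[of z] by (simp add: dG_def dH_def prod_eq_iff)
qed

text \<open>This compares the differential of xy with dG and dH, as completeness requires. The
  constant is 4, from 1 - Q \<ge> 1/4, times the 4 that bounds (1 + |P|)(1 + 2|P|) by 4(1 +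
  P^2).\<close>

lemma product_derivative_bound:
  "\<bar>p\<bar> \<le> 16 * (1 + (fst z * snd z)\<^sup>2) * (\<bar>H z\<bar> * \<bar>dG\<bar> + \<bar>G z\<bar> * \<bar>dH\<bar>)"
proof -
  let ?P = "fst z * snd z" and ?s = "\<bar>H z\<bar> * \<bar>dG\<bar> + \<bar>G z\<bar> * \<bar>dH\<bar>"
  have s: "0 \<le> ?s" by simp
  have "\<bar>\<omega>\<bar> \<le> A z * ?s"
  proof -
    have "\<bar>G z * dH - H z * dG\<bar> \<le> ?s"
      using abs_triangle_ineq4[of "G z * dH" "H z * dG"] by (simp add: abs_mult)
    then show ?thesis
      unfolding polar_identity_angle using A_ge_1[of z] by (simp add: abs_mult)
  qed
  moreover have "\<bar>?P\<^sup>2 * U z\<bar> \<le> \<bar>?P\<bar>"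
  proof -
    have "\<bar>?P\<^sup>2 * U z\<bar> = \<bar>?P\<bar> * \<bar>?P * U z\<bar>" by (simp add: abs_mult power2_eq_square)
    also have "\<dots> \<le> \<bar>?P\<bar> * 1" by (intro mult_left_mono P_U) simp
    finally show ?thesis by simp
  qed
  ultimately have 1: "\<bar>?P\<^sup>2 * U z * \<omega>\<bar> \<le> \<bar>?P\<bar> * (A z * ?s)"
    unfolding abs_mult[of "?P\<^sup>2 * U z"] by (intro mult_mono) auto
  have 2: "\<bar>(A z)\<^sup>2 * (H z * dG + G z * dH)\<bar> \<le> (A z)\<^sup>2 * ?s"
    using abs_triangle_ineq[of "H z * dG" "G z * dH"] by (simp add: abs_mult mult_left_mono)
  have "1 / 4 * \<bar>p\<bar> \<le> (1 - Q z) * \<bar>p\<bar>"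
    using Q_bounds[of z] by (intro mult_right_mono) auto
  also have "\<dots> = \<bar>(1 - Q z) * p\<bar>"
    using Q_bounds[of z] by (simp add: abs_mult)
  also have "\<dots> \<le> (A z)\<^sup>2 * ?s + \<bar>?P\<bar> * (A z * ?s)"
    unfolding polar_identity_radius using 1 2 by linarith
  also have "\<dots> = A z * (A z + \<bar>?P\<bar>) * ?s" by (simp add: power2_eq_square algebra_simps)
  also have "\<dots> \<le> (1 + \<bar>?P\<bar>) * (1 + 2 * \<bar>?P\<bar>) * ?s"
    using A_le[of z] A_ge_1[of z] s by (intro mult_right_mono mult_mono) auto
  also have "\<dots> \<le> 4 * (1 + ?P\<^sup>2) * ?s"
  proof (rule mult_right_mono[OF _ s])
    \<comment> \<open>Completes the square in 4(1 + P^2) - (1 + |P|)(1 + 2|P|) = 2 P^2 - 3|P| +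
      3.\<close>
    have "0 \<le> 2 * (\<bar>?P\<bar> - 3/4)\<^sup>2" by simp
    also have "\<dots> = 2 * ?P\<^sup>2 - 3 * \<bar>?P\<bar> + 9 / 8"
      by (simp add: power2_eq_square algebra_simps)
    finally have "3 * \<bar>?P\<bar> \<le> 3 + 2 * ?P\<^sup>2" by simp
    then show "(1 + \<bar>?P\<bar>) * (1 + 2 * \<bar>?P\<bar>) \<le> 4 * (1 + ?P\<^sup>2)"
      by (simp add: algebra_simps power2_eq_square flip: abs_mult)
  qed
  finally show ?thesis by (simp add: algebra_simps)
qed

end

end

section \<open>Injectivity, image and equivariance of the radial map\<close>

definition quadrant :: "plane set" where
  "quadrant = {z. fst z > 0 \<and> snd z > 0}"

text \<open>The function u + c e^(-u) has slope 1 - c e^(-u) > 0; the inequality 1 + x \<le> e^x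
  gives strict monotonicity directly.\<close>

lemma add_mult_exp_minus_inj:
  fixes u v c :: real
  assumes "0 < c" "c < 1" "0 < u" "0 < v" and eq: "u + c * exp (- u) = v + c * exp (- v)"
  shows "u = v"
proof -
  have False if "0 < u" "u < v" "u + c * exp (- u) = v + c * exp (- v)" for u v
  proof -
    have "1 + (u - v) \<le> exp (u - v)" by (rule exp_ge_add_one_self)
    then have "exp (- u) * (1 + (u - v)) \<le> exp (- u) * exp (u - v)" by (intro mult_left_mono) auto
    also have "\<dots> = exp (- v)" by (simp flip: exp_add)
    finally have "exp (- u) - exp (- v) \<le> exp (- u) * (v - u)" by (simp add: algebra_simps)
    also have "\<dots> \<le> 1 * (v - u)" using that by (intro mult_right_mono) auto
    finally have "c * (exp (- u) - exp (- v)) \<le> c * (v - u)" using \<open>0 < c\<close> by simp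
    also have "\<dots> < 1 * (v - u)" using \<open>c < 1\<close> that by (intro mult_strict_right_mono) auto
    finally show False using that by (simp add: algebra_simps)
  qed
  then show ?thesis using assms by (metis linorder_neqE)
qed

context tentacles
begin

lemma outside_quadrant: "z \<notin> quadrant \<Longrightarrow> T z = 1 \<and> G z = fst z \<and> H z = snd z"
proof -
  assume "z \<notin> quadrant"
  then have "Q z = 0" by (auto simp: quadrant_def Q_eq)
  then show ?thesis by (simp add: G_def H_def T_def A_def)
qed

text \<open>The defining equation of the radial map. Because H/G = y/x, the value of
  \<open>osc\<close> can be read off the image point, and the equation then determines u.\<close>

lemma quadrant_inverse_product:
  assumes "z \<in> quadrant"
  defines "u \<equiv> inverse (fst z * snd z)"
  shows "inverse (G z * H z) = u + osc (ln (H z / G z) / 2) * exp (- u)"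
    and "u * A z = u + osc (ln (H z / G z) / 2) * exp (- u)"
proof -
  have pos: "fst z > 0" "snd z > 0" using assms(1) by (auto simp: quadrant_def)
  have r: "H z / G z = snd z / fst z" using T_pos[of z] by (simp add: G_def H_def)
  have "u > 0" using pos by (simp add: u_def)
  show uA: "u * A z = u + osc (ln (H z / G z) / 2) * exp (- u)"
    unfolding r using pos by (simp add: A_def Q_eq u_def field_simps)
  have "G z * H z * (u * A z) = (fst z * snd z * u) * ((T z)\<^sup>2 * A z)"
    by (simp add: G_def H_def power2_eq_square)
  also have "\<dots> = 1" unfolding T_sq using pos by (simp add: u_def field_simps)
  finally show "inverse (G z * H z) = u + osc (ln (H z / G z) / 2) * exp (- u)"
    unfolding uA[symmetric] by (rule inverse_unique)
qed

lemma GH_quadrant_iff: "(G z, H z) \<in> quadrant \<longleftrightarrow> z \<in> quadrant"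
  using T_pos[of z] by (simp add: quadrant_def G_def H_def zero_less_mult_iff)

text \<open>In the quadrant the image fixes the ratio and, by monotonicity, u, hence
  \<open>A\<close> and \<open>T\<close>. Off the quadrant the map is the identity.\<close>

lemma inj_GH:
  assumes "G z = G z'" "H z = H z'"
  shows "z = z'"
proof -
  have T: "T z = T z'"
  proof (cases "z \<in> quadrant")
    case True
    then have z': "z' \<in> quadrant" using GH_quadrant_iff[of z] GH_quadrant_iff[of z'] assms by simp
    let ?c = "osc (ln (H z / G z) / 2)" and ?u = "inverse (fst z * snd z)" and ?v = "inverse (fst z' * snd z')"
    note e = quadrant_inverse_product[OF True] and e' = quadrant_inverse_product[OF z', folded assms]
    have pos: "?u > 0" "?v > 0" using True z' by (auto simp: quadrant_def)
    have "?u + ?c * exp (- ?u) = ?v + ?c * exp (- ?v)" using e(1) e'(1) by simp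
    then have uv: "?u = ?v"
      by (rule add_mult_exp_minus_inj[OF osc_bounds(2,3) pos])
    have "?v * A z = ?v * A z'" using e(2) e'(2) unfolding uv by (rule trans[OF _ sym])
    then have "A z = A z'"
      using mult_left_cancel[OF less_imp_neq[OF pos(2), symmetric]] by blast
    then show ?thesis by (simp add: T_def)
  next
    case False
    then have "z' \<notin> quadrant" using GH_quadrant_iff[of z] GH_quadrant_iff[of z'] assms by simp
    then show ?thesis using False outside_quadrant by simp
  qed
  have "fst z = fst z'" "snd z = snd z'"
    using assms T_pos[of z'] unfolding G_def H_def T by simp_all
  then show ?thesis by (simp add: prod_eq_iff)
qed

text \<open>In terms of u the claim reads osc < u + osc e^(-u), and indeed osc (1 - e^(-u)) \<le>
  osc u < u.\<close>

lemma GH_bound: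
  assumes "z \<in> quadrant"
  shows "G z * H z * osc (ln (H z / G z) / 2) < 1"
proof -
  let ?c = "osc (ln (H z / G z) / 2)" and ?u = "inverse (fst z * snd z)"
  have "(G z, H z) \<in> quadrant" using assms GH_quadrant_iff by simp
  then have pos: "G z * H z > 0" by (simp add: quadrant_def)
  have u: "?u > 0" using assms by (auto simp: quadrant_def)
  have c: "0 < ?c" "?c < 1" by (rule osc_bounds)+
  have "1 + - ?u \<le> exp (- ?u)" by (rule exp_ge_add_one_self)
  then have "?c * (1 - exp (- ?u)) \<le> ?c * ?u" using c by (intro mult_left_mono) auto
  also have "\<dots> < 1 * ?u" using c u by (intro mult_strict_right_mono) auto
  finally have "?c < inverse (G z * H z)"
    unfolding quadrant_inverse_product(1)[OF assms] by (simp add: algebra_simps)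
  then show ?thesis using pos by (simp add: field_simps)
qed

text \<open>The hypothesis says that w = 1/(ab) exceeds c = osc, the value of u + c e^(-u) at u = 0;
  at u = w the value exceeds w. The intermediate value theorem yields u, and the preimage is (a, b)
  stretched by s = sqrt(w/u), which is 1/T.\<close>

lemma GH_surj:
  assumes "a > 0" "b > 0" and less: "a * b * osc (ln (b / a) / 2) < 1"
  obtains z where "z \<in> quadrant" "G z = a" "H z = b"
proof -
  define c where "c = osc (ln (b / a) / 2)"
  define w where "w = inverse (a * b)"
  have "c > 0" unfolding c_def by (rule osc_bounds)
  have w: "w > 0" "c < w" using assms by (auto simp: w_def c_def field_simps)
  have "\<exists>u. 0 \<le> u \<and> u \<le> w \<and> u + c * exp (- u) = w"
    using w \<open>c > 0\<close> by (intro IVT') (auto intro!: continuous_intros)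
  then obtain u where u: "0 \<le> u" "u + c * exp (- u) = w" by blast
  then have "u > 0" using w by (cases "u = 0") auto
  define s where "s = sqrt (w / u)"
  have s: "s > 0" "s\<^sup>2 = w / u" using w \<open>u > 0\<close> by (auto simp: s_def)
  define z where "z = (s * a, s * b)"
  have z: "z \<in> quadrant" using s assms by (simp add: z_def quadrant_def)
  have "fst z * snd z = s\<^sup>2 * (a * b)" by (simp add: z_def power2_eq_square)
  also have "\<dots> = inverse u" using assms w \<open>u > 0\<close> by (simp add: s(2) w_def field_simps)
  finally have P: "inverse (fst z * snd z) = u" by simp
  have "H z / G z = b / a" using T_pos[of z] s by (simp add: z_def G_def H_def)
  then have "u * A z = w"
    using quadrant_inverse_product(2)[OF z] unfolding P by (simp add: c_def[symmetric] u(2))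
  then have "A z = s\<^sup>2" using \<open>u > 0\<close> by (simp add: s(2) nonzero_eq_divide_eq mult.commute)
  then have "(T z * s)\<^sup>2 = 1" using T_sq[of z] by (simp add: power_mult_distrib)
  then have "T z * s = 1" using mult_pos_pos[OF T_pos[of z] s(1)] by (simp add: power2_eq_1_iff)
  then have "a * (T z * s) = a" "b * (T z * s) = b" by simp_all
  then have "G z = a" "H z = b" by (simp_all add: G_def H_def z_def mult_ac)
  then show thesis using that z by blast
qed

text \<open>The linear map keeps xy and multiplies y/x by e^2, so t = ln(y/x)/2 grows by exactly one
  period of \<open>osc\<close>.\<close>

lemma GH_equivariant:
  "T (exp (- 1) * x, exp 1 * y) = T (x, y)"
  "G (exp (- 1) * x, exp 1 * y) = exp (- 1) * G (x, y)"
  "H (exp (- 1) * x, exp 1 * y) = exp 1 * H (x, y)"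
proof -
  have "Q (exp (- 1) * x, exp 1 * y) = Q (x, y)"
  proof (cases "x > 0 \<and> y > 0")
    case True
    have "exp 1 * y / (exp (- 1) * x) = exp 2 * (y / x)"
      by (simp add: exp_minus field_simps flip: exp_add)
    then have eq: "ln (exp 1 * y / (exp (- 1) * x)) / 2 = ln (y / x) / 2 + 1"
      using True ln_mult[of "exp 2" "y / x"] by (simp only: divide_pos_pos) simp
    have eq': "exp (- 1) * x * (exp 1 * y) = x * y"
      by (simp add: exp_minus field_simps)
    have q: "Q (x, y) = osc (ln (y / x) / 2) * exp (- inverse (x * y))" if "x > 0" "y > 0" for x y
      using that by (simp add: Q_eq)
    have "Q (exp (- 1) * x, exp 1 * y)
        = osc (ln (exp 1 * y / (exp (- 1) * x)) / 2) * exp (- inverse (exp (- 1) * x * (exp 1 * y)))"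
      using True by (intro q) auto
    also have "\<dots> = Q (x, y)"
      unfolding eq eq' osc_periodic using True by (intro q[symmetric]) auto
    finally show ?thesis .
  qed (auto simp: Q_eq zero_less_mult_iff)
  then show "T (exp (- 1) * x, exp 1 * y) = T (x, y)"
    by (simp add: T_def A_def exp_minus field_simps)
  then show "G (exp (- 1) * x, exp 1 * y) = exp (- 1) * G (x, y)"
    "H (exp (- 1) * x, exp 1 * y) = exp 1 * H (x, y)"
    by (simp_all add: G_def H_def)
qed

end

subsection \<open>Anosov structures from pairs of functions\<close>

definition pullback_metric ::
    "(plane \<Rightarrow> real) \<Rightarrow> (plane \<Rightarrow> real) \<Rightarrow> (plane \<Rightarrow> real) \<Rightarrow> plane \<Rightarrow> plane \<Rightarrow> plane \<Rightarrow> real" where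
  "pullback_metric \<kappa> g h p v w = \<kappa> p *
     (frechet_derivative g (at p) v * frechet_derivative g (at p) w
      + frechet_derivative h (at p) v * frechet_derivative h (at p) w)"

text \<open>Differentiate g(f^n(p)) = c^n g(p).\<close>

lemma frechet_derivative_funpow:
  fixes f :: "plane \<Rightarrow> plane" and g :: "plane \<Rightarrow> real"
  assumes f: "smooth f" and g: "smooth g" and eq: "\<And>p. g (f p) = c * g p"
  shows "frechet_derivative g (at ((f ^^ n) p)) (frechet_derivative (f ^^ n) (at p) v)
       = c ^ n * frechet_derivative g (at p) v"
proof -
  have diff: "(f ^^ n) differentiable (at p)" for p
  proof (induction n)
    case (Suc n)
    have "f differentiable (at ((f ^^ n) p))"
      using smooth_imp_has_derivative[OF f] by (rule differentiableI)
    with Suc show ?case unfolding funpow.simps by (intro differentiable_chain_at)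
  qed (simp add: id_def)
  have eqn: "g ((f ^^ n) q) = c ^ n * g q" for q
    by (induction n) (simp_all add: eq)
  have "((\<lambda>q. g ((f ^^ n) q)) has_derivative (\<lambda>v. c ^ n * frechet_derivative g (at p) v)) (at p)"
    unfolding eqn by (intro has_derivative_mult_right smooth_imp_has_derivative g)
  moreover have "((\<lambda>q. g ((f ^^ n) q)) has_derivative
      (\<lambda>v. frechet_derivative g (at ((f ^^ n) p)) (frechet_derivative (f ^^ n) (at p) v))) (at p)"
    using diff_chain_at[OF diff[THEN frechet_derivative_works[THEN iffD1]] smooth_imp_has_derivative[OF g]]
    by (simp add: o_def)
  ultimately show ?thesis by (metis has_derivative_unique)
qed

context plane_embedding
begin

lemma riemannian_metric_pullback:
  assumes "smooth \<kappa>" and pos: "\<And>p. \<kappa> p > 0"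
  shows "riemannian_metric (pullback_metric \<kappa> g h)"
  unfolding riemannian_metric_def
proof (intro conjI allI impI)
  fix p v w :: plane
  have lin: "linear (frechet_derivative g (at p))" "linear (frechet_derivative h (at p))"
    using smooth_imp_has_derivative[OF smooth_g, of p] smooth_imp_has_derivative[OF smooth_h, of p]
    by (simp_all add: has_derivative_linear)
  show "bilinear (pullback_metric \<kappa> g h p)"
    unfolding bilinear_def pullback_metric_def
    by (intro conjI allI linearI; simp only: lin[THEN linear_add] lin[THEN linear_scale] real_scaleR_def;
        simp add: algebra_simps)
  show "pullback_metric \<kappa> g h p v w = pullback_metric \<kappa> g h p w v"
    by (simp add: pullback_metric_def mult.commute)
  show "smooth (\<lambda>p. pullback_metric \<kappa> g h p v w)"
    unfolding pullback_metric_def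
    by (intro smooth_mult smooth_add smooth_frechet_derivative smooth_g smooth_h assms)
  assume "v \<noteq> 0"
  then have "frechet_derivative g (at p) v \<noteq> 0 \<or> frechet_derivative h (at p) v \<noteq> 0"
    using immersion by blast
  then have "0 < (frechet_derivative g (at p) v)\<^sup>2 + (frechet_derivative h (at p) v)\<^sup>2"
    by (simp add: sum_power2_gt_zero_iff)
  then show "pullback_metric \<kappa> g h p v v > 0"
    using pos[of p] by (simp add: pullback_metric_def power2_eq_square)
qed

text \<open>On a vector tangent to a leaf of \<open>g\<close> only the dh-part of the norm survives,
  and it grows by exactly e^n because \<open>\<kappa>\<close> is invariant; dually for
  \<open>h\<close>. So C = 1 and \<lambda> = e, with the leaves of \<open>g\<close>
  unstable.\<close>

lemma anosov_structure_leaves: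
  assumes f: "smooth f" "smooth f'" "\<And>p. f' (f p) = p" "\<And>p. f (f' p) = p"
    and g: "\<And>p. g (f p) = exp (- 1) * g p" and h: "\<And>p. h (f p) = exp 1 * h p"
    and \<kappa>: "\<And>p. \<kappa> (f p) = \<kappa> p"
    and complete: "complete_riemannian_metric (pullback_metric \<kappa> g h)"
  shows "anosov_structure f (pullback_metric \<kappa> g h) (leaves h) (leaves g)"
proof -
  interpret swap: plane_embedding h g
    by (rule plane_embedding_commute) (rule plane_embedding_axioms)
  have "inv f = f'"
    using f(3,4) by (intro inv_equality)
  moreover have "bij f"
    using f(3,4) by (intro o_bij[of f' f]) auto
  ultimately have diffeo: "diffeomorphism f"
    using f(1,2) by (simp add: diffeomorphism_def)
  have \<kappa>n: "\<kappa> ((f ^^ n) p) = \<kappa> p" for n p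
    by (induction n) (simp_all add: \<kappa>)
  have norm: "riemannian_norm (pullback_metric \<kappa> g h) ((f ^^ n) p) (frechet_derivative (f ^^ n) (at p) v)
      = sqrt (\<kappa> p * ((exp (- 1) ^ n * frechet_derivative g (at p) v)\<^sup>2
            + (exp 1 ^ n * frechet_derivative h (at p) v)\<^sup>2))" for n p v
    unfolding riemannian_norm_def pullback_metric_def \<kappa>n
      frechet_derivative_funpow[OF f(1) smooth_g g] frechet_derivative_funpow[OF f(1) smooth_h h]
    by (simp add: power2_eq_square)
  have norm0: "riemannian_norm (pullback_metric \<kappa> g h) p v
      = sqrt (\<kappa> p * ((frechet_derivative g (at p) v)\<^sup>2 + (frechet_derivative h (at p) v)\<^sup>2))" for p v
    by (simp add: riemannian_norm_def pullback_metric_def power2_eq_square)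
  have scale: "sqrt (k * (c * x)\<^sup>2) = c * sqrt (k * x\<^sup>2)" if "c > 0" for c k x :: real
    using that by (simp add: power_mult_distrib real_sqrt_mult)
  have "riemannian_norm (pullback_metric \<kappa> g h) ((f ^^ n) p) (frechet_derivative (f ^^ n) (at p) v)
      \<ge> 1 * exp 1 ^ n * riemannian_norm (pullback_metric \<kappa> g h) p v"
    if "tangent_to (leaves g) p v" for n p v
    using tangent_to_leaves[OF that smooth_imp_has_derivative[OF smooth_g]]
    by (subst norm) (simp add: norm0 scale)
  moreover have "riemannian_norm (pullback_metric \<kappa> g h) ((f ^^ n) p) (frechet_derivative (f ^^ n) (at p) v)
      \<le> 1 * inverse (exp 1 ^ n) * riemannian_norm (pullback_metric \<kappa> g h) p v"
    if "tangent_to (leaves h) p v" for n p v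
    using tangent_to_leaves[OF that smooth_imp_has_derivative[OF smooth_h]]
    by (subst norm) (simp add: norm0 scale exp_minus power_inverse)
  ultimately have "\<exists>C lam. C > 0 \<and> lam > 1 \<and> (\<forall>n\<ge>1. \<forall>p v.
        (tangent_to (leaves g) p v \<longrightarrow>
           riemannian_norm (pullback_metric \<kappa> g h) ((f ^^ n) p) (frechet_derivative (f ^^ n) (at p) v)
             \<ge> C * lam ^ n * riemannian_norm (pullback_metric \<kappa> g h) p v) \<and>
        (tangent_to (leaves h) p v \<longrightarrow>
           riemannian_norm (pullback_metric \<kappa> g h) ((f ^^ n) p) (frechet_derivative (f ^^ n) (at p) v)
             \<le> C * inverse (lam ^ n) * riemannian_norm (pullback_metric \<kappa> g h) p v))"
    by (intro exI[of _ 1] exI[of _ "exp 1"]) auto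
  moreover have "respects_foliation f (leaves g)" "respects_foliation f (leaves h)"
    using f g h by (auto intro!: respects_foliation_leaves[of f f'] smooth_imp_continuous_on)
  ultimately show ?thesis
    unfolding anosov_structure_def
    using diffeo complete foliation_leaves swap.foliation_leaves by blast
qed

end

subsection \<open>Completeness for the tentacled region\<close>

text \<open>\<open>(X, Y)\<close> identifies the plane with the whole plane or with the open first quadrant, and large
  values of \<open>V\<close> indicate points near the boundary of the embedded region.\<close>

locale tentacle_plane = tentacles +
  fixes X Y V :: "plane \<Rightarrow> real" and f f' :: "plane \<Rightarrow> plane"
  assumes smooth_X: "smooth X" and smooth_Y: "smooth Y" and smooth_V: "smooth V"
    and inj_XY: "\<And>p q. X p = X q \<Longrightarrow> Y p = Y q \<Longrightarrow> p = q"
    and immersion_XY: "\<And>p v. frechet_derivative X (at p) v = 0 \<Longrightarrow> frechet_derivative Y (at p) v = 0 \<Longrightarrow> v = 0"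
    and range_XY: "range (\<lambda>p. (X p, Y p)) = UNIV \<or> range (\<lambda>p. (X p, Y p)) = quadrant"
    and product_le_V: "\<And>p. (X p * Y p)\<^sup>2 \<le> V p"
    and V_derivative: "\<And>p v. \<bar>frechet_derivative V (at p) v\<bar> \<le> 4 * (1 + V p)\<^sup>2 *
        \<bar>X p * frechet_derivative Y (at p) v + Y p * frechet_derivative X (at p) v\<bar>"
    and bounded_V: "\<And>B. bounded {p. \<bar>X p\<bar> \<le> B \<and> \<bar>Y p\<bar> \<le> B \<and> V p \<le> B}"
    and smooth_f: "smooth f" "smooth f'" and f_inverse: "\<And>p. f' (f p) = p" "\<And>p. f (f' p) = p"
    and X_f: "\<And>p. X (f p) = exp (- 1) * X p" and Y_f: "\<And>p. Y (f p) = exp 1 * Y p"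
    and V_f: "\<And>p. V (f p) = V p"
begin

definition g :: "plane \<Rightarrow> real" where "g p = G (X p, Y p)"

definition h :: "plane \<Rightarrow> real" where "h p = H (X p, Y p)"

text \<open>The constant is \<open>2 * 65\<^sup>2\<close>, from \<open>(65 * (a + b))\<^sup>2 \<le> 2 * 65\<^sup>2 * (a\<^sup>2 + b\<^sup>2)\<close>.\<close>

definition \<kappa> :: "plane \<Rightarrow> real" where "\<kappa> p = 8450 * (1 + V p) ^ 6"

lemma V_nonneg: "V p \<ge> 0"
  using product_le_V[of p] zero_le_power2[of "X p * Y p"] by linarith

lemma smooth_g: "smooth g" and smooth_h: "smooth h"
  unfolding g_def[abs_def] h_def[abs_def]
  by (intro smooth_compose_plane smooth_G smooth_H smooth_X smooth_Y)+

lemma frechet_derivative_g: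
    "frechet_derivative g (at p) = (\<lambda>v. frechet_derivative X (at p) v * T (X p, Y p)
       + X p * dT (X p, Y p) (frechet_derivative X (at p) v, frechet_derivative Y (at p) v))"
  and frechet_derivative_h:
    "frechet_derivative h (at p) = (\<lambda>v. frechet_derivative Y (at p) v * T (X p, Y p)
       + Y p * dT (X p, Y p) (frechet_derivative X (at p) v, frechet_derivative Y (at p) v))"
proof -
  have XY: "((\<lambda>p. (X p, Y p)) has_derivative
      (\<lambda>v. (frechet_derivative X (at p) v, frechet_derivative Y (at p) v))) (at p)"
    by (intro has_derivative_Pair smooth_imp_has_derivative smooth_X smooth_Y)
  show "frechet_derivative g (at p) = (\<lambda>v. frechet_derivative X (at p) v * T (X p, Y p)
       + X p * dT (X p, Y p) (frechet_derivative X (at p) v, frechet_derivative Y (at p) v))"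
    using diff_chain_at[OF XY G_has_derivative]
    by (intro frechet_derivative_at[symmetric]) (simp add: o_def g_def[abs_def])
  show "frechet_derivative h (at p) = (\<lambda>v. frechet_derivative Y (at p) v * T (X p, Y p)
       + Y p * dT (X p, Y p) (frechet_derivative X (at p) v, frechet_derivative Y (at p) v))"
    using diff_chain_at[OF XY H_has_derivative]
    by (intro frechet_derivative_at[symmetric]) (simp add: o_def h_def[abs_def])
qed

sublocale plane_embedding g h
proof
  show "smooth g" "smooth h" by (fact smooth_g smooth_h)+
  show "p = q" if "g p = g q" "h p = h q" for p q
    using inj_GH[of "(X p, Y p)" "(X q, Y q)"] that by (intro inj_XY) (simp_all add: g_def h_def)
  show "v = 0" if "frechet_derivative g (at p) v = 0" "frechet_derivative h (at p) v = 0" for p v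
  proof -
    have "(frechet_derivative X (at p) v, frechet_derivative Y (at p) v) = 0"
      using that unfolding frechet_derivative_g frechet_derivative_h
      by (intro immersion_GH[of _ "(X p, Y p)"]) simp_all
    then show ?thesis by (intro immersion_XY[of p]) (simp_all add: prod_eq_iff)
  qed
qed

lemma g_f: "g (f p) = exp (- 1) * g p" and h_f: "h (f p) = exp 1 * h p"
  by (simp_all add: g_def h_def X_f Y_f GH_equivariant)

lemma smooth_\<kappa>: "smooth \<kappa>"
  unfolding \<kappa>_def[abs_def] by (intro smooth_mult smooth_power smooth_add smooth_const smooth_V)

lemma \<kappa>_pos: "\<kappa> p > 0"
  using V_nonneg[of p] by (simp add: \<kappa>_def)

text \<open>The square root halves the exponent 6 of \<open>\<kappa>\<close>. The cube is what the
  test function \<open>W\<close> needs: two powers of 1 + V from the assumed bound on dV and one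
  from the differential of the product.\<close>

lemma riemannian_norm_lower_bound:
  "65 * (1 + V p) ^ 3 * (\<bar>frechet_derivative g (at p) v\<bar> + \<bar>frechet_derivative h (at p) v\<bar>)
    \<le> riemannian_norm (pullback_metric \<kappa> g h) p v"
proof -
  let ?a = "frechet_derivative g (at p) v" and ?b = "frechet_derivative h (at p) v"
  have "(\<bar>?a\<bar> + \<bar>?b\<bar>)\<^sup>2 \<le> 2 * (?a\<^sup>2 + ?b\<^sup>2)"
  proof -
    have "0 \<le> (\<bar>?a\<bar> - \<bar>?b\<bar>)\<^sup>2" by simp
    then show ?thesis by (simp add: power2_diff power2_sum)
  qed
  then have "4225 * (1 + V p) ^ 6 * (\<bar>?a\<bar> + \<bar>?b\<bar>)\<^sup>2 \<le> 4225 * (1 + V p) ^ 6 * (2 * (?a\<^sup>2 + ?b\<^sup>2))"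
    using V_nonneg[of p] by (intro mult_left_mono) auto
  moreover have "(65 * (1 + V p) ^ 3 * (\<bar>?a\<bar> + \<bar>?b\<bar>))\<^sup>2 = 4225 * (1 + V p) ^ 6 * (\<bar>?a\<bar> + \<bar>?b\<bar>)\<^sup>2"
    by (simp add: power_mult_distrib flip: power_mult)
  moreover have "4225 * (1 + V p) ^ 6 * (2 * (?a\<^sup>2 + ?b\<^sup>2)) = 8450 * (1 + V p) ^ 6 * (?a * ?a + ?b * ?b)"
    by (simp add: power2_eq_square algebra_simps)
  ultimately show ?thesis
    unfolding riemannian_norm_def pullback_metric_def \<kappa>_def
    by (intro real_le_rsqrt) (simp only:)
qed

definition W :: "plane \<Rightarrow> real" where
  "W p = V p / (1 + (g p)\<^sup>2 + (h p)\<^sup>2)"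

definition dW :: "plane \<Rightarrow> plane \<Rightarrow> real" where
  "dW p v = frechet_derivative V (at p) v / (1 + (g p)\<^sup>2 + (h p)\<^sup>2)
     - V p * (2 * g p * frechet_derivative g (at p) v + 2 * h p * frechet_derivative h (at p) v)
        / (1 + (g p)\<^sup>2 + (h p)\<^sup>2)\<^sup>2"

lemma denominator_pos: "1 + (g p)\<^sup>2 + (h p)\<^sup>2 > 0"
  by (simp add: add_pos_nonneg)

lemma W_has_derivative: "(W has_derivative dW p) (at p)"
proof -
  have "(W has_derivative (\<lambda>v. (frechet_derivative V (at p) v * (1 + (g p)\<^sup>2 + (h p)\<^sup>2)
     - V p * (2 * g p * frechet_derivative g (at p) v + 2 * h p * frechet_derivative h (at p) v))
       / ((1 + (g p)\<^sup>2 + (h p)\<^sup>2) * (1 + (g p)\<^sup>2 + (h p)\<^sup>2)))) (at p)"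
    unfolding W_def[abs_def]
  proof (rule has_derivative_divide')
    show "((\<lambda>p. 1 + (g p)\<^sup>2 + (h p)\<^sup>2) has_derivative
        (\<lambda>v. 2 * g p * frechet_derivative g (at p) v + 2 * h p * frechet_derivative h (at p) v)) (at p)"
      by (rule derivative_eq_intros smooth_imp_has_derivative smooth_g smooth_h refl | simp add: mult_ac)+
  qed (use smooth_imp_has_derivative[OF smooth_V] denominator_pos[of p] in auto)
  then show ?thesis
    by (rule has_derivative_eq_rhs)
      (use denominator_pos[of p] in \<open>simp add: dW_def fun_eq_iff diff_divide_distrib power2_eq_square\<close>)
qed

text \<open>The quotient rule gives two terms. In the first, 4 (1 + V)^2 times 16 (1 + V) makes 64
  (1 + V)^3, the weights |g| and |h| being absorbed by the denominator; the second contributes (1 +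
  V)^3. Their sum is the constant 65.\<close>

lemma dW_bound: "\<bar>dW p v\<bar> \<le> riemannian_norm (pullback_metric \<kappa> g h) p v"
proof -
  let ?a = "\<bar>frechet_derivative g (at p) v\<bar>" and ?b = "\<bar>frechet_derivative h (at p) v\<bar>"
  let ?D = "1 + (g p)\<^sup>2 + (h p)\<^sup>2" and ?p = "X p * frechet_derivative Y (at p) v + Y p * frechet_derivative X (at p) v"
  have D: "1 \<le> ?D" by simp
  have sq: "2 * \<bar>x\<bar> \<le> 1 + x\<^sup>2" for x :: real
  proof -
    have "0 \<le> (\<bar>x\<bar> - 1)\<^sup>2" by simp
    then show ?thesis by (simp add: power2_diff)
  qed
  have gD: "2 * \<bar>g p\<bar> \<le> ?D" "2 * \<bar>h p\<bar> \<le> ?D"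
    using sq[of "g p"] sq[of "h p"] zero_le_power2[of "g p"] zero_le_power2[of "h p"] by linarith+
  have "\<bar>?p\<bar> \<le> 16 * (1 + (X p * Y p)\<^sup>2) * (\<bar>h p\<bar> * ?a + \<bar>g p\<bar> * ?b)"
    using product_derivative_bound[of "(X p, Y p)"
        "(frechet_derivative X (at p) v, frechet_derivative Y (at p) v)"]
    unfolding frechet_derivative_g frechet_derivative_h g_def h_def by simp
  also have "\<dots> \<le> 16 * (1 + V p) * (?D * ?a + ?D * ?b)"
    using product_le_V[of p] V_nonneg[of p] gD by (intro mult_mono add_mono) auto
  finally have p: "\<bar>?p\<bar> \<le> 16 * (1 + V p) * ?D * (?a + ?b)" by (simp add: algebra_simps)
  have "\<bar>frechet_derivative V (at p) v\<bar> \<le> 4 * (1 + V p)\<^sup>2 * \<bar>?p\<bar>" by (rule V_derivative)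
  also have "\<dots> \<le> 4 * (1 + V p)\<^sup>2 * (16 * (1 + V p) * ?D * (?a + ?b))"
    using p by (intro mult_left_mono) auto
  also have "\<dots> = 64 * (1 + V p) ^ 3 * (?a + ?b) * ?D"
    by (simp add: power2_eq_square power3_eq_cube algebra_simps)
  finally have 1: "\<bar>frechet_derivative V (at p) v / ?D\<bar> \<le> 64 * (1 + V p) ^ 3 * (?a + ?b)"
    using denominator_pos[of p] by (simp add: abs_divide pos_divide_le_eq)
  have "\<bar>2 * g p * frechet_derivative g (at p) v + 2 * h p * frechet_derivative h (at p) v\<bar>
      \<le> 2 * \<bar>g p\<bar> * ?a + 2 * \<bar>h p\<bar> * ?b"
    by (rule order_trans[OF abs_triangle_ineq]) (simp add: abs_mult)
  also have "\<dots> \<le> ?D * ?a + ?D * ?b"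
    using gD by (intro add_mono mult_right_mono) auto
  also have "\<dots> = (?a + ?b) * ?D" by (simp add: algebra_simps)
  also have "\<dots> \<le> (?a + ?b) * ?D\<^sup>2"
    by (intro mult_left_mono self_le_power[OF D]) auto
  finally have "V p * \<bar>2 * g p * frechet_derivative g (at p) v + 2 * h p * frechet_derivative h (at p) v\<bar>
      \<le> V p * ((?a + ?b) * ?D\<^sup>2)"
    using V_nonneg[of p] by (intro mult_left_mono)
  also have "\<dots> \<le> (1 + V p) ^ 3 * ((?a + ?b) * ?D\<^sup>2)"
  proof (rule mult_right_mono)
    have "V p \<le> (1 + V p) * 1" by simp
    also have "\<dots> \<le> (1 + V p) * (1 + V p)\<^sup>2"
      using V_nonneg[of p] by (intro mult_left_mono) auto
    finally show "V p \<le> (1 + V p) ^ 3" by (simp add: power2_eq_square power3_eq_cube)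
  qed simp
  finally have 2: "\<bar>V p * (2 * g p * frechet_derivative g (at p) v + 2 * h p * frechet_derivative h (at p) v)
        / ?D\<^sup>2\<bar> \<le> (1 + V p) ^ 3 * (?a + ?b)"
    using denominator_pos[of p] V_nonneg[of p]
    by (simp add: abs_divide abs_mult pos_divide_le_eq zero_less_power mult.assoc)
  have "\<bar>dW p v\<bar> \<le> 64 * (1 + V p) ^ 3 * (?a + ?b) + (1 + V p) ^ 3 * (?a + ?b)"
    unfolding dW_def by (rule order_trans[OF abs_triangle_ineq4]) (intro add_mono 1 2)
  also have "\<dots> = 65 * (1 + V p) ^ 3 * (?a + ?b)" by simp
  finally show ?thesis using riemannian_norm_lower_bound[of p v] by linarith
qed

text \<open>\<open>g\<close> and \<open>h\<close> separate points. For properness, bounds on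
  \<open>g\<close>, \<open>h\<close> and \<open>W\<close> bound \<open>V\<close>, hence XY, hence
  \<open>A\<close> and 1/T, and so X = g/T and Y = h/T.\<close>

lemma complete_metric: "complete_riemannian_metric (pullback_metric \<kappa> g h)"
proof (rule complete_riemannian_metricI[where F = "{g, h, W}"
      and \<phi>' = "\<lambda>\<phi> p. if \<phi> = W then dW p else frechet_derivative \<phi> (at p)"])
  show "riemannian_metric (pullback_metric \<kappa> g h)"
    by (rule riemannian_metric_pullback[OF smooth_\<kappa> \<kappa>_pos])
  show "(\<phi> has_derivative (if \<phi> = W then dW p else frechet_derivative \<phi> (at p))) (at p)"
    if "\<phi> \<in> {g, h, W}" for \<phi> p
    using that W_has_derivative[of p] smooth_imp_has_derivative[OF smooth_g, of p]
      smooth_imp_has_derivative[OF smooth_h, of p]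
    by auto
  show "\<bar>(if \<phi> = W then dW p else frechet_derivative \<phi> (at p)) v\<bar>
      \<le> riemannian_norm (pullback_metric \<kappa> g h) p v" if "\<phi> \<in> {g, h, W}" for \<phi> p v
  proof -
    let ?s = "\<bar>frechet_derivative g (at p) v\<bar> + \<bar>frechet_derivative h (at p) v\<bar>"
    have "1 \<le> (1 + V p) ^ 3" using V_nonneg[of p] by simp
    then have "1 * ?s \<le> 65 * (1 + V p) ^ 3 * ?s"
      by (intro mult_right_mono) auto
    then have "1 * ?s \<le> riemannian_norm (pullback_metric \<kappa> g h) p v"
      using riemannian_norm_lower_bound by (rule order_trans)
    then have "\<bar>frechet_derivative g (at p) v\<bar> \<le> riemannian_norm (pullback_metric \<kappa> g h) p v"
      "\<bar>frechet_derivative h (at p) v\<bar> \<le> riemannian_norm (pullback_metric \<kappa> g h) p v"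
      by simp_all
    then show ?thesis using that dW_bound[of p v] by auto
  qed
  show "p = q" if "\<And>\<phi>. \<phi> \<in> {g, h, W} \<Longrightarrow> \<phi> p = \<phi> q" for p q
    using that by (intro inj) auto
  show "bounded {q. \<forall>\<phi>\<in>{g, h, W}. \<bar>\<phi> q - \<phi> p\<bar> \<le> R}" for R p
  proof -
    define B0 where "B0 = \<bar>R\<bar> + \<bar>g p\<bar> + \<bar>h p\<bar> + \<bar>W p\<bar>"
    define B1 where "B1 = B0 * (1 + B0\<^sup>2 + B0\<^sup>2)"
    define B where "B = B0 * (2 + B1) + B1"
    have "B0 \<ge> 0" "B1 \<ge> 0" by (auto simp: B0_def B1_def)
    have "\<bar>X q\<bar> \<le> B \<and> \<bar>Y q\<bar> \<le> B \<and> V q \<le> B"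
      if q: "\<bar>g q - g p\<bar> \<le> R" "\<bar>h q - h p\<bar> \<le> R" "\<bar>W q - W p\<bar> \<le> R" for q
    proof -
      have gq: "\<bar>g q\<bar> \<le> B0" and hq: "\<bar>h q\<bar> \<le> B0" and Wq: "W q \<le> B0"
        using q unfolding B0_def by linarith+
      have "V q = W q * (1 + (g q)\<^sup>2 + (h q)\<^sup>2)"
        using denominator_pos[of q] by (simp add: W_def)
      also have "\<dots> \<le> B0 * (1 + B0\<^sup>2 + B0\<^sup>2)"
        using Wq gq hq \<open>B0 \<ge> 0\<close> denominator_pos[of q]
        by (intro mult_mono add_mono) (auto intro: less_imp_le simp: abs_le_square_iff[symmetric])
      finally have V: "V q \<le> B1" by (simp add: B1_def)
      have "0 \<le> (\<bar>X q * Y q\<bar> - 1)\<^sup>2" by simp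
      then have "\<bar>X q * Y q\<bar> \<le> 1 + (X q * Y q)\<^sup>2"
        using zero_le_power2[of "X q * Y q"] by (simp add: power2_diff)
      then have "A (X q, Y q) \<le> 2 + B1"
        using A_le[of "(X q, Y q)"] product_le_V[of q] V by simp
      then have T: "inverse (T (X q, Y q)) \<le> 2 + B1"
        using inverse_T_le[of "(X q, Y q)"] by linarith
      have "\<bar>X q\<bar> = \<bar>g q\<bar> * inverse (T (X q, Y q))" "\<bar>Y q\<bar> = \<bar>h q\<bar> * inverse (T (X q, Y q))"
        using T_pos[of "(X q, Y q)"] by (simp_all add: g_def h_def G_def H_def abs_mult)
      moreover have "\<bar>x\<bar> * inverse (T (X q, Y q)) \<le> B0 * (2 + B1)" if "\<bar>x\<bar> \<le> B0" for x
        using T that \<open>B0 \<ge> 0\<close> T_pos[of "(X q, Y q)"] by (intro mult_mono) auto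
      ultimately have "\<bar>X q\<bar> \<le> B0 * (2 + B1)" "\<bar>Y q\<bar> \<le> B0 * (2 + B1)"
        using gq hq by simp_all
      moreover have "0 \<le> B0 * (2 + B1)" using \<open>B0 \<ge> 0\<close> \<open>B1 \<ge> 0\<close> by simp
      ultimately show ?thesis using V \<open>B1 \<ge> 0\<close> unfolding B_def by linarith
    qed
    then show ?thesis by (intro bounded_subset[OF bounded_V[of B]]) auto
  qed
qed

lemma anosov: "anosov_structure f (pullback_metric \<kappa> g h) (leaves h) (leaves g)"
  using smooth_f f_inverse g_f h_f _ complete_metric
  by (rule anosov_structure_leaves) (simp add: \<kappa>_def V_f)

end

subsection \<open>Degree of inaccessibility\<close>

definition same_leaf :: "plane set set \<Rightarrow> plane set set \<Rightarrow> (plane \<times> plane) set" where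
  "same_leaf Fs Fu = {(p, q). (\<exists>L\<in>Fs. p \<in> L \<and> q \<in> L) \<or> (\<exists>L\<in>Fu. p \<in> L \<and> q \<in> L)}"

lemma accessible_iff_relpow: "accessible Fs Fu n p q \<longleftrightarrow> (p, q) \<in> same_leaf Fs Fu ^^ n"
  by (simp add: accessible_def relpow_fun_conv same_leaf_def)

lemma access_number_le: "accessible Fs Fu n p q \<Longrightarrow> access_number Fs Fu p q \<le> enat n"
  unfolding access_number_def by (rule INF_lower) simp

lemma relpow_sym: "sym R \<Longrightarrow> (x, y) \<in> R ^^ n \<Longrightarrow> (y, x) \<in> R ^^ n"
proof (induction n arbitrary: y)
  case (Suc n)
  then obtain z where "(x, z) \<in> R ^^ n" "(z, y) \<in> R" by auto
  then show ?case using Suc by (meson relpow_Suc_I2 symD)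
qed simp

section \<open>Estimates for the oscillating function\<close>

context tentacles
begin

lemma cos_pos_if_osc_less:
  assumes "osc t < 1 / 4"
  shows "cos (2 * pi * t) > 0"
  using assms \<delta> unfolding osc_def by argo

text \<open>A value below 1/4 needs cos(2 pi t) > 0, and half a period reverses the sign of the
  cosine. This makes a tentacle narrow where ab is at least 4.\<close>

lemma osc_half_turn: "\<not> (osc t < 1 / 4 \<and> osc (t + 1 / 2) < 1 / 4)"
proof
  assume "osc t < 1 / 4 \<and> osc (t + 1 / 2) < 1 / 4"
  then have "cos (2 * pi * t) > 0" "cos (2 * pi * (t + 1 / 2)) > 0"
    by (auto intro: cos_pos_if_osc_less)
  moreover have "2 * pi * (t + 1 / 2) = 2 * pi * t + pi" by (simp add: distrib_left)
  ultimately show False by (simp add: cos_add)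
qed

lemma osc_shift: "osc (of_int n + t) = osc t"
proof -
  have "2 * pi * (of_int n + t) = 2 * pi * t + 2 * pi * of_int n" by (simp add: distrib_left)
  then show ?thesis
    by (simp add: osc_def cos_add)
qed

lemma osc_mono:
  assumes "\<bar>a\<bar> \<le> \<bar>b\<bar>" "\<bar>b\<bar> \<le> 1 / 2"
  shows "osc a \<le> osc b"
proof -
  have "cos \<bar>2 * pi * b\<bar> \<le> cos \<bar>2 * pi * a\<bar>"
    using assms by (intro cos_monotone_0_pi_le) (auto simp: abs_mult)
  then show ?thesis by (simp add: osc_def)
qed

text \<open>Since 1 - cos(2 pi v) = 2 sin^2(pi v) \<le> 32 v^2, \<open>osc\<close> rises by at most
  8 v^2 \<le> 2 \<delta> v for v \<le> \<delta>/4. Descending along a leaf by v divides ab by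
  e^(2v), which compensates the factor allowed here.\<close>

lemma osc_near_0:
  assumes "0 \<le> v" "v \<le> \<delta> / 4"
  shows "osc v \<le> \<delta> * exp (2 * v)"
proof -
  have "\<bar>sin (pi * v)\<bar> \<le> \<bar>pi * v\<bar>" by (rule abs_sin_x_le_abs_x)
  also have "\<dots> \<le> 4 * v" using pi_less_4 assms by (simp add: abs_mult mult_right_mono)
  finally have "\<bar>sin (pi * v)\<bar>\<^sup>2 \<le> (4 * v)\<^sup>2" by (rule power_mono) simp
  then have "(sin (pi * v))\<^sup>2 \<le> (4 * v)\<^sup>2" by simp
  moreover have "cos (2 * (pi * v)) = 1 - 2 * (sin (pi * v))\<^sup>2" by (rule cos_double_sin)
  ultimately have "osc v \<le> \<delta> + 8 * v * v"
    by (simp add: osc_def power2_eq_square mult.assoc)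
  also have "8 * v * v \<le> 8 * v * (\<delta> / 4)" using assms by (intro mult_left_mono) auto
  also have "\<delta> + 8 * v * (\<delta> / 4) = \<delta> * (1 + 2 * v)" by (simp add: algebra_simps)
  also have "\<dots> \<le> \<delta> * exp (2 * v)" using \<delta> by (intro mult_left_mono exp_ge_add_one_self) auto
  finally show ?thesis by simp
qed

end

context tentacle_plane
begin

section \<open>The embedded region\<close>

definition S :: "plane set" where "S = range (\<lambda>p. (X p, Y p))"

lemma S_cases: "S = UNIV \<or> S = quadrant"
  using range_XY by (simp add: S_def)

lemma quadrant_subset_S: "quadrant \<subseteq> S"
  using S_cases by auto

lemma range_\<Phi>:
  "range \<Phi> = {z \<in> S. z \<in> quadrant \<longrightarrow> fst z * snd z * osc (ln (snd z / fst z) / 2) < 1}"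
proof (intro equalityI subsetI)
  fix z assume "z \<in> range \<Phi>"
  then obtain p where z: "z = (G (X p, Y p), H (X p, Y p))" by (auto simp: \<Phi>_def g_def h_def)
  have "(X p, Y p) \<in> S" by (auto simp: S_def)
  then have "z \<in> S"
    using S_cases GH_quadrant_iff[of "(X p, Y p)"] by (auto simp: z)
  moreover have "fst z * snd z * osc (ln (snd z / fst z) / 2) < 1" if "z \<in> quadrant"
    using GH_bound[of "(X p, Y p)"] that GH_quadrant_iff[of "(X p, Y p)"] by (simp add: z)
  ultimately show "z \<in> {z \<in> S. z \<in> quadrant \<longrightarrow> fst z * snd z * osc (ln (snd z / fst z) / 2) < 1}" by simp
next
  fix z assume z: "z \<in> {z \<in> S. z \<in> quadrant \<longrightarrow> fst z * snd z * osc (ln (snd z / fst z) / 2) < 1}"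
  have "\<exists>w\<in>S. z = (G w, H w)"
  proof (cases "z \<in> quadrant")
    case True
    then obtain w where "w \<in> quadrant" "G w = fst z" "H w = snd z"
      using z GH_surj[of "fst z" "snd z"] by (auto simp: quadrant_def)
    then show ?thesis using quadrant_subset_S by (intro bexI[of _ w]) auto
  next
    case False
    then show ?thesis using z outside_quadrant[of z] by (intro bexI[of _ z]) auto
  qed
  then obtain p where "z = (G (X p, Y p), H (X p, Y p))" by (auto simp: S_def)
  then have "z = \<Phi> p" by (simp add: \<Phi>_def g_def h_def)
  then show "z \<in> range \<Phi>" by simp
qed

subsection \<open>Lower bound\<close>

lemma osc_less_in_tentacle:
  assumes "g p > 0" "h p > 0" "4 \<le> g p * h p"
  shows "osc (ln (h p / g p) / 2) < 1 / 4"
proof -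
  have "\<Phi> p \<in> range \<Phi>" by simp
  then have "g p * h p * osc (ln (h p / g p) / 2) < 1"
    using assms(1,2) unfolding range_\<Phi> by (simp add: \<Phi>_def quadrant_def)
  moreover have "4 * osc (ln (h p / g p) / 2) \<le> g p * h p * osc (ln (h p / g p) / 2)"
    using assms(3) osc_bounds(2) by (intro mult_right_mono) (auto intro: less_imp_le)
  ultimately show ?thesis by linarith
qed

text \<open>If w fell below w(p)/e, the path in the leaf would pass a point r with exactly this
  value. There the product is still at least 4, so \<open>osc\<close> is below 1/4 at both p and r,
  although their t-coordinates differ by exactly 1/2.\<close>

lemma leaf_drop:
  assumes L: "L \<in> leaves u" "p \<in> L" "q \<in> L"
    and uw: "(u = g \<and> w = h) \<or> (u = h \<and> w = g)"
    and pos: "g p > 0" "h p > 0" and large: "4 * exp 1 \<le> g p * h p"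
  shows "u q = u p \<and> exp (- 1) * w p \<le> w q"
proof -
  obtain \<gamma> where \<gamma>: "path \<gamma>" "\<And>t. t \<in> {0..1} \<Longrightarrow> u (\<gamma> t) = u p" "\<gamma> 0 = p" "\<gamma> 1 = q"
    using same_leafE[OF L] by blast
  have "w q < exp (- 1) * w p \<Longrightarrow> False"
  proof -
    assume less: "w q < exp (- 1) * w p"
    have "smooth w" using uw smooth_g smooth_h by auto
    then have "continuous_on {0..1} (w \<circ> \<gamma>)"
      using \<gamma>(1) by (intro continuous_on_compose[OF _ smooth_imp_continuous_on]) (simp_all add: path_def)
    moreover have "exp (- 1) * w p \<le> w p"
      using pos uw by (auto intro!: mult_left_le_one_le)
    ultimately obtain t where t: "0 \<le> t" "t \<le> 1" "w (\<gamma> t) = exp (- 1) * w p"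
      using IVT2'[of "w \<circ> \<gamma>" 1 "exp (- 1) * w p" 0] less \<gamma>(3,4) by auto
    define r where "r = \<gamma> t"
    have ur: "u r = u p" using \<gamma>(2) t by (simp add: r_def)
    have wr: "w r = exp (- 1) * w p" using t by (simp add: r_def)
    have posr: "g r > 0" "h r > 0" using uw ur wr pos by auto
    have "g r * h r = exp (- 1) * (g p * h p)" using uw ur wr by auto
    moreover have "exp (- 1) * (4 * exp 1) \<le> exp (- 1) * (g p * h p)"
      using large by (intro mult_left_mono) auto
    moreover have "exp (- 1) * (4 * exp 1) = (4 :: real)" by (simp add: exp_minus)
    ultimately have "4 \<le> g r * h r" by linarith
    then have or: "osc (ln (h r / g r) / 2) < 1 / 4" using posr by (intro osc_less_in_tentacle)
    have "4 \<le> g p * h p" by (rule order_trans[OF _ large]) simp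
    then have op: "osc (ln (h p / g p) / 2) < 1 / 4"
      using pos by (intro osc_less_in_tentacle)
    have "ln (h p / g p) / 2 = ln (h r / g r) / 2 + 1 / 2 \<or> ln (h r / g r) / 2 = ln (h p / g p) / 2 + 1 / 2"
      using uw
    proof
      assume "u = g \<and> w = h"
      then have "ln (h r / g r) = ln (h p / g p) - 1" using ur wr pos by (simp add: ln_div ln_mult)
      then show ?thesis by argo
    next
      assume "u = h \<and> w = g"
      then have "ln (h r / g r) = ln (h p / g p) + 1" using ur wr pos by (simp add: ln_div ln_mult)
      then show ?thesis by argo
    qed
    then show False using osc_half_turn or op by metis
  qed
  moreover have "u q = u p" using \<gamma>(2)[of 1] \<gamma>(4) by simp
  ultimately show ?thesis by fastforce
qed

lemma same_leaf_drop:
  assumes "(p, q) \<in> same_leaf (leaves h) (leaves g)"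
    and pos: "g p > 0" "h p > 0" and large: "4 * exp 1 \<le> g p * h p"
  shows "g q > 0 \<and> h q > 0 \<and> exp (- 1) * (g p * h p) \<le> g q * h q"
proof -
  have "(g q = g p \<and> exp (- 1) * h p \<le> h q) \<or> (h q = h p \<and> exp (- 1) * g p \<le> g q)"
    using assms(1) leaf_drop[OF _ _ _ _ pos large] unfolding same_leaf_def by blast
  then show ?thesis
  proof
    assume q: "g q = g p \<and> exp (- 1) * h p \<le> h q"
    then have "0 < exp (- 1) * h p" "g p * (exp (- 1) * h p) \<le> g p * h q" using pos by auto
    then show ?thesis using q pos less_le_trans[of 0 "exp (- 1) * h p" "h q"] by (simp add: mult_ac)
  next
    assume q: "h q = h p \<and> exp (- 1) * g p \<le> g q"
    then have "0 < exp (- 1) * g p" "(exp (- 1) * g p) * h p \<le> g q * h p" using pos by auto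
    then show ?thesis using q pos less_le_trans[of 0 "exp (- 1) * g p" "g q"] by (simp add: mult_ac)
  qed
qed

text \<open>Each leaf costs at most a factor e. Before the step to \<open>Suc n\<close> the exponent
  \<open>N - n\<close> is at least 1, which supplies the product \<open>4 * exp 1\<close> that a
  step requires.\<close>

lemma relpow_drop:
  assumes "(p, q) \<in> same_leaf (leaves h) (leaves g) ^^ n" "n \<le> N"
    and "g p > 0" "h p > 0" "4 * exp (real N) \<le> g p * h p"
  shows "g q > 0 \<and> h q > 0 \<and> 4 * exp (real N - real n) \<le> g q * h q"
  using assms(1,2)
proof (induction n arbitrary: q)
  case 0
  then show ?case using assms(3-5) by simp
next
  case (Suc n)
  then obtain r where r: "(p, r) \<in> same_leaf (leaves h) (leaves g) ^^ n" "(r, q) \<in> same_leaf (leaves h) (leaves g)"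
    by auto
  have IH: "g r > 0" "h r > 0" "4 * exp (real N - real n) \<le> g r * h r"
    using Suc.IH[OF r(1)] Suc.prems(2) by auto
  have "exp 1 \<le> exp (real N - real n)" using Suc.prems(2) by simp
  then have "4 * exp 1 \<le> g r * h r" using IH(3) by linarith
  from same_leaf_drop[OF r(2) IH(1,2) this]
  have q: "g q > 0" "h q > 0" "exp (- 1) * (g r * h r) \<le> g q * h q" by auto
  have "4 * exp (real N - real (Suc n)) = exp (- 1) * (4 * exp (real N - real n))"
    by (simp add: algebra_simps flip: exp_add)
  also have "\<dots> \<le> exp (- 1) * (g r * h r)" using IH(3) by (intro mult_left_mono) auto
  finally show ?case using q by linarith
qed

lemma degree_ge:
  assumes "4 * exp (real N) * \<delta> < 1"
  shows "enat N \<le> degree_of_inaccessibility (leaves h) (leaves g)"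
proof -
  \<comment> \<open>(a, a) lies on the axis t = 0 of a tentacle, where osc = \<delta>; the
    hypothesis places it in the region.\<close>
  define a where "a = sqrt (4 * exp (real N))"
  have a: "a > 0" "a * a = 4 * exp (real N)" by (auto simp: a_def)
  have "(a, a) \<in> range \<Phi>"
    unfolding range_\<Phi> using a assms quadrant_subset_S by (auto simp: quadrant_def osc_def)
  then obtain p where p: "\<Phi> p = (a, a)" by auto
  \<comment> \<open>The product 1/4 lies below 4, the least value that up to N steps can reach from
    (a, a).\<close>
  have "(1 / 2, 1 / 2) \<in> range \<Phi>"
    unfolding range_\<Phi> using quadrant_subset_S osc_bounds(3)[of 0] by (auto simp: quadrant_def)
  then obtain q where q: "\<Phi> q = (1 / 2, 1 / 2)" by auto
  have "enat N \<le> access_number (leaves h) (leaves g) p q"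
    unfolding access_number_def
  proof (rule INF_greatest)
    fix n assume "n \<in> {n. accessible (leaves h) (leaves g) n p q}"
    then have n: "(p, q) \<in> same_leaf (leaves h) (leaves g) ^^ n" by (simp add: accessible_iff_relpow)
    show "enat N \<le> enat n"
    proof (rule ccontr)
      assume "\<not> enat N \<le> enat n"
      then have "n \<le> N" by simp
      from relpow_drop[OF n this] have "4 * exp (real N - real n) \<le> g q * h q"
        using p a by (auto simp: \<Phi>_def)
      moreover have "1 \<le> exp (real N - real n)" using \<open>n \<le> N\<close> by simp
      moreover have gh: "g q = 1 / 2" "h q = 1 / 2" using q by (simp_all add: \<Phi>_def)
      have "g q * h q = 1 / 4" unfolding gh by simp
      ultimately show False by linarith
    qed
  qed
  also have "\<dots> \<le> degree_of_inaccessibility (leaves h) (leaves g)"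
    unfolding degree_of_inaccessibility_def by (rule SUP_upper2[of "(p, q)"]) auto
  finally show ?thesis .
qed

end

section \<open>Leaves and axis-parallel segments\<close>

context tentacle_plane
begin

abbreviation R :: "(plane \<times> plane) set" where
  "R \<equiv> same_leaf (leaves h) (leaves g)"

lemma sym_R: "sym R"
  by (auto simp: same_leaf_def sym_def)

lemma refl_R: "(p, p) \<in> R"
  using partition_on_leaves[of g] by (auto simp: same_leaf_def partition_on_def)

lemma relpow_R_mono: "(p, q) \<in> R ^^ m \<Longrightarrow> m \<le> n \<Longrightarrow> (p, q) \<in> R ^^ n"
proof (induction n)
  case (Suc n)
  show ?case
  proof (cases "m = Suc n")
    case False
    then have "(p, q) \<in> R ^^ n" using Suc by simp
    then show ?thesis using refl_R by (rule relpow_Suc_I)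
  qed (use Suc.prems in simp)
qed simp

lemma same_leafI_segment:
  assumes seg: "closed_segment z w \<subseteq> range \<Phi>" and eq: "fst z = fst w \<or> snd z = snd w"
  shows "(\<Psi> z, \<Psi> w) \<in> R"
proof -
  have zw: "\<Phi> (\<Psi> z) = z" "\<Phi> (\<Psi> w) = w" using seg by (auto intro!: \<Phi>_\<Psi>)
  have gh: "g (\<Psi> x) = fst x" "h (\<Psi> x) = snd x" if "x \<in> closed_segment z w" for x
    using that seg g_\<Psi> h_\<Psi> by blast+
  have "\<exists>L\<in>leaves g. \<Psi> z \<in> L \<and> \<Psi> w \<in> L" if "fst z = fst w"
  proof (rule same_leaf_if_segment; unfold zw)
    fix x assume x: "x \<in> closed_segment z w"
    then have "fst x = fst z" using that by (auto simp: closed_segment_def left_diff_distrib)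
    then show "g (\<Psi> x) = g (\<Psi> z)" using gh(1)[OF x] gh(1)[of z] by simp
  qed (rule seg)
  moreover have "\<exists>L\<in>leaves h. \<Psi> z \<in> L \<and> \<Psi> w \<in> L" if "snd z = snd w"
  proof (rule same_leaf_if_segment; unfold zw)
    fix x assume x: "x \<in> closed_segment z w"
    then have "snd x = snd z" using that by (auto simp: closed_segment_def left_diff_distrib)
    then show "h (\<Psi> x) = h (\<Psi> z)" using gh(2)[OF x] gh(2)[of z] by simp
  qed (rule seg)
  ultimately show ?thesis using eq unfolding same_leaf_def by blast
qed

subsection \<open>Descending a tentacle\<close>

text \<open>Logarithmic coordinates on the quadrant: 2s is the logarithm of the product, 2t that of
  the ratio. On leaves of \<open>g\<close> the difference s - t is constant, on leaves of
  \<open>h\<close> the sum s + t.\<close>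

definition pt :: "real \<Rightarrow> real \<Rightarrow> plane" where
  "pt s t = (exp (s - t), exp (s + t))"

lemma pt_in_range: "pt s t \<in> range \<Phi> \<longleftrightarrow> exp (2 * s) * osc t < 1"
proof -
  have "exp (s - t) * exp (s + t) = exp (2 * s)" by (simp flip: exp_add)
  moreover have "exp (s + t) / exp (s - t) = exp (2 * t)" by (simp flip: exp_diff)
  moreover have "pt s t \<in> quadrant" by (simp add: pt_def quadrant_def)
  ultimately show ?thesis
    unfolding range_\<Phi> using quadrant_subset_S by (auto simp: pt_def)
qed

lemma quadrant_eq_pt:
  assumes "z \<in> quadrant"
  obtains s t where "z = pt s t"
proof
  have "exp ((ln (fst z) + ln (snd z)) / 2 - (ln (snd z) - ln (fst z)) / 2) = fst z"
    "exp ((ln (fst z) + ln (snd z)) / 2 + (ln (snd z) - ln (fst z)) / 2) = snd z"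
    using assms by (simp_all add: quadrant_def field_simps)
  then show "z = pt ((ln (fst z) + ln (snd z)) / 2) ((ln (snd z) - ln (fst z)) / 2)"
    by (simp add: pt_def prod_eq_iff)
qed

text \<open>Here s + t is constant, so the path is a horizontal segment along which the first
  coordinate decreases.\<close>

lemma descend_right:
  assumes "0 \<le> v" and "\<And>v'. 0 \<le> v' \<Longrightarrow> v' \<le> v \<Longrightarrow> exp (2 * (s - v')) * osc (t + v') < 1"
  shows "(\<Psi> (pt s t), \<Psi> (pt (s - v) (t + v))) \<in> R"
proof (rule same_leafI_segment)
  show "closed_segment (pt s t) (pt (s - v) (t + v)) \<subseteq> range \<Phi>"
  proof
    fix z assume z: "z \<in> closed_segment (pt s t) (pt (s - v) (t + v))"
    have "fst z \<in> closed_segment (exp (s - t)) (exp (s - v - (t + v)))"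
      using z by (auto simp: closed_segment_def pt_def)
    then have fz: "exp (s - v - (t + v)) \<le> fst z" "fst z \<le> exp (s - t)"
      using \<open>0 \<le> v\<close> by (auto simp: closed_segment_eq_real_ivl split: if_splits)
    have sz: "snd z = exp (s + t)"
      using z by (auto simp: closed_segment_def pt_def algebra_simps)
    have "fst z > 0" using fz(1) by (meson exp_gt_zero less_le_trans)
    \<comment> \<open>At depth v' the first coordinate is exp(s - t - 2 v'); this is solved for
      v'.\<close>
    define v' where "v' = (s - t - ln (fst z)) / 2"
    have "fst z = exp (s - v' - (t + v'))" using \<open>fst z > 0\<close> by (simp add: v'_def)
    then have zpt: "z = pt (s - v') (t + v')" using sz by (simp add: pt_def prod_eq_iff)
    have "ln (fst z) \<le> s - t" using fz(2) \<open>fst z > 0\<close> using ln_le_cancel_iff[of "fst z" "exp (s - t)"] by simp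
    moreover have "s - v - (t + v) \<le> ln (fst z)" using fz(1) \<open>fst z > 0\<close> by (simp add: ln_ge_iff)
    ultimately have "0 \<le> v'" "v' \<le> v" by (auto simp: v'_def)
    then show "z \<in> range \<Phi>" unfolding zpt pt_in_range by (rule assms(2))
  qed
qed (simp add: pt_def)

lemma descend_left:
  assumes "0 \<le> v" and "\<And>v'. 0 \<le> v' \<Longrightarrow> v' \<le> v \<Longrightarrow> exp (2 * (s - v')) * osc (t - v') < 1"
  shows "(\<Psi> (pt s t), \<Psi> (pt (s - v) (t - v))) \<in> R"
proof (rule same_leafI_segment)
  show "closed_segment (pt s t) (pt (s - v) (t - v)) \<subseteq> range \<Phi>"
  proof
    fix z assume z: "z \<in> closed_segment (pt s t) (pt (s - v) (t - v))"
    have "snd z \<in> closed_segment (exp (s + t)) (exp (s - v + (t - v)))"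
      using z by (auto simp: closed_segment_def pt_def)
    then have sz: "exp (s - v + (t - v)) \<le> snd z" "snd z \<le> exp (s + t)"
      using \<open>0 \<le> v\<close> by (auto simp: closed_segment_eq_real_ivl split: if_splits)
    have fz: "fst z = exp (s - t)"
      using z by (auto simp: closed_segment_def pt_def algebra_simps)
    have "snd z > 0" using sz(1) by (meson exp_gt_zero less_le_trans)
    define v' where "v' = (s + t - ln (snd z)) / 2"
    have "snd z = exp (s - v' + (t - v'))" using \<open>snd z > 0\<close> by (simp add: v'_def)
    then have zpt: "z = pt (s - v') (t - v')" using fz by (simp add: pt_def prod_eq_iff)
    have "ln (snd z) \<le> s + t" using sz(2) \<open>snd z > 0\<close> using ln_le_cancel_iff[of "snd z" "exp (s + t)"] by simp
    moreover have "s - v + (t - v) \<le> ln (snd z)" using sz(1) \<open>snd z > 0\<close> by (simp add: ln_ge_iff)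
    ultimately have "0 \<le> v'" "v' \<le> v" by (auto simp: v'_def)
    then show "z \<in> range \<Phi>" unfolding zpt pt_in_range by (rule assms(2))
  qed
qed (simp add: pt_def)

text \<open>Towards the integer \<open>n\<close>, both s and the distance of t from \<open>n\<close>
  decrease, hence so do e^(2s) and \<open>osc\<close>, and the path cannot leave the region.\<close>

lemma descend_to_centre:
  assumes "pt s (of_int n + a) \<in> range \<Phi>" "\<bar>a\<bar> \<le> 1 / 2"
  shows "(\<Psi> (pt s (of_int n + a)), \<Psi> (pt (s - \<bar>a\<bar>) (of_int n))) \<in> R"
proof -
  have less: "exp (2 * (s - v)) * osc (of_int n + b) < 1" if "0 \<le> v" "\<bar>b\<bar> \<le> \<bar>a\<bar>" for v b
  proof -
    have "exp (2 * (s - v)) * osc b \<le> exp (2 * s) * osc a"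
      using that assms(2) osc_bounds(2)[of b] by (intro mult_mono osc_mono) auto
    also have "\<dots> < 1" using assms(1) unfolding pt_in_range osc_shift .
    finally show ?thesis by (simp add: osc_shift)
  qed
  show ?thesis
  proof (cases "a \<ge> 0")
    case True
    have "(\<Psi> (pt s (of_int n + a)), \<Psi> (pt (s - a) (of_int n + a - a))) \<in> R"
    proof (rule descend_left)
      fix v assume "0 \<le> v" "v \<le> a"
      then show "exp (2 * (s - v)) * osc (of_int n + a - v) < 1"
        using less[of v "a - v"] by (simp add: add_diff_eq)
    qed (rule True)
    then show ?thesis using True by simp
  next
    case False
    have "(\<Psi> (pt s (of_int n + a)), \<Psi> (pt (s - - a) (of_int n + a + - a))) \<in> R"
    proof (rule descend_right)
      fix v assume "0 \<le> v" "v \<le> - a"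
      then show "exp (2 * (s - v)) * osc (of_int n + a + v) < 1"
        using less[of v "a + v"] by (simp add: add.assoc)
    qed (use False in simp)
    then show ?thesis using False by simp
  qed
qed

text \<open>One round goes out to t = n + \<delta>/4 and back; each leg lowers s by \<delta>/4. The
  outward leg meets growing \<open>osc\<close>, and \<delta>/4 is the length up to which the descent
  compensates for this.\<close>

lemma zigzag:
  assumes "pt s (of_int n) \<in> range \<Phi>"
  shows "(\<Psi> (pt s (of_int n)), \<Psi> (pt (s - real k * (\<delta> / 2)) (of_int n))) \<in> R ^^ (2 * k)"
proof (induction k)
  case (Suc k)
  define s' where "s' = s - real k * (\<delta> / 2)"
  have "exp (2 * s') * \<delta> \<le> exp (2 * s) * \<delta>" using \<delta> by (simp add: s'_def)
  also have "\<dots> < 1" using assms osc_shift[of n 0] by (simp add: pt_in_range osc_def)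
  finally have s': "exp (2 * s') * \<delta> < 1" .
  have less: "exp (2 * (s' - v)) * osc (of_int n + v) < 1" if "0 \<le> v" "v \<le> \<delta> / 4" for v
  proof -
    have "exp (2 * (s' - v)) * osc v \<le> exp (2 * (s' - v)) * (\<delta> * exp (2 * v))"
      by (intro mult_left_mono osc_near_0 that) simp
    also have "\<dots> = exp (2 * s') * \<delta>" by (simp add: algebra_simps flip: exp_add)
    finally show ?thesis using s' by (simp add: osc_shift)
  qed
  have 1: "(\<Psi> (pt s' (of_int n)), \<Psi> (pt (s' - \<delta> / 4) (of_int n + \<delta> / 4))) \<in> R"
    using \<delta> by (intro descend_right less) auto
  have "pt (s' - \<delta> / 4) (of_int n + \<delta> / 4) \<in> range \<Phi>"
    unfolding pt_in_range using \<delta> by (intro less) auto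
  then have "(\<Psi> (pt (s' - \<delta> / 4) (of_int n + \<delta> / 4)), \<Psi> (pt (s' - \<delta> / 4 - \<bar>\<delta> / 4\<bar>) (of_int n))) \<in> R"
    using \<delta> by (intro descend_to_centre) auto
  moreover have "s' - \<delta> / 4 - \<bar>\<delta> / 4\<bar> = s - real (Suc k) * (\<delta> / 2)"
    using \<delta> by (simp add: s'_def algebra_simps)
  ultimately have 2: "(\<Psi> (pt (s' - \<delta> / 4) (of_int n + \<delta> / 4)), \<Psi> (pt (s - real (Suc k) * (\<delta> / 2)) (of_int n))) \<in> R"
    by simp
  from Suc 1 2 show ?case
    unfolding s'_def by (auto intro: relpow_Suc_I)
qed simp

text \<open>One leaf to the centre line, where e^(2s) < 1/\<delta>, and then rounds of two leaves,
  each lowering 2s by \<delta>, until the product is below 1. The number depends on \<delta>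
  alone.\<close>

definition steps :: nat where
  "steps = 1 + 2 * nat \<lceil>ln (1 / \<delta>) / \<delta>\<rceil>"

subsection \<open>Crossing the body\<close>

text \<open>The tentacles are cut off along the hyperbola ab = 1. Since osc < 1, the rest satisfies
  the condition on the region whatever t is.\<close>

definition body :: "plane set" where
  "body = {z \<in> S. z \<in> quadrant \<longrightarrow> fst z * snd z < 1}"

lemma body_subset: "body \<subseteq> range \<Phi>"
proof
  fix z assume "z \<in> body"
  then show "z \<in> range \<Phi>"
    unfolding range_\<Phi> body_def
  proof (intro CollectI conjI impI; elim CollectE conjE)
    assume "z \<in> quadrant" and "z \<in> quadrant \<longrightarrow> fst z * snd z < 1"
    then have pos: "fst z * snd z > 0" and less: "fst z * snd z < 1"
      by (auto simp: quadrant_def)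
    have "fst z * snd z * osc (ln (snd z / fst z) / 2) \<le> fst z * snd z * 1"
      using pos osc_bounds(3) by (intro mult_left_mono) (auto intro: less_imp_le)
    then show "fst z * snd z * osc (ln (snd z / fst z) / 2) < 1" using less by simp
  qed
qed

lemma reach_body:
  obtains q where "(p, q) \<in> R ^^ steps" "\<Phi> q \<in> body"
proof (cases "\<Phi> p \<in> quadrant")
  case False
  have "\<Phi> p \<in> range \<Phi>" by simp
  then have "\<Phi> p \<in> body" using False by (simp add: range_\<Phi> body_def)
  moreover have "(p, p) \<in> R ^^ steps" by (rule relpow_R_mono[of _ _ 0]) auto
  ultimately show ?thesis using that by blast
next
  case True
  then obtain s t where st: "\<Phi> p = pt s t" by (rule quadrant_eq_pt)
  define n where "n = round t"
  define a where "a = t - of_int n"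
  define k where "k = nat \<lceil>ln (1 / \<delta>) / \<delta>\<rceil>"
  define s1 where "s1 = s - \<bar>a\<bar>"
  define q where "q = \<Psi> (pt (s1 - real k * (\<delta> / 2)) (of_int n))"
  have t: "t = of_int n + a" by (simp add: a_def)
  have "\<bar>a\<bar> \<le> 1 / 2" unfolding a_def n_def using of_int_round_abs_le[of t] by (simp add: abs_minus_commute)
  have pr: "pt s (of_int n + a) \<in> range \<Phi>" using st by (metis t rangeI)
  have "p = \<Psi> (pt s (of_int n + a))" using st by (metis t \<Psi>_\<Phi>)
  then have 1: "(p, \<Psi> (pt s1 (of_int n))) \<in> R"
    using descend_to_centre[OF pr \<open>\<bar>a\<bar> \<le> 1 / 2\<close>] by (simp add: s1_def)
  have "exp (2 * s1) * osc 0 \<le> exp (2 * s) * osc a"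
    using osc_bounds(2)[of 0] \<open>\<bar>a\<bar> \<le> 1 / 2\<close> by (intro mult_mono osc_mono) (auto simp: s1_def)
  also have "\<dots> < 1" using pr by (simp add: pt_in_range osc_shift)
  finally have s1: "exp (2 * s1) * osc 0 < 1" .
  then have s1r: "pt s1 (of_int n) \<in> range \<Phi>" using osc_shift[of n 0] by (simp add: pt_in_range)
  have "(p, q) \<in> R ^^ (1 + 2 * k)"
    using relpow_Suc_I2[OF 1 zigzag[OF s1r, of k]] by (simp add: q_def)
  moreover have "exp (2 * (s1 - real k * (\<delta> / 2))) < 1"
  proof -
    have "exp (2 * s1) < 1 / \<delta>" using s1 \<delta> by (simp add: osc_def field_simps)
    then have "ln (exp (2 * s1)) < ln (1 / \<delta>)" using \<delta> by (subst ln_less_cancel_iff) auto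
    also have "ln (1 / \<delta>) \<le> real k * \<delta>"
    proof -
      have "ln (1 / \<delta>) / \<delta> \<le> real k" unfolding k_def by linarith
      then show ?thesis using \<delta> by (simp add: pos_divide_le_eq)
    qed
    finally show ?thesis by simp
  qed
  then have "\<Phi> q \<in> body"
  proof -
    let ?z = "pt (s1 - real k * (\<delta> / 2)) (of_int n)"
    assume less: "exp (2 * (s1 - real k * (\<delta> / 2))) < 1"
    have "?z \<in> quadrant" by (simp add: pt_def quadrant_def)
    moreover have "fst ?z * snd ?z = exp (2 * (s1 - real k * (\<delta> / 2)))"
      by (simp add: pt_def flip: exp_add)
    ultimately have "?z \<in> body" using less quadrant_subset_S by (auto simp: body_def)
    then show ?thesis using body_subset \<Phi>_\<Psi> by (auto simp: q_def)
  qed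
  ultimately show ?thesis using that by (simp add: steps_def k_def)
qed

text \<open>The product is affine along an axis-parallel segment, so a bound at the ends persists.
  The other alternative covers segments with nonpositive first coordinate, where the product may be
  large but the quadrant is never met.\<close>

lemma body_segment:
  assumes S: "z \<in> S" "w \<in> S" and eq: "fst z = fst w \<or> snd z = snd w"
    and less: "(fst z \<le> 0 \<and> fst w \<le> 0) \<or> (fst z * snd z < 1 \<and> fst w * snd w < 1)"
  shows "closed_segment z w \<subseteq> range \<Phi>"
proof (rule order_trans[OF _ body_subset], rule subsetI)
  fix x assume "x \<in> closed_segment z w"
  then obtain u where u: "0 \<le> u" "u \<le> 1" "x = (1 - u) *\<^sub>R z + u *\<^sub>R w"
    by (auto simp: closed_segment_def)
  have fx: "fst x = (1 - u) * fst z + u * fst w" and sx: "snd x = (1 - u) * snd z + u * snd w"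
    using u(3) by simp_all
  have comb: "(1 - u) * a + u * b < c" if "a < c" "b < c" for a b c
    using convex_bound_lt[OF that, of "1 - u" u] u by simp
  have "x \<in> S"
  proof -
    have "(1 - u) * a + u * b > 0" if "a > 0" "b > 0" for a b
      using comb[of "- a" 0 "- b"] that by (simp add: algebra_simps)
    then show ?thesis using S_cases S fx sx by (auto simp: quadrant_def)
  qed
  moreover have "fst x * snd x < 1" if "x \<in> quadrant"
  proof -
    have "\<not> (fst z \<le> 0 \<and> fst w \<le> 0)"
    proof
      assume "fst z \<le> 0 \<and> fst w \<le> 0"
      then have "(1 - u) * fst z \<le> 0" "u * fst w \<le> 0" using u by (auto simp: mult_nonneg_nonpos)
      then show False using that fx by (simp add: quadrant_def)
    qed
    then have "(1 - u) * (fst z * snd z) + u * (fst w * snd w) < 1"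
      using less by (intro comb) auto
    moreover have "fst x * snd x = (1 - u) * (fst z * snd z) + u * (fst w * snd w)"
      using eq
    proof
      assume e: "fst z = fst w"
      then have "fst x = fst z" by (simp add: fx algebra_simps)
      then show ?thesis using e by (simp add: sx algebra_simps)
    next
      assume e: "snd z = snd w"
      then have "snd x = snd z" by (simp add: sx algebra_simps)
      then show ?thesis using e by (simp add: fx algebra_simps)
    qed
    ultimately show ?thesis by simp
  qed
  ultimately show "x \<in> body" by (simp add: body_def)
qed

text \<open>Vertically to a common height, horizontally, and vertically again. The height is
  positive, so that it also exists when \<open>S\<close> is the quadrant, and so small that both
  corners have product below 1.\<close>

lemma cross_body:
  assumes p: "\<Phi> p \<in> body" and q: "\<Phi> q \<in> body"
  shows "(p, q) \<in> R ^^ 3"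
proof -
  define \<epsilon> where "\<epsilon> = inverse (2 + \<bar>g p\<bar> + \<bar>g q\<bar>)"
  have \<epsilon>: "\<epsilon> > 0" by (simp add: \<epsilon>_def add_pos_nonneg)
  have less: "a * \<epsilon> < 1" if "\<bar>a\<bar> \<le> \<bar>g p\<bar> + \<bar>g q\<bar>" for a
  proof -
    have "a < 2 + \<bar>g p\<bar> + \<bar>g q\<bar>" using that by linarith
    then show ?thesis unfolding \<epsilon>_def by (simp add: divide_less_eq add_pos_nonneg flip: divide_inverse)
  qed
  have \<epsilon>S: "(g x, \<epsilon>) \<in> S" if "\<Phi> x \<in> S" for x
  proof (cases "S = UNIV")
    case False
    then have "S = quadrant" using S_cases by simp
    then show ?thesis using that \<epsilon> by (simp add: quadrant_def \<Phi>_def)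
  qed simp
  have pS: "\<Phi> p \<in> S" "\<Phi> q \<in> S" using p q by (auto simp: body_def)
  have vertical: "closed_segment (\<Phi> x) (g x, \<epsilon>) \<subseteq> range \<Phi>"
    if "\<Phi> x \<in> body" "\<bar>g x\<bar> \<le> \<bar>g p\<bar> + \<bar>g q\<bar>" for x
  proof (rule body_segment)
    show "(fst (\<Phi> x) \<le> 0 \<and> fst (g x, \<epsilon>) \<le> 0) \<or>
        (fst (\<Phi> x) * snd (\<Phi> x) < 1 \<and> fst (g x, \<epsilon>) * snd (g x, \<epsilon>) < 1)"
    proof (cases "g x \<le> 0")
      case False
      have "g x * h x < 1"
      proof (cases "h x > 0")
        case True
        then have "\<Phi> x \<in> quadrant" using False by (simp add: \<Phi>_def quadrant_def)
        then show ?thesis using that(1) unfolding body_def by (simp add: \<Phi>_def)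
      next
        case f: False
        then have "g x * h x \<le> 0" using False by (simp add: mult_nonneg_nonpos)
        then show ?thesis by simp
      qed
      then show ?thesis using less that(2) by (simp add: \<Phi>_def)
    qed (simp add: \<Phi>_def)
  qed (use that \<epsilon>S[of x] in \<open>auto simp: body_def \<Phi>_def\<close>)
  have horizontal: "closed_segment (g p, \<epsilon>) (g q, \<epsilon>) \<subseteq> range \<Phi>"
    using \<epsilon>S pS less by (intro body_segment) auto
  have 1: "(p, \<Psi> (g p, \<epsilon>)) \<in> R"
    using same_leafI_segment[OF vertical[OF p]] unfolding \<Psi>_\<Phi> by (simp add: \<Phi>_def)
  have 2: "(\<Psi> (g p, \<epsilon>), \<Psi> (g q, \<epsilon>)) \<in> R"
    using same_leafI_segment[OF horizontal] by simp
  have "(q, \<Psi> (g q, \<epsilon>)) \<in> R"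
    using same_leafI_segment[OF vertical[OF q]] unfolding \<Psi>_\<Phi> by (simp add: \<Phi>_def)
  then have 3: "(\<Psi> (g q, \<epsilon>), q) \<in> R" using sym_R by (meson symD)
  show ?thesis
    unfolding numeral_3_eq_3 using 1 2 3 by (meson relpow_Suc_I2 relpow_0_I)
qed

lemma degree_finite: "degree_of_inaccessibility (leaves h) (leaves g) < \<infinity>"
proof -
  have "access_number (leaves h) (leaves g) p q \<le> enat (steps + 3 + steps)" for p q
  proof (rule access_number_le)
    obtain p' where p': "(p, p') \<in> R ^^ steps" "\<Phi> p' \<in> body" by (rule reach_body)
    obtain q' where q': "(q, q') \<in> R ^^ steps" "\<Phi> q' \<in> body" by (rule reach_body)
    have "(q', q) \<in> R ^^ steps" using sym_R q'(1) by (rule relpow_sym)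
    then have "(p, q) \<in> R ^^ steps O R ^^ 3 O R ^^ steps"
      using p' q' cross_body by blast
    then show "accessible (leaves h) (leaves g) (steps + 3 + steps) p q"
      unfolding accessible_iff_relpow relpow_add O_assoc .
  qed
  then have "degree_of_inaccessibility (leaves h) (leaves g) \<le> enat (steps + 3 + steps)"
    unfolding degree_of_inaccessibility_def by (auto intro: SUP_least)
  then show ?thesis by (rule le_less_trans) simp
qed

end

subsection \<open>The two examples\<close>

lemma bounded_box: "bounded {p :: plane. \<bar>fst p\<bar> \<le> B \<and> \<bar>snd p\<bar> \<le> B}"
proof (rule bounded_subset)
  show "bounded ({-B..B} \<times> {-B..B})"
    by (intro bounded_Times) auto
qed auto

lemma smooth_fst: "smooth (fst :: plane \<Rightarrow> real)" and smooth_snd: "smooth (snd :: plane \<Rightarrow> real)"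
  by (intro smooth_bounded_linear bounded_linear_fst bounded_linear_snd)+

lemma frechet_derivative_fst: "frechet_derivative (fst :: plane \<Rightarrow> real) (at p) = fst"
  and frechet_derivative_snd: "frechet_derivative (snd :: plane \<Rightarrow> real) (at p) = snd"
  by (auto intro!: frechet_derivative_at[symmetric] derivative_eq_intros)

lemma tentacle_plane_with_fixed_point:
  assumes \<delta>: "0 < \<delta>" "\<delta> \<le> 1 / 8"
  shows "tentacle_plane \<delta> fst snd (\<lambda>z. (fst z * snd z)\<^sup>2)
    (\<lambda>z. (exp (- 1) * fst z, exp 1 * snd z)) (\<lambda>z. (exp 1 * fst z, exp (- 1) * snd z))"
proof
  show "0 < \<delta>" "\<delta> \<le> 1 / 8" by fact+
  show "smooth (fst :: plane \<Rightarrow> real)" "smooth (snd :: plane \<Rightarrow> real)"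
    by (rule smooth_fst smooth_snd)+
  show "smooth (\<lambda>z :: plane. (fst z * snd z)\<^sup>2)"
    by (intro smooth_power smooth_mult smooth_fst smooth_snd)
  show "p = q" if "fst p = fst q" "snd p = snd q" for p q :: plane
    using that by (rule prod_eqI)
  show "v = 0" if "frechet_derivative fst (at p) v = 0" "frechet_derivative snd (at p) v = 0" for p v :: plane
    using that by (simp add: frechet_derivative_fst frechet_derivative_snd prod_eq_iff)
  show "range (\<lambda>p :: plane. (fst p, snd p)) = UNIV \<or> range (\<lambda>p. (fst p, snd p)) = quadrant"
    by (auto simp: image_iff)
  show "(fst p * snd p)\<^sup>2 \<le> (fst p * snd p)\<^sup>2" for p :: plane by simp
  show "\<bar>frechet_derivative (\<lambda>z. (fst z * snd z)\<^sup>2) (at p) v\<bar> \<le> 4 * (1 + (fst p * snd p)\<^sup>2)\<^sup>2 *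
     \<bar>fst p * frechet_derivative snd (at p) v + snd p * frechet_derivative fst (at p) v\<bar>" for p v :: plane
  proof -
    let ?P = "fst p * snd p" and ?d = "fst p * snd v + snd p * fst v"
    have "((\<lambda>z. (fst z * snd z)\<^sup>2) has_derivative (\<lambda>v. 2 * ?P * (fst p * snd v + snd p * fst v))) (at p)"
      by (auto intro!: derivative_eq_intros simp: fun_eq_iff power2_eq_square algebra_simps)
    then have eq: "frechet_derivative (\<lambda>z. (fst z * snd z)\<^sup>2) (at p) v = 2 * ?P * ?d"
      by (rule frechet_derivative_at[symmetric, THEN fun_cong])
    have "0 \<le> (\<bar>?P\<bar> - 1)\<^sup>2" by simp
    then have "2 * \<bar>?P\<bar> \<le> 1 + ?P\<^sup>2" by (simp add: power2_diff)
    also have "\<dots> \<le> (1 + ?P\<^sup>2)\<^sup>2" by (intro self_le_power) auto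
    also have "\<dots> \<le> 4 * (1 + ?P\<^sup>2)\<^sup>2" by simp
    finally have "2 * \<bar>?P\<bar> * \<bar>?d\<bar> \<le> 4 * (1 + ?P\<^sup>2)\<^sup>2 * \<bar>?d\<bar>"
      by (rule mult_right_mono) simp
    then show ?thesis
      unfolding eq frechet_derivative_fst frechet_derivative_snd by (simp add: abs_mult)
  qed
  show "bounded {p. \<bar>fst p\<bar> \<le> B \<and> \<bar>snd p\<bar> \<le> B \<and> (fst p * snd p)\<^sup>2 \<le> B}" for B :: real
    by (rule bounded_subset[OF bounded_box[of B]]) auto
  show "smooth (\<lambda>z :: plane. (exp (- 1) * fst z, exp 1 * snd z))"
    "smooth (\<lambda>z :: plane. (exp 1 * fst z, exp (- 1) * snd z))"
    by (intro smooth_Pair smooth_mult smooth_const smooth_fst smooth_snd)+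
qed (simp_all add: exp_minus field_simps)

text \<open>The exponential maps the plane onto the quadrant and turns the linear map into a
  translation. With P = XY, \<open>V\<close> is P^2 + P^(-2): the second term grows towards the
  axes, which are now part of the boundary.\<close>

lemma tentacle_plane_fixed_point_free:
  assumes \<delta>: "0 < \<delta>" "\<delta> \<le> 1 / 8"
  shows "tentacle_plane \<delta> (\<lambda>z. exp (fst z)) (\<lambda>z. exp (snd z))
    (\<lambda>z. exp (2 * (fst z + snd z)) + exp (- 2 * (fst z + snd z)))
    (\<lambda>z. (fst z + - 1, snd z + 1)) (\<lambda>z. (fst z + 1, snd z + - 1))"
proof
  have dX: "frechet_derivative (\<lambda>z :: plane. exp (fst z)) (at p) = (\<lambda>v. exp (fst p) * fst v)" for p
    by (auto intro!: frechet_derivative_at[symmetric] derivative_eq_intros)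
  have dY: "frechet_derivative (\<lambda>z :: plane. exp (snd z)) (at p) = (\<lambda>v. exp (snd p) * snd v)" for p
    by (auto intro!: frechet_derivative_at[symmetric] derivative_eq_intros)
  show "0 < \<delta>" "\<delta> \<le> 1 / 8" by fact+
  show "smooth (\<lambda>z :: plane. exp (fst z))" "smooth (\<lambda>z :: plane. exp (snd z))"
    by (intro smooth_exp smooth_fst smooth_snd)+
  show "smooth (\<lambda>z :: plane. exp (2 * (fst z + snd z)) + exp (- 2 * (fst z + snd z)))"
    by (intro smooth_add smooth_exp smooth_mult smooth_const smooth_fst smooth_snd)
  show "p = q" if "exp (fst p) = exp (fst q)" "exp (snd p) = exp (snd q)" for p q :: plane
    using that by (simp add: prod_eq_iff)
  show "v = 0" if "frechet_derivative (\<lambda>z. exp (fst z)) (at p) v = 0"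
      "frechet_derivative (\<lambda>z. exp (snd z)) (at p) v = 0" for p v :: plane
    using that by (simp add: dX dY prod_eq_iff)
  have "range (\<lambda>p :: plane. (exp (fst p), exp (snd p))) = quadrant"
  proof (intro equalityI subsetI)
    fix z assume "z \<in> quadrant"
    then have "z = (\<lambda>p :: plane. (exp (fst p), exp (snd p))) (ln (fst z), ln (snd z))"
      by (simp add: quadrant_def prod_eq_iff)
    then show "z \<in> range (\<lambda>p :: plane. (exp (fst p), exp (snd p)))" by (rule range_eqI)
  qed (auto simp: quadrant_def)
  then show "range (\<lambda>p :: plane. (exp (fst p), exp (snd p))) = UNIV
      \<or> range (\<lambda>p :: plane. (exp (fst p), exp (snd p))) = quadrant" ..
  show "(exp (fst p) * exp (snd p))\<^sup>2 \<le> exp (2 * (fst p + snd p)) + exp (- 2 * (fst p + snd p))" for p :: plane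
    by (simp add: power2_eq_square flip: exp_add)
  show "\<bar>frechet_derivative (\<lambda>z. exp (2 * (fst z + snd z)) + exp (- 2 * (fst z + snd z))) (at p) v\<bar>
     \<le> 4 * (1 + (exp (2 * (fst p + snd p)) + exp (- 2 * (fst p + snd p))))\<^sup>2 *
     \<bar>exp (fst p) * frechet_derivative (\<lambda>z. exp (snd z)) (at p) v
      + exp (snd p) * frechet_derivative (\<lambda>z. exp (fst z)) (at p) v\<bar>" for p v :: plane
  proof -
    define t where "t = fst p + snd p"
    define V where "V = exp (2 * t) + exp (- 2 * t)"
    let ?d = "fst v + snd v"
    have "((\<lambda>z. exp (2 * (fst z + snd z)) + exp (- 2 * (fst z + snd z))) has_derivative
        (\<lambda>v. 2 * (exp (2 * t) - exp (- 2 * t)) * (fst v + snd v))) (at p)"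
      unfolding t_def by (auto intro!: derivative_eq_intros simp: algebra_simps)
    then have eq: "frechet_derivative (\<lambda>z. exp (2 * (fst z + snd z)) + exp (- 2 * (fst z + snd z))) (at p) v
        = 2 * (exp (2 * t) - exp (- 2 * t)) * ?d"
      by (rule frechet_derivative_at[symmetric, THEN fun_cong])
    have eq': "exp (fst p) * (exp (snd p) * snd v) + exp (snd p) * (exp (fst p) * fst v) = exp t * ?d"
      by (simp add: t_def exp_add algebra_simps)
    have V: "0 < V" by (simp add: V_def add_pos_pos)
    \<comment> \<open>The bound on dV is measured against d(XY), which carries the factor e^t. When
      this is small, the term e^(-2t) of \<open>V\<close> pays for it; hence the square of 1 + V in
      the bound.\<close>
    have "1 \<le> (1 + V) * exp t"
    proof -
      have "1 + t \<le> exp t" "1 + - t \<le> exp (- t)" by (rule exp_ge_add_one_self)+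
      then have "1 \<le> exp t + exp (- t)" by linarith
      also have "exp (- t) = exp (- 2 * t) * exp t" by (simp flip: exp_add)
      also have "exp t + exp (- 2 * t) * exp t \<le> (1 + V) * exp t"
        by (simp add: V_def algebra_simps)
      finally show ?thesis .
    qed
    then have "V * 1 \<le> (1 + V) * ((1 + V) * exp t)" using V by (intro mult_mono) auto
    moreover have "\<bar>exp (2 * t) - exp (- 2 * t)\<bar> \<le> V"
      unfolding V_def using exp_gt_zero[of "2 * t"] exp_gt_zero[of "- 2 * t"] by linarith
    ultimately have "\<bar>exp (2 * t) - exp (- 2 * t)\<bar> \<le> (1 + V)\<^sup>2 * exp t"
      by (simp add: power2_eq_square mult.assoc)
    also have "\<dots> \<le> 2 * ((1 + V)\<^sup>2 * exp t)" by simp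
    finally have "2 * \<bar>exp (2 * t) - exp (- 2 * t)\<bar> * \<bar>?d\<bar> \<le> 2 * (2 * ((1 + V)\<^sup>2 * exp t)) * \<bar>?d\<bar>"
      by (intro mult_right_mono mult_left_mono) auto
    moreover have "\<bar>2 * x * y\<bar> = 2 * \<bar>x\<bar> * \<bar>y\<bar>" for x y :: real by (simp add: abs_mult)
    moreover have "4 * x * \<bar>exp t * y\<bar> = 2 * (2 * (x * exp t)) * \<bar>y\<bar>" for x y :: real
      by (simp add: abs_mult)
    ultimately show ?thesis
      unfolding eq dX dY eq' t_def[symmetric] V_def[symmetric] by (simp only:)
  qed
  show "bounded {p. \<bar>exp (fst p)\<bar> \<le> B \<and> \<bar>exp (snd p)\<bar> \<le> B \<and>
      exp (2 * (fst p + snd p)) + exp (- 2 * (fst p + snd p)) \<le> B}" for B :: real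
  proof (rule bounded_subset[OF bounded_box[of "2 * \<bar>B\<bar>"]], intro subsetI CollectI)
    fix p :: plane
    assume "p \<in> {p. \<bar>exp (fst p)\<bar> \<le> B \<and> \<bar>exp (snd p)\<bar> \<le> B \<and>
      exp (2 * (fst p + snd p)) + exp (- 2 * (fst p + snd p)) \<le> B}"
    then have "exp (fst p) \<le> B" "exp (snd p) \<le> B"
      "exp (2 * (fst p + snd p)) + exp (- 2 * (fst p + snd p)) \<le> B" by auto
    moreover have "x < exp x" for x :: real using exp_ge_add_one_self[of x] by linarith
    note this[of "fst p"] this[of "snd p"] this[of "- 2 * (fst p + snd p)"]
    \<comment> \<open>Upper bounds on both coordinates and a lower bound on their sum bound each
      coordinate from below.\<close>
    ultimately have "fst p < B" "snd p < B" "- 2 * (fst p + snd p) < B" "0 < B"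
      using exp_gt_zero[of "2 * (fst p + snd p)"] exp_gt_zero[of "fst p"] by linarith+
    then show "\<bar>fst p\<bar> \<le> 2 * \<bar>B\<bar> \<and> \<bar>snd p\<bar> \<le> 2 * \<bar>B\<bar>"
      by (simp add: abs_le_iff)
  qed
  show "smooth (\<lambda>z :: plane. (fst z + - 1, snd z + 1))" "smooth (\<lambda>z :: plane. (fst z + 1, snd z + - 1))"
    by (intro smooth_Pair smooth_add smooth_const smooth_fst smooth_snd)+
qed (simp_all add: add.commute flip: exp_add)

theorem mainTheorem2:
  fixes N :: nat
  assumes "N > 0"
  shows "(\<exists>f \<mu> Fs Fu. anosov_structure f \<mu> Fs Fu \<and>
            enat N \<le> degree_of_inaccessibility Fs Fu \<and> degree_of_inaccessibility Fs Fu < \<infinity> \<and>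
            (\<forall>p. f p \<noteq> p)) \<and>
         (\<exists>f \<mu> Fs Fu. anosov_structure f \<mu> Fs Fu \<and>
            enat N \<le> degree_of_inaccessibility Fs Fu \<and> degree_of_inaccessibility Fs Fu < \<infinity> \<and>
            (\<exists>p. f p = p))"
proof -
  \<comment> \<open>Then 4 e^N \<delta> = 1/2, so a tentacle reaches the product 4 e^N.\<close>
  define \<delta> where "\<delta> = exp (- real N) / 8"
  have \<delta>: "0 < \<delta>" "\<delta> \<le> 1 / 8" by (simp_all add: \<delta>_def)
  have N: "4 * exp (real N) * \<delta> < 1" by (simp add: \<delta>_def exp_minus)
  interpret free: tentacle_plane \<delta> "\<lambda>z. exp (fst z)" "\<lambda>z. exp (snd z)"
    "\<lambda>z. exp (2 * (fst z + snd z)) + exp (- 2 * (fst z + snd z))"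
    "\<lambda>z. (fst z + - 1, snd z + 1)" "\<lambda>z. (fst z + 1, snd z + - 1)"
    by (rule tentacle_plane_fixed_point_free[OF \<delta>])
  interpret fixed: tentacle_plane \<delta> fst snd "\<lambda>z. (fst z * snd z)\<^sup>2"
    "\<lambda>z. (exp (- 1) * fst z, exp 1 * snd z)" "\<lambda>z. (exp 1 * fst z, exp (- 1) * snd z)"
    by (rule tentacle_plane_with_fixed_point[OF \<delta>])
  have "(\<lambda>z :: plane. (fst z + - 1, snd z + 1)) p \<noteq> p" for p
    by (simp add: prod_eq_iff)
  moreover have "(\<lambda>z :: plane. (exp (- 1) * fst z, exp 1 * snd z)) (0, 0) = (0, 0)" by simp
  ultimately show ?thesis
    using free.anosov free.degree_ge[OF N] free.degree_finite
      fixed.anosov fixed.degree_ge[OF N] fixed.degree_finite by blast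
qed

end
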